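(* Let $\{x_n^{\mathrm{stat}}(t),\ n\in\mathbb{Z},\ t\ge 0\}$ be the system of one-sided reflected Brownian motions with random initial condition $x_0^{\mathrm{stat}}(0)=0$ and $x_n^{\mathrm{stat}}(0)-x_{n-1}^{\mathrm{stat}}(0)=\zeta_n$ for all $n\in\mathbb{Z}$, where $(\zeta_n)_{n\in\mathbb{Z}}$ are i.i.d. exponential random variables with parameter $1$, independent of the driving Brownian motions. Then for every $a>0$, $$\lim_{t\to\infty} t^{-1}\log \mathbb{P}\left(x_t^{\mathrm{stat}}(t)\ge 2t+at\right)=-r^{\mathrm{stat}}(a)$$ (the limit exists, $t$ running through the positive integers), where $$r^{\mathrm{stat}}(a)=-\frac{a^2}{4}+\left(1+\frac{a}{2}\right)\sqrt{a+\frac{a^2}{4}}+\log\left(1+\frac{a}{2}-\sqrt{a+\frac{a^2}{4}}\right).$$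
   Context: Dynamics. Let $\{B_n,\ n\in\mathbb{Z}\}$ be independent standard Brownian motions started at $0$. For a (possibly random, independent of the $B_n$) initial condition $(x_n(0))_{n\in\mathbb{Z}}$ with $x_n(0)\ge x_{n-1}(0)$, the system of one-sided reflected Brownian motions is the one in which $x_n$ is driven by $B_n$ and is reflected off $x_{n-1}$ in the positive direction (Skorokhod reflection), so that $x_n(t)\ge x_{n-1}(t)$ for all $t$ and $x_{n-1}$ is not influenced by $x_n$. Explicitly, $$x_n(t)=\sup_{k\le n}\Big\{x_k(0)+Y_{k,n}(t)\Big\},\qquad Y_{k,n}(t)=\sup_{0=s_{k-1}\le s_k\le\dots\le s_{n-1}\le s_n=t}\ \sum_{i=k}^{n}\big(B_i(s_i)-B_i(s_{i-1})\big),$$ which is almost surely finite and well defined for the initial condition considered. *)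

theory Defs
  imports "HOL-Probability.Probability"
begin

definition standard_brownian_motion :: "'a measure \<Rightarrow> (real \<Rightarrow> 'a \<Rightarrow> real) \<Rightarrow> bool" where
  "standard_brownian_motion M W \<longleftrightarrow>
     (\<forall>t\<ge>0. W t \<in> borel_measurable M) \<and>
     (\<forall>\<omega>\<in>space M. W 0 \<omega> = 0) \<and>
     (\<forall>\<omega>\<in>space M. continuous_on {0..} (\<lambda>t. W t \<omega>)) \<and>
     (\<forall>s t. 0 \<le> s \<longrightarrow> s < t \<longrightarrow>
        distributed M lborel (\<lambda>\<omega>. W t \<omega> - W s \<omega>) (normal_density 0 (sqrt (t - s)))) \<and>
     (\<forall>\<tau> :: nat \<Rightarrow> real. 0 \<le> \<tau> 0 \<longrightarrow> mono \<tau> \<longrightarrow>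
        prob_space.indep_vars M (\<lambda>_. borel) (\<lambda>i \<omega>. W (\<tau> (Suc i)) \<omega> - W (\<tau> i) \<omega>) UNIV)"

text \<open>The trajectory of a process as a random element of the product space over times \<open>t \<ge> 0\<close>;
  used to express independence of whole processes.\<close>

abbreviation path_space :: "(real \<Rightarrow> real) measure" where
  "path_space \<equiv> PiM {0..} (\<lambda>_. borel)"

definition trajectory :: "(real \<Rightarrow> 'a \<Rightarrow> real) \<Rightarrow> 'a \<Rightarrow> real \<Rightarrow> real" where
  "trajectory W \<omega> = (\<lambda>t\<in>{0..}. W t \<omega>)"

text \<open>Only the values \<open>s (k - 1), \<dots>, s n\<close> of a time sequence are relevant.\<close>

definition jump_times :: "int \<Rightarrow> int \<Rightarrow> real \<Rightarrow> (int \<Rightarrow> real) set" where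
  "jump_times k n t = {s. s (k - 1) = 0 \<and> s n = t \<and> (\<forall>i\<in>{k..n}. s (i - 1) \<le> s i)}"

text \<open>The suprema are taken in the extended reals, so that they are meaningful
  for every realisation \<open>b\<close> of the driving paths and not just almost surely.\<close>

definition last_passage :: "(int \<Rightarrow> real \<Rightarrow> real) \<Rightarrow> int \<Rightarrow> int \<Rightarrow> real \<Rightarrow> ereal" where
  "last_passage b k n t =
     (SUP s\<in>jump_times k n t. ereal (\<Sum>i=k..n. b i (s i) - b i (s (i - 1))))"

definition reflected_system ::
  "(int \<Rightarrow> real) \<Rightarrow> (int \<Rightarrow> real \<Rightarrow> real) \<Rightarrow> int \<Rightarrow> real \<Rightarrow> ereal" where
  "reflected_system x0 b n t = (SUP k\<in>{..n}. ereal (x0 k) + last_passage b k n t)"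

definition r_stat :: "real \<Rightarrow> real" where
  "r_stat a = - (a\<^sup>2 / 4) + (1 + a / 2) * sqrt (a + a\<^sup>2 / 4)
              + ln (1 + a / 2 - sqrt (a + a\<^sup>2 / 4))"

end

theory Submission
  imports Defs "HOL-Real_Asymp.Real_Asymp"
begin

text \<open>
  The key is an exact formula for exponential last passage percolation with boundary weights of
  parameters \<open>p = 1 - q\<close> in row \<open>0\<close> and \<open>q\<close> in column \<open>0\<close>: Burke's property makes the increments
  along the last column independent and exponential, so the moment generating function of the
  passage time is explicit after tilting the weights of row \<open>0\<close>. With \<open>N\<close> columns, weights scaled
  by \<open>1 / sqrt N\<close> and boundary parameters \<open>\<nu> / sqrt N\<close> and \<open>la / sqrt N\<close>, this becomes
  \<open>E exp ((la - \<nu>) L) = exp (T (la\<^sup>2 - \<nu>\<^sup>2) / 2) (la / \<nu>) ^ n\<close> in the Brownian limit. The central limit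
  theorem, applied to the block sums over a fixed time grid, transfers upper bounds for moment
  generating functions and lower bounds for tail probabilities to Brownian last passage times.

  The upper tail is then bounded by Markov's inequality and a union bound over the starting level
  \<open>k\<close>; levels \<open>k > 0\<close> are treated with \<open>(\<nu>, la) = (1 - \<theta>, 1)\<close> and levels \<open>k \<le> 0\<close>, which contribute
  less, with \<open>\<nu>\<close> slightly above \<open>1\<close>. For the lower bound one tilts by \<open>\<theta>\<close> as in the
  Gaertner--Ellis theorem; the paths that leave through row \<open>0\<close> are negligible because they are
  dominated by a stationary model with a strictly smaller exponent.
\<close>

section \<open>Last passage recursions\<close>

text \<open>The passage time to the end of the last column is G(0,N) plus the increments along that
  column, and these two parts are dependent, so Burke's property alone gives no generating function.
  Row 0 therefore gets the rate p + s: the density exp(s G(0,N)) turns it into p, and as p + q = 1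
  the tilted model is stationary. After scaling, row 0 is a Brownian level with drift \<nu>, column
  0 supplies gaps of rate la, and s becomes la - \<nu>. For T = n = t and (\<nu>, la) = (1 -
  \<theta>, 1) the exponent per unit time is \<theta> - \<theta>^2 / 2 - ln (1 - \<theta>); its
  Legendre transform at 2 + a is \<open>r_stat a\<close>. Two mesh parameters are kept apart: the
  number m of time steps and the number b of columns per step. The limit b -> infinity is taken at
  fixed m, where only finitely many block sums have to converge. Level changes inside a block are
  controlled by an oscillation bound that is uniform in b and vanishes afterwards as m ->
  infinity.\<close>

fun lpp :: "(nat \<Rightarrow> nat \<Rightarrow> real) \<Rightarrow> nat \<Rightarrow> nat \<Rightarrow> real" where
  "lpp w 0 0 = w 0 0"
| "lpp w (Suc i) 0 = lpp w i 0 + w (Suc i) 0"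
| "lpp w 0 (Suc l) = lpp w 0 l + w 0 (Suc l)"
| "lpp w (Suc i) (Suc l) = max (lpp w i (Suc l)) (lpp w (Suc i) l) + w (Suc i) (Suc l)"

lemma lpp_mono:
  "(\<And>i' l'. i' \<le> i \<Longrightarrow> l' \<le> l \<Longrightarrow> w i' l' \<le> w' i' l') \<Longrightarrow> lpp w i l \<le> lpp w' i l"
proof (induction w i l rule: lpp.induct)
  case (4 w i l)
  have "lpp w i (Suc l) \<le> lpp w' i (Suc l)" "lpp w (Suc i) l \<le> lpp w' (Suc i) l"
    using 4 by auto
  moreover have "w (Suc i) (Suc l) \<le> w' (Suc i) (Suc l)"
    using 4(3) by auto
  ultimately show ?case
    by auto
qed (fastforce intro!: add_mono)+

lemma lpp_cong:
  "(\<And>i' l'. i' \<le> i \<Longrightarrow> l' \<le> l \<Longrightarrow> w i' l' = w' i' l') \<Longrightarrow> lpp w i l = lpp w' i l"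
  by (intro antisym lpp_mono) auto

lemma lpp_nonneg:
  "(\<And>i' l'. i' \<le> i \<Longrightarrow> l' \<le> l \<Longrightarrow> 0 \<le> w i' l') \<Longrightarrow> 0 \<le> lpp w i l"
  by (induction w i l rule: lpp.induct) (auto simp: le_max_iff_disj intro!: add_nonneg_nonneg)

lemma lpp_Suc_ge:
  assumes "\<And>i' l'. i' \<le> Suc i \<Longrightarrow> l' \<le> l \<Longrightarrow> 0 \<le> w i' l'"
  shows "lpp w i l \<le> lpp w (Suc i) l"
  using assms by (cases l) (auto simp: add_increasing2)

text \<open>\<open>\<alpha>\<close> and \<open>\<beta>\<close> are the mean weights in row \<open>0\<close> and in column \<open>0\<close>.\<close>

definition bweight :: "real \<Rightarrow> real \<Rightarrow> (nat \<times> nat \<Rightarrow> real) \<Rightarrow> nat \<Rightarrow> nat \<Rightarrow> real" where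
  "bweight \<alpha> \<beta> e i l =
     (if i = 0 \<and> l = 0 then 0 else if i = 0 then \<alpha> * e (0, l) else if l = 0 then \<beta> * e (i, 0)
      else e (i, l))"

lemma bweight_nonneg:
  "0 \<le> \<alpha> \<Longrightarrow> 0 \<le> \<beta> \<Longrightarrow> 0 \<le> e (i, l) \<Longrightarrow> 0 \<le> bweight \<alpha> \<beta> e i l"
  by (auto simp: bweight_def)

lemma lpp_col0: "lpp (bweight \<alpha> \<beta> e) i 0 = \<beta> * (\<Sum>k<i. e (Suc k, 0))"
  by (induction i) (auto simp: bweight_def algebra_simps)

lemma lpp_row0: "lpp (bweight \<alpha> \<beta> e) 0 l = \<alpha> * (\<Sum>k<l. e (0, Suc k))"
  by (induction l) (auto simp: bweight_def algebra_simps)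

text \<open>An up-right path leaves the corner through row 0 or through column 0 and never meets the
  other boundary afterwards, so deleting the weights of that other boundary does not change its
  length.\<close>

lemma lpp_le_max_boundaries:
  "lpp (bweight \<alpha> \<beta> e) i l \<le> max (lpp (bweight \<alpha> 0 e) i l) (lpp (bweight 0 \<beta> e) i l)"
proof (induction "bweight \<alpha> \<beta> e" i l rule: lpp.induct)
  case (4 i l)
  have "bweight \<alpha> \<beta> e (Suc i) (Suc l) = bweight \<alpha> 0 e (Suc i) (Suc l)"
       "bweight \<alpha> \<beta> e (Suc i) (Suc l) = bweight 0 \<beta> e (Suc i) (Suc l)"
    by (auto simp: bweight_def)
  with 4 show ?case by (auto simp: max_def split: if_splits)
next
  case (2 i)
  have "lpp (bweight \<alpha> \<beta> e) (Suc i) 0 = lpp (bweight 0 \<beta> e) (Suc i) 0"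
    by (simp only: lpp_col0)
  then show ?case by linarith
next
  case (3 l)
  have "lpp (bweight \<alpha> \<beta> e) 0 (Suc l) = lpp (bweight \<alpha> 0 e) 0 (Suc l)"
    by (simp only: lpp_row0)
  then show ?case by linarith
qed (auto simp: bweight_def)

text \<open>Last passage over additive paths that may change level only at the columns in \<open>A\<close>;
  a path may start at any level \<open>i\<close>, with initial value \<open>z i\<close>.\<close>

fun rpass :: "(nat \<Rightarrow> bool) \<Rightarrow> (nat \<Rightarrow> real) \<Rightarrow> (nat \<Rightarrow> nat \<Rightarrow> real) \<Rightarrow> nat \<Rightarrow> nat \<Rightarrow> real" where
  "rpass A z X 0 0 = z 0"
| "rpass A z X 0 (Suc l) = rpass A z X 0 l + X 0 l"
| "rpass A z X (Suc i) 0 = max (z (Suc i)) (rpass A z X i 0)"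
| "rpass A z X (Suc i) (Suc l) =
     (if A (Suc l) then max (rpass A z X (Suc i) l + X (Suc i) l) (rpass A z X i (Suc l))
      else rpass A z X (Suc i) l + X (Suc i) l)"

abbreviation pass :: "(nat \<Rightarrow> real) \<Rightarrow> (nat \<Rightarrow> nat \<Rightarrow> real) \<Rightarrow> nat \<Rightarrow> nat \<Rightarrow> real" where
  "pass \<equiv> rpass (\<lambda>_. True)"

lemma rpass_step: "rpass A z X i l + X i l \<le> rpass A z X i (Suc l)"
  by (cases i) auto

text \<open>Column 0 needs no membership in A: its clause already takes the maximum over all
  starting levels up to i.\<close>

lemma rpass_up: "A l \<or> l = 0 \<Longrightarrow> rpass A z X i l \<le> rpass A z X (Suc i) l"
  by (cases l) auto

lemma rpass_cong:
  "(\<And>i'. i' \<le> i \<Longrightarrow> z i' = z' i') \<Longrightarrow> (\<And>i' l'. i' \<le> i \<Longrightarrow> l' < l \<Longrightarrow> X i' l' = X' i' l') \<Longrightarrow>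
   rpass A z X i l = rpass A z' X' i l"
  by (induction A z X i l rule: rpass.induct) auto

lemma rpass_scale:
  assumes "0 \<le> c"
  shows "rpass A (\<lambda>i. c * z i) (\<lambda>i l. c * X i l) i l = c * rpass A z X i l"
  using assms
  by (induction A z X i l rule: rpass.induct) (auto simp: max_mult_distrib_left distrib_left)

lemma rpass_advance: "rpass A z X i l + (\<Sum>k=l..<l+d. X i k) \<le> rpass A z X i (l + d)"
proof (induction d)
  case (Suc d)
  have "rpass A z X i l + (\<Sum>k=l..<l+Suc d. X i k) \<le> rpass A z X i (l + d) + X i (l + d)"
    using Suc by simp
  also have "\<dots> \<le> rpass A z X i (l + Suc d)"
    using rpass_step[of A z X i "l + d"] by simp
  finally show ?case .
qed simp

lemma rpass_advance_eq:
  "(\<And>k. l < k \<Longrightarrow> k \<le> l + d \<Longrightarrow> \<not> A k) \<Longrightarrow>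
   rpass A z X i (l + d) = rpass A z X i l + (\<Sum>k=l..<l+d. X i k)"
proof (induction d)
  case (Suc d)
  then have "rpass A z X i (l + Suc d) = rpass A z X i (l + d) + X i (l + d)"
    by (cases i) auto
  with Suc show ?case by simp
qed simp

lemma not_dvd_between: "(b::nat) dvd l \<Longrightarrow> l < k \<Longrightarrow> k < l + b \<Longrightarrow> \<not> b dvd k"
  by (metis add_diff_cancel_left' dvd_diff_nat dvd_imp_le less_imp_add_positive nat_add_left_cancel_less
      not_less)

text \<open>Between two multiples of b a path stays on its level, so only sums over whole blocks
  matter and the restricted problem is an unrestricted one on the coarser grid.\<close>

lemma rpass_block:
  assumes "0 < b"
  shows "rpass (\<lambda>l. b dvd l) z X i (j * b) = pass z (\<lambda>i j. \<Sum>l=j*b..<j*b+b. X i l) i j"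
proof -
  have mult: "rpass (\<lambda>l. b dvd l) z X i (Suc j * b) =
     (let u = rpass (\<lambda>l. b dvd l) z X i (j * b) + (\<Sum>l=j*b..<j*b+b. X i l) in
      case i of 0 \<Rightarrow> u | Suc i' \<Rightarrow> max u (rpass (\<lambda>l. b dvd l) z X i' (Suc j * b)))" for i j
  proof -
    \<comment> \<open>Splitting off the last column of the block isolates \<open>Suc j * b\<close>,
      the only place in it where a change of level is allowed.\<close>
    obtain c where b: "b = Suc c" using assms by (cases b) auto
    have e: "Suc j * b = Suc (j * b + c)" using b by simp
    have 1: "rpass (\<lambda>l. b dvd l) z X i (j * b + c) = 
        rpass (\<lambda>l. b dvd l) z X i (j * b) + (\<Sum>l=j*b..<j*b+c. X i l)"
    proof (rule rpass_advance_eq)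
      fix k assume "j * b < k" "k \<le> j * b + c"
      then show "\<not> b dvd k" using b by (intro not_dvd_between[OF dvd_triv_right, of j]) auto
    qed
    have 2: "b dvd Suc (j * b + c)" using e by (metis dvd_triv_right)
    show ?thesis
      unfolding e using 1 2 b by (cases i) (auto simp: Let_def)
  qed
  show ?thesis
  proof (induction i arbitrary: j)
    case 0
    show ?case
    proof (induction j)
      case (Suc j)
      then show ?case using mult[of 0 j] by (simp add: Let_def)
    qed simp
  next
    case (Suc i)
    note IH = Suc
    show ?case
    proof (induction j)
      case 0
      then show ?case using IH[of 0] by simp
    next
      case (Suc j)
      then show ?case using mult[of "Suc i" j] IH[of "Suc j"] by (simp add: Let_def)
    qed
  qed
qed

text \<open>A path counted by \<open>rpass\<close> collects one weight per column; the corresponding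
  lattice path also collects boundary weights and the weights met while moving up, all nonnegative.
  Level i of \<open>rpass\<close> is row i + 1, because row 0 is a boundary, and the term
  \<open>real l\<close> undoes the centring of the weights at their mean 1.\<close>

lemma lpp_ge_rpass:
  assumes "0 \<le> \<alpha>" "0 \<le> \<beta>" "\<And>c. c \<in> {..Suc i} \<times> {..l} \<Longrightarrow> 0 \<le> e c"
  shows "real l + rpass A (\<lambda>_. 0) (\<lambda>i l. e (Suc i, Suc l) - 1) i l \<le> lpp (bweight \<alpha> \<beta> e) (Suc i) l"
  using assms(3)
proof (induction A "\<lambda>_::nat. 0::real" "\<lambda>i l. e (Suc i, Suc l) - 1" i l rule: rpass.induct)
  case (1 A)
  then show ?case using assms(1,2) by (simp add: bweight_def)
next
  case (2 A l)
  have "real (Suc l) + rpass A (\<lambda>_. 0) (\<lambda>i l. e (Suc i, Suc l) - 1) 0 (Suc l) \<le>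
     lpp (bweight \<alpha> \<beta> e) (Suc 0) l + e (Suc 0, Suc l)"
  proof -
    have "real l + rpass A (\<lambda>_. 0) (\<lambda>i l. e (Suc i, Suc l) - 1) 0 l \<le> lpp (bweight \<alpha> \<beta> e) (Suc 0) l"
      by (rule 2(1)) (rule 2(2), auto)
    then show ?thesis by simp
  qed
  also have "\<dots> \<le> lpp (bweight \<alpha> \<beta> e) (Suc 0) (Suc l)"
    by (simp add: bweight_def)
  finally show ?case .
next
  case (3 A i)
  then have *: "rpass A (\<lambda>_. 0) (\<lambda>i l. e (Suc i, Suc l) - 1) i 0 \<le> lpp (bweight \<alpha> \<beta> e) (Suc i) 0"
    by force
  also have "\<dots> \<le> lpp (bweight \<alpha> \<beta> e) (Suc (Suc i)) 0"
    using 3 assms(1,2) by (intro lpp_Suc_ge bweight_nonneg) auto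
  finally have "rpass A (\<lambda>_. 0) (\<lambda>i l. e (Suc i, Suc l) - 1) i 0 \<le> lpp (bweight \<alpha> \<beta> e) (Suc (Suc i)) 0" .
  moreover have "0 \<le> lpp (bweight \<alpha> \<beta> e) (Suc (Suc i)) 0"
    using 3 assms(1,2) by (intro lpp_nonneg bweight_nonneg) auto
  ultimately show ?case by (simp del: lpp.simps)
next
  case (4 A i l)
  have e: "0 \<le> e c" if "c \<in> {..Suc (Suc i)} \<times> {..Suc l}" for c
    using 4(4) that by blast
  have "real l + rpass A (\<lambda>_. 0) (\<lambda>i l. e (Suc i, Suc l) - 1) (Suc i) l
         \<le> lpp (bweight \<alpha> \<beta> e) (Suc (Suc i)) l"
    by (cases "A (Suc l)") (use 4(1,3) e in \<open>auto\<close>)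
  also have "\<dots> + e (Suc (Suc i), Suc l) \<le> lpp (bweight \<alpha> \<beta> e) (Suc (Suc i)) (Suc l)"
    by (simp add: bweight_def)
  finally have *: "real (Suc l) + (rpass A (\<lambda>_. 0) (\<lambda>i l. e (Suc i, Suc l) - 1) (Suc i) l
      + (e (Suc (Suc i), Suc l) - 1)) \<le> lpp (bweight \<alpha> \<beta> e) (Suc (Suc i)) (Suc l)"
    by simp
  show ?case
  proof (cases "A (Suc l)")
    case True
    have "real (Suc l) + rpass A (\<lambda>_. 0) (\<lambda>i l. e (Suc i, Suc l) - 1) i (Suc l) \<le>
        lpp (bweight \<alpha> \<beta> e) (Suc i) (Suc l)"
      using 4(2)[OF True] e by auto
    also have "\<dots> \<le> lpp (bweight \<alpha> \<beta> e) (Suc (Suc i)) (Suc l)"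
      using e assms(1,2) by (intro lpp_Suc_ge bweight_nonneg) auto
    finally show ?thesis using * True by (simp del: lpp.simps)
  next
    case False
    then show ?thesis using * by (simp del: lpp.simps)
  qed
qed

text \<open>Every upward move of a lattice path can be brought forward to the last multiple of b.
  This exchanges a piece of fewer than b columns on the old level for one on the new level, at a
  cost of at most 2 \<epsilon>, and the additional weight in the column of the move costs at most
  \<epsilon>'. Each of the i changes of level pays once.\<close>

lemma lpp_le_rpass:
  assumes "0 \<le> \<beta>" "0 < b" and e: "\<And>c. c \<in> {..n} \<times> {..N} \<Longrightarrow> 0 \<le> e c"
    and osc: "\<And>i l d. Suc i \<le> n \<Longrightarrow> b dvd l \<Longrightarrow> d < b \<Longrightarrow> l + d \<le> N \<Longrightarrow>
        \<bar>\<Sum>k=l..<l+d. e (Suc i, Suc k) - 1\<bar> \<le> \<epsilon>"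
    and osc1: "\<And>i l. Suc i \<le> n \<Longrightarrow> Suc l \<le> N \<Longrightarrow> e (Suc i, Suc l) \<le> \<epsilon>'"
    and "Suc i \<le> n" "l \<le> N" "0 \<le> \<epsilon>" "0 \<le> \<epsilon>'"
  shows "lpp (bweight 0 \<beta> e) (Suc i) l \<le>
    real l + rpass (\<lambda>l. b dvd l) (\<lambda>i. \<beta> * (\<Sum>k<Suc i. e (Suc k, 0))) (\<lambda>i l. e (Suc i, Suc l) - 1) i l
     + real i * (2 * \<epsilon> + \<epsilon>')"
  using assms(6,7)
proof (induction i arbitrary: l)
  case 0
  from 0(2) show ?case
  proof (induction l)
    case 0
    then show ?case by (simp add: bweight_def)
  next
    case (Suc l)
    \<comment> \<open>Row 0 has weight 0, so in row 1 the maximum of the recursion is always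
      attained by the predecessor in the same row.\<close>
    have "lpp (bweight 0 \<beta> e) 0 (Suc l) \<le> lpp (bweight 0 \<beta> e) (Suc 0) l"
    proof -
      have "lpp (bweight 0 \<beta> e) 0 (Suc l) = 0" by (simp only: lpp_row0)
      moreover have "0 \<le> lpp (bweight 0 \<beta> e) (Suc 0) l"
        using \<open>Suc 0 \<le> n\<close> Suc(2) e \<open>0 \<le> \<beta>\<close> by (intro lpp_nonneg bweight_nonneg) auto
      ultimately show ?thesis by simp
    qed
    then have "lpp (bweight 0 \<beta> e) (Suc 0) (Suc l) = lpp (bweight 0 \<beta> e) (Suc 0) l + e (Suc 0, Suc l)"
      by (simp add: bweight_def)
    then show ?case using Suc by (simp del: lpp.simps)
  qed
next
  case (Suc i)
  note IH = Suc(1) and n = Suc(2)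
  let ?r = "rpass (\<lambda>l. b dvd l) (\<lambda>i. \<beta> * (\<Sum>k<Suc i. e (Suc k, 0))) (\<lambda>i l. e (Suc i, Suc l) - 1)"
  let ?G = "lpp (bweight 0 \<beta> e)"
  let ?E = "2 * \<epsilon> + \<epsilon>'"
  have E0: "0 \<le> ?E" using \<open>0 \<le> \<epsilon>\<close> \<open>0 \<le> \<epsilon>'\<close> by simp
  from Suc(3) show ?case
  proof (induction l)
    case 0
    have "?G (Suc (Suc i)) 0 = \<beta> * (\<Sum>k<Suc (Suc i). e (Suc k, 0))"
      by (simp only: lpp_col0)
    also have "\<dots> \<le> ?r (Suc i) 0"
      by simp
    finally show ?case
      using mult_nonneg_nonneg[OF of_nat_0_le_iff E0, of "Suc i"] by (simp del: lpp.simps rpass.simps)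
  next
    case (Suc l)
    \<comment> \<open>The last multiple of b up to \<open>Suc l\<close>; the path is made to move up
      here instead of at \<open>Suc l\<close>.\<close>
    define l0 where "l0 = b * (Suc l div b)"
    define d where "d = Suc l mod b"
    have ld: "Suc l = l0 + d" "b dvd l0" "d < b"
      using \<open>0 < b\<close> by (auto simp: l0_def d_def)
    have G: "?G (Suc (Suc i)) (Suc l) =
        max (?G (Suc i) (Suc l)) (?G (Suc (Suc i)) l) + e (Suc (Suc i), Suc l)"
      by (simp add: bweight_def)
    have "?G (Suc (Suc i)) l \<le> real l + ?r (Suc i) l + real (Suc i) * ?E"
      using Suc by simp
    moreover have "?r (Suc i) l + (e (Suc (Suc i), Suc l) - 1) \<le> ?r (Suc i) (Suc l)"
      by (rule rpass_step)
    ultimately have left: "?G (Suc (Suc i)) l + e (Suc (Suc i), Suc l) \<le>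
        real (Suc l) + ?r (Suc i) (Suc l) + real (Suc i) * ?E"
      by linarith
    have nd: "\<And>k. l0 < k \<Longrightarrow> k \<le> l0 + d \<Longrightarrow> \<not> b dvd k"
      using ld by (intro not_dvd_between[of b l0]) auto
    have a1: "?r i (Suc l) = ?r i l0 + (\<Sum>k=l0..<l0+d. e (Suc i, Suc k) - 1)"
      unfolding ld(1) by (rule rpass_advance_eq) (rule nd)
    have a2: "?r (Suc i) (Suc l) = ?r (Suc i) l0 + (\<Sum>k=l0..<l0+d. e (Suc (Suc i), Suc k) - 1)"
      unfolding ld(1) by (rule rpass_advance_eq) (rule nd)
    have a3: "?r i l0 \<le> ?r (Suc i) l0"
      by (rule rpass_up) (use ld in auto)
    have a4: "\<bar>\<Sum>k=l0..<l0+d. e (Suc i, Suc k) - 1\<bar> \<le> \<epsilon>"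
      "\<bar>\<Sum>k=l0..<l0+d. e (Suc (Suc i), Suc k) - 1\<bar> \<le> \<epsilon>"
      using n Suc(2) ld by (intro osc; simp)+
    have a5: "e (Suc (Suc i), Suc l) \<le> \<epsilon>'"
      using n Suc(2) osc1 by auto
    have "?r i (Suc l) + e (Suc (Suc i), Suc l) \<le> ?r (Suc i) (Suc l) + ?E"
      using a1 a2 a3 a4 a5 by linarith
    moreover have "?G (Suc i) (Suc l) \<le> real (Suc l) + ?r i (Suc l) + real i * ?E"
      by (rule IH) (use n Suc(2) in auto)
    ultimately have below: "?G (Suc i) (Suc l) + e (Suc (Suc i), Suc l) \<le>
        real (Suc l) + ?r (Suc i) (Suc l) + real (Suc i) * ?E"
      by (simp add: algebra_simps del: lpp.simps rpass.simps)
    show ?case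
      unfolding G using below left by (simp add: max_def del: lpp.simps rpass.simps)
  qed
qed

text \<open>This minimality of \<open>pass\<close> is how suprema over continuous paths are bounded
  from below: F will be the passage time, or the reflected system, read off on a time grid. Its
  values are extended reals because those suprema are.\<close>

lemma pass_le:
  fixes F :: "nat \<Rightarrow> nat \<Rightarrow> ereal"
  assumes "\<And>i. ereal (z i) \<le> F i 0" "\<And>i j. F i j + ereal (X i j) \<le> F i (Suc j)"
    "\<And>i j. F i j \<le> F (Suc i) j"
  shows "ereal (pass z X i j) \<le> F i j"
proof (induction i arbitrary: j)
  case 0
  show ?case
  proof (induction j)
    case (Suc j)
    have "ereal (pass z X 0 (Suc j)) = ereal (pass z X 0 j) + ereal (X 0 j)" by simp
    also have "\<dots> \<le> F 0 j + ereal (X 0 j)" using Suc by (rule add_right_mono)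
    also have "\<dots> \<le> F 0 (Suc j)" by (rule assms)
    finally show ?case .
  qed (use assms in simp)
next
  case (Suc i)
  note IH = Suc
  show ?case
  proof (induction j)
    case 0
    have "ereal (pass z X i 0) \<le> F (Suc i) 0" using IH assms(3) order_trans by blast
    then show ?case using assms(1)[of "Suc i"] by (simp add: max_def)
  next
    case (Suc j)
    have "ereal (pass z X (Suc i) j + X (Suc i) j) = ereal (pass z X (Suc i) j) + ereal (X (Suc i) j)" by simp
    also have "\<dots> \<le> F (Suc i) j + ereal (X (Suc i) j)" using Suc by (rule add_right_mono)
    also have "\<dots> \<le> F (Suc i) (Suc j)" by (rule assms)
    finally have "ereal (pass z X (Suc i) j + X (Suc i) j) \<le> F (Suc i) (Suc j)" .
    moreover have "ereal (pass z X i (Suc j)) \<le> F (Suc i) (Suc j)"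
      using IH assms(3) order_trans by blast
    ultimately show ?case by (simp add: max_def)
  qed
qed

section \<open>Burke's property for exponential weights\<close>

abbreviation expo :: "real \<Rightarrow> real measure" where
  "expo r \<equiv> density lborel (\<lambda>x. ennreal (exponential_density r x))"

lemma sets_expo [simp, measurable_cong]: "sets (expo r) = sets borel"
  by simp

lemma prob_space_expo: "0 < r \<Longrightarrow> prob_space (expo r)"
  using prob_space_exponential_density by simp

lemma nn_integral_expo:
  "f \<in> borel_measurable borel \<Longrightarrow>
   (\<integral>\<^sup>+x. f x \<partial>expo r) = (\<integral>\<^sup>+x. ennreal (exponential_density r x) * f x \<partial>lborel)"
  by (subst nn_integral_density) auto

lemma nn_integral_exponential_density:
  "0 < r \<Longrightarrow> (\<integral>\<^sup>+x. ennreal (exponential_density r x) \<partial>lborel) = 1"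
  using prob_space.emeasure_space_1[OF prob_space_expo, of r] by (simp add: emeasure_density)

lemma nn_integral_expo_scale:
  assumes [measurable]: "f \<in> borel_measurable borel" and r: "0 < r"
  shows "(\<integral>\<^sup>+x. f (1 / r * x) \<partial>expo 1) = (\<integral>\<^sup>+x. f x \<partial>expo r)"
proof -
  have "(\<integral>\<^sup>+x. f (1 / r * x) \<partial>expo 1) =
      (\<integral>\<^sup>+x. ennreal (exponential_density 1 x) * f (1 / r * x) \<partial>lborel)"
    by (rule nn_integral_expo) measurable
  also have "\<dots> = ennreal \<bar>r\<bar> *
      (\<integral>\<^sup>+x. ennreal (exponential_density 1 (0 + r * x)) * f (1 / r * (0 + r * x)) \<partial>lborel)"
    by (rule nn_integral_real_affine) (use r in auto)
  also have "\<dots> = (\<integral>\<^sup>+x. ennreal r * (ennreal (exponential_density 1 (r * x)) * f x) \<partial>lborel)"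
    using r by (subst nn_integral_cmult[symmetric]) auto
  also have "\<dots> = (\<integral>\<^sup>+x. ennreal (exponential_density r x) * f x \<partial>lborel)"
  proof (rule nn_integral_cong)
    fix x
    have "ennreal r * ennreal (exponential_density 1 (r * x)) = ennreal (exponential_density r x)"
      using r by (auto simp: exponential_density_def ennreal_mult[symmetric] mult_less_0_iff mult.commute)
    then show "ennreal r * (ennreal (exponential_density 1 (r * x)) * f x) =
        ennreal (exponential_density r x) * f x"
      by (simp add: mult.assoc[symmetric])
  qed
  also have "\<dots> = (\<integral>\<^sup>+x. f x \<partial>expo r)"
    by (rule nn_integral_expo[symmetric]) measurable
  finally show ?thesis .
qed

text \<open>The density of rate r times \<open>exp (s * x)\<close> is the density of rate r - s up
  to the constant r / (r - s). This is the step that lowers the rate of row 0 from p + s to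
  p.\<close>

lemma nn_integral_expo_tilt:
  assumes [measurable]: "f \<in> borel_measurable borel" and r: "0 < r" "s < r"
  shows "(\<integral>\<^sup>+x. ennreal (exp (s * x)) * f x \<partial>expo r) = ennreal (r / (r - s)) * (\<integral>\<^sup>+x. f x \<partial>expo (r - s))"
proof -
  have "(\<integral>\<^sup>+x. ennreal (exp (s * x)) * f x \<partial>expo r) =
      (\<integral>\<^sup>+x. ennreal (exponential_density r x) * (ennreal (exp (s * x)) * f x) \<partial>lborel)"
    by (rule nn_integral_expo) measurable
  also have "\<dots> = (\<integral>\<^sup>+x. ennreal (r / (r - s)) * (ennreal (exponential_density (r - s) x) * f x) \<partial>lborel)"
  proof (rule nn_integral_cong)
    fix x
    have "ennreal (exponential_density r x) * ennreal (exp (s * x)) =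
        ennreal (r / (r - s)) * ennreal (exponential_density (r - s) x)"
    proof (cases "x < 0")
      case False
      have "exp (- x * r) * exp (s * x) = exp (- x * (r - s))"
        by (simp add: exp_add[symmetric] algebra_simps)
      then have "r * exp (- x * r) * exp (s * x) = r / (r - s) * ((r - s) * exp (- x * (r - s)))"
        using r by simp
      then show ?thesis
        using r False by (simp add: exponential_density_def ennreal_mult[symmetric] del: mult_minus_left)
    qed (simp add: exponential_density_def)
    then show "ennreal (exponential_density r x) * (ennreal (exp (s * x)) * f x) =
        ennreal (r / (r - s)) * (ennreal (exponential_density (r - s) x) * f x)"
      by (simp add: mult.assoc[symmetric])
  qed
  also have "\<dots> = ennreal (r / (r - s)) * (\<integral>\<^sup>+x. f x \<partial>expo (r - s))"
    by (subst nn_integral_cmult, simp, subst nn_integral_expo) auto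
  finally show ?thesis .
qed

lemma nn_integral_expo_exp:
  assumes r: "0 < r" "s < r"
  shows "(\<integral>\<^sup>+x. ennreal (exp (s * x)) \<partial>expo r) = ennreal (r / (r - s))"
  using nn_integral_expo_tilt[OF _ r, of "\<lambda>_. 1"] r
  using prob_space.emeasure_space_1[OF prob_space_expo, of "r - s"] by simp

text \<open>The memoryless property: given its sign, \<open>x - y\<close> is independent of \<open>min x y\<close>, and the
  latter is exponential with parameter \<open>p + q = 1\<close>.\<close>

lemma expo_memoryless:
  assumes pq: "0 < p" "0 < q" "p + q = 1"
    and [measurable]: "case_prod g \<in> borel_measurable (borel \<Otimes>\<^sub>M borel)"
    and neg: "\<And>d w. d < 0 \<Longrightarrow> g d w = 0"
  shows "(\<integral>\<^sup>+x. \<integral>\<^sup>+y. \<integral>\<^sup>+w. g (x - y) w \<partial>expo 1 \<partial>expo q \<partial>expo p) =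
    (\<integral>\<^sup>+x. \<integral>\<^sup>+y. g (x - y) y \<partial>expo q \<partial>expo p)"
proof -
  let ?a = "\<lambda>r x. ennreal (exponential_density r x)"
  define H where "H d = (\<integral>\<^sup>+w. g d w \<partial>expo 1)" for d
  have H': "H d = (\<integral>\<^sup>+w. ?a 1 w * g d w \<partial>lborel)" for d
    unfolding H_def by (rule nn_integral_expo) measurable
  have [measurable]: "H \<in> borel_measurable borel"
    unfolding H'[abs_def] by measurable
  have Hneg: "H d = 0" if "d < 0" for d
    using neg[OF that] by (simp add: H_def)
  \<comment> \<open>At x = d + y with d and y nonnegative, the product of the two densities is p q
    exp (- p d) times the density of rate p + q = 1 at y, so the variables d and y separate. For
    negative d this fails, hence the condition on h.\<close>
  have dens: "?a p (d + y) * ?a q y * h = ennreal (p * q * exp (- (p * d))) * (?a 1 y * h)"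
    if "d < 0 \<longrightarrow> h = 0" for d y and h :: ennreal
  proof (cases "d < 0 \<or> y < 0")
    case True
    then show ?thesis using that by (auto simp: exponential_density_def)
  next
    case False
    then have "?a p (d + y) * ?a q y = ennreal (p * exp (- (d + y) * p) * (q * exp (- y * q)))"
      using pq by (auto simp: exponential_density_def ennreal_mult)
    also have "p * exp (- (d + y) * p) * (q * exp (- y * q)) =
        p * q * (exp (- (p * d)) * exp (- (y * (p + q))))"
      by (simp add: exp_add[symmetric] algebra_simps)
    also have "ennreal \<dots> = ennreal (p * q * exp (- (p * d))) * ?a 1 y"
      unfolding pq(3) using pq False by (auto simp: exponential_density_def ennreal_mult[symmetric] mult.assoc)
    finally show ?thesis by (simp add: mult.assoc)
  qed
  \<comment> \<open>Fubini brings the integral over x inside, where for fixed y the substitution x =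
    d + y is a translation of Lebesgue measure.\<close>
  have shift: "(\<integral>\<^sup>+x. \<integral>\<^sup>+y. h (x - y) y \<partial>expo q \<partial>expo p) =
      (\<integral>\<^sup>+d. \<integral>\<^sup>+y. ennreal (p * q * exp (- (p * d))) * (?a 1 y * h d y) \<partial>lborel \<partial>lborel)"
    if [measurable]: "case_prod h \<in> borel_measurable (borel \<Otimes>\<^sub>M borel)"
      and neg: "\<And>d w. d < 0 \<Longrightarrow> h d w = 0" for h :: "real \<Rightarrow> real \<Rightarrow> ennreal"
  proof -
    have "(\<integral>\<^sup>+x. \<integral>\<^sup>+y. h (x - y) y \<partial>expo q \<partial>expo p) =
        (\<integral>\<^sup>+x. \<integral>\<^sup>+y. ?a p x * ?a q y * h (x - y) y \<partial>lborel \<partial>lborel)"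
    proof -
      have "(\<integral>\<^sup>+y. h (x - y) y \<partial>expo q) = (\<integral>\<^sup>+y. ?a q y * h (x - y) y \<partial>lborel)" for x
        by (rule nn_integral_expo) measurable
      then show ?thesis
        by (subst nn_integral_expo) (auto simp: nn_integral_cmult[symmetric] mult.assoc)
    qed
    also have "\<dots> = (\<integral>\<^sup>+y. \<integral>\<^sup>+x. ?a p x * ?a q y * h (x - y) y \<partial>lborel \<partial>lborel)"
      by (rule lborel_pair.Fubini') measurable
    also have "\<dots> = (\<integral>\<^sup>+y. \<integral>\<^sup>+d. ?a p (d + y) * ?a q y * h d y \<partial>lborel \<partial>lborel)"
    proof (rule nn_integral_cong)
      fix y :: real
      show "(\<integral>\<^sup>+x. ?a p x * ?a q y * h (x - y) y \<partial>lborel) = (\<integral>\<^sup>+d. ?a p (d + y) * ?a q y * h d y \<partial>lborel)"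
        using nn_integral_real_affine[of "\<lambda>x. ?a p x * ?a q y * h (x - y) y" 1 y] by (simp add: add.commute)
    qed
    also have "\<dots> = (\<integral>\<^sup>+y. \<integral>\<^sup>+d. ennreal (p * q * exp (- (p * d))) * (?a 1 y * h d y) \<partial>lborel \<partial>lborel)"
      by (intro nn_integral_cong dens) (use neg in auto)
    also have "\<dots> = (\<integral>\<^sup>+d. \<integral>\<^sup>+y. ennreal (p * q * exp (- (p * d))) * (?a 1 y * h d y) \<partial>lborel \<partial>lborel)"
      by (rule lborel_pair.Fubini') measurable
    finally show ?thesis .
  qed
  have "(\<integral>\<^sup>+x. \<integral>\<^sup>+y. \<integral>\<^sup>+w. g (x - y) w \<partial>expo 1 \<partial>expo q \<partial>expo p) =
      (\<integral>\<^sup>+x. \<integral>\<^sup>+y. H (x - y) \<partial>expo q \<partial>expo p)"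
    by (simp add: H_def)
  also have "\<dots> = (\<integral>\<^sup>+d. \<integral>\<^sup>+y. ennreal (p * q * exp (- (p * d))) * (?a 1 y * H d) \<partial>lborel \<partial>lborel)"
    by (rule shift) (auto simp: Hneg)
  also have "\<dots> = (\<integral>\<^sup>+d. \<integral>\<^sup>+y. ennreal (p * q * exp (- (p * d))) * (?a 1 y * g d y) \<partial>lborel \<partial>lborel)"
  proof (rule nn_integral_cong)
    fix d
    show "(\<integral>\<^sup>+y. ennreal (p * q * exp (- (p * d))) * (?a 1 y * H d) \<partial>lborel) =
        (\<integral>\<^sup>+y. ennreal (p * q * exp (- (p * d))) * (?a 1 y * g d y) \<partial>lborel)"
    proof -
      have "(\<integral>\<^sup>+y. ?a 1 y * H d \<partial>lborel) = (\<integral>\<^sup>+y. ?a 1 y * g d y \<partial>lborel)"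
        by (subst nn_integral_multc) (simp_all add: nn_integral_exponential_density H')
      then show ?thesis
        by (simp add: nn_integral_cmult)
    qed
  qed
  also have "\<dots> = (\<integral>\<^sup>+x. \<integral>\<^sup>+y. g (x - y) y \<partial>expo q \<partial>expo p)"
    by (rule shift[symmetric]) (auto simp: neg)
  finally show ?thesis .
qed

lemma expo_Fubini:
  assumes "0 < p" "0 < q" "case_prod g \<in> borel_measurable (borel \<Otimes>\<^sub>M borel)"
  shows "(\<integral>\<^sup>+x. \<integral>\<^sup>+y. g x y \<partial>expo q \<partial>expo p) = (\<integral>\<^sup>+y. \<integral>\<^sup>+x. g x y \<partial>expo p \<partial>expo q)"
proof -
  interpret P: prob_space "expo p" by (rule prob_space_expo) fact
  interpret Q: prob_space "expo q" by (rule prob_space_expo) fact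
  interpret PQ: pair_sigma_finite "expo q" "expo p" ..
  show ?thesis
    by (rule PQ.Fubini') (use assms(3) in measurable)
qed

text \<open>Since max (x - y) 0 + min x y = x and max (y - x) 0 + min x y = y, the claim is that w
  may be exchanged for min x y. On each of the two sign regions of x - y the minimum is independent
  of x - y and has the law of w.\<close>

lemma burke_cell:
  assumes pq: "0 < p" "0 < q" "p + q = 1"
    and [measurable]: "case_prod f \<in> borel_measurable (borel \<Otimes>\<^sub>M borel)"
  shows "(\<integral>\<^sup>+x. \<integral>\<^sup>+y. \<integral>\<^sup>+w. f (max (x - y) 0 + w) (max (y - x) 0 + w) \<partial>expo 1 \<partial>expo q \<partial>expo p) =
    (\<integral>\<^sup>+x. \<integral>\<^sup>+y. f x y \<partial>expo q \<partial>expo p)"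
proof -
  \<comment> \<open>Ties x = y belong to g1 only, so that the two parts add up to the integrand
    exactly.\<close>
  define g1 where "g1 d w = (if 0 \<le> d then f (d + w) w else 0)" for d w :: real
  define g2 where "g2 d w = (if 0 < d then f w (d + w) else 0)" for d w :: real
  have m1[measurable]: "case_prod g1 \<in> borel_measurable (borel \<Otimes>\<^sub>M borel)"
    unfolding g1_def by measurable
  have m2[measurable]: "case_prod g2 \<in> borel_measurable (borel \<Otimes>\<^sub>M borel)"
    unfolding g2_def by measurable
  have [simp]: "sigma_finite_measure (expo 1)" "sigma_finite_measure (expo q)" "sigma_finite_measure (expo p)"
    using prob_space_expo pq by (auto intro: prob_space_imp_sigma_finite)
  interpret E1: sigma_finite_measure "expo 1" by simp
  interpret E2: sigma_finite_measure "expo q" by simp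
  interpret E3: sigma_finite_measure "expo p" by simp
  have split1: "f (max (x - y) 0 + w) (max (y - x) 0 + w) = g1 (x - y) w + g2 (y - x) w" for x y w
    by (auto simp: g1_def g2_def max_def)
  have split2: "f x y = g1 (x - y) y + g2 (y - x) x" for x y
    by (auto simp: g1_def g2_def)
  have "(\<integral>\<^sup>+x. \<integral>\<^sup>+y. \<integral>\<^sup>+w. f (max (x - y) 0 + w) (max (y - x) 0 + w) \<partial>expo 1 \<partial>expo q \<partial>expo p) =
     (\<integral>\<^sup>+x. \<integral>\<^sup>+y. \<integral>\<^sup>+w. g1 (x - y) w \<partial>expo 1 \<partial>expo q \<partial>expo p) +
     (\<integral>\<^sup>+x. \<integral>\<^sup>+y. \<integral>\<^sup>+w. g2 (y - x) w \<partial>expo 1 \<partial>expo q \<partial>expo p)"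
    unfolding split1 by (simp add: nn_integral_add)
  also have "(\<integral>\<^sup>+x. \<integral>\<^sup>+y. \<integral>\<^sup>+w. g1 (x - y) w \<partial>expo 1 \<partial>expo q \<partial>expo p) =
      (\<integral>\<^sup>+x. \<integral>\<^sup>+y. g1 (x - y) y \<partial>expo q \<partial>expo p)"
    by (rule expo_memoryless[OF pq]) (auto simp: g1_def)
  \<comment> \<open>The region y > x is the same statement with p and q exchanged, so the order of
    integration is swapped before and after \<open>expo_memoryless\<close>.\<close>
  also have "(\<integral>\<^sup>+x. \<integral>\<^sup>+y. \<integral>\<^sup>+w. g2 (y - x) w \<partial>expo 1 \<partial>expo q \<partial>expo p) =
      (\<integral>\<^sup>+y. \<integral>\<^sup>+x. \<integral>\<^sup>+w. g2 (y - x) w \<partial>expo 1 \<partial>expo p \<partial>expo q)"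
    by (rule expo_Fubini) (use pq in \<open>auto\<close>)
  also have "\<dots> = (\<integral>\<^sup>+y. \<integral>\<^sup>+x. g2 (y - x) x \<partial>expo p \<partial>expo q)"
    by (rule expo_memoryless) (use pq in \<open>auto simp: g2_def\<close>)
  also have "\<dots> = (\<integral>\<^sup>+x. \<integral>\<^sup>+y. g2 (y - x) x \<partial>expo q \<partial>expo p)"
    by (rule expo_Fubini[symmetric]) (use pq in auto)
  also have "(\<integral>\<^sup>+x. \<integral>\<^sup>+y. g1 (x - y) y \<partial>expo q \<partial>expo p) + \<dots> = (\<integral>\<^sup>+x. \<integral>\<^sup>+y. f x y \<partial>expo q \<partial>expo p)"
    unfolding split2 by (simp add: nn_integral_add)
  finally show ?thesis .
qed

section \<open>Product measures of independent exponential weights\<close>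

lemma product_sigma_finite_expo:
  "(\<And>i. 0 < r i) \<Longrightarrow> product_sigma_finite (\<lambda>i. expo (r i))"
  by (intro product_sigma_finite.intro prob_space_imp_sigma_finite prob_space_expo)

definition noise :: "(nat \<times> nat) set \<Rightarrow> (nat \<times> nat \<Rightarrow> real) measure" where
  "noise S = PiM S (\<lambda>_. expo 1)"

lemma sets_noise [measurable_cong]: "sets (noise S) = sets (PiM S (\<lambda>_. borel))"
  unfolding noise_def by (intro sets_PiM_cong) auto

lemma prob_space_noise: "prob_space (noise S)"
  unfolding noise_def by (intro prob_space_PiM prob_space_expo) simp

lemma measurable_noise_component: "c \<in> S \<Longrightarrow> (\<lambda>e. e c) \<in> borel_measurable (noise S)"
  using measurable_component_singleton[of c S "\<lambda>_. expo 1"] by (simp add: noise_def)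

text \<open>Integrates out the newest weight for fixed old ones; the induction over cells below
  reveals one weight at a time in this way.\<close>

lemma nn_integral_noise_insert:
  assumes "finite S" "c \<notin> S" and [measurable]: "f \<in> borel_measurable (noise (insert c S))"
  shows "(\<integral>\<^sup>+e. f e \<partial>noise (insert c S)) = (\<integral>\<^sup>+e. \<integral>\<^sup>+y. f (e(c := y)) \<partial>expo 1 \<partial>noise S)"
proof -
  interpret product_sigma_finite "\<lambda>_::nat \<times> nat. expo 1"
    by (rule product_sigma_finite_expo) simp
  show ?thesis
    using product_nn_integral_insert[OF assms(1,2) assms(3)[unfolded noise_def]]
    unfolding noise_def .
qed

text \<open>The pathwise comparisons of passage times assume nonnegative weights, while the sample
  space contains all real-valued functions.\<close>

lemma AE_noise_nonneg: "finite S \<Longrightarrow> AE e in noise S. \<forall>c\<in>S. 0 \<le> e c"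
proof (subst AE_ball_countable)
  show "\<forall>c\<in>S. AE e in noise S. 0 \<le> e c"
  proof
    fix c assume "c \<in> S"
    have "AE x in expo 1. 0 \<le> x"
      by (subst AE_density) (auto simp: exponential_density_def)
    then show "AE e in noise S. 0 \<le> e c"
      unfolding noise_def using \<open>c \<in> S\<close>
      by (intro AE_PiM_component prob_space_expo) auto
  qed
qed (simp add: countable_finite)

lemma bweight_Suc_Suc [simp]: "bweight \<alpha> \<beta> e (Suc i) (Suc l) = e (Suc i, Suc l)"
  by (simp add: bweight_def)

lemma measurable_lpp [measurable]:
  "{..i} \<times> {..l} \<subseteq> S \<Longrightarrow> (\<lambda>e. lpp (bweight \<alpha> \<beta> e) i l) \<in> borel_measurable (noise S)"
proof (induction i arbitrary: l)
  case 0
  then have "(\<lambda>e. e (0, Suc k)) \<in> borel_measurable (noise S)" if "k < l" for k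
    by (intro measurable_noise_component) (use that in auto)
  then have "(\<lambda>e. \<Sum>k<l. e (0, Suc k)) \<in> borel_measurable (noise S)"
    by (intro borel_measurable_sum) (simp only: lessThan_iff)
  then show ?case
    unfolding lpp_row0 by (intro borel_measurable_times borel_measurable_const)
next
  case (Suc i)
  note IH = Suc(1)
  from Suc(2) show ?case
  proof (induction l)
    case 0
    then have "(\<lambda>e. e (Suc k, 0)) \<in> borel_measurable (noise S)" if "k < Suc i" for k
      by (intro measurable_noise_component) (use that in auto)
    then have "(\<lambda>e. \<Sum>k<Suc i. e (Suc k, 0)) \<in> borel_measurable (noise S)"
      by (intro borel_measurable_sum) (simp only: lessThan_iff)
    then show ?case
      unfolding lpp_col0 by (intro borel_measurable_times borel_measurable_const)
  next
    case (Suc l)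
    have "(\<lambda>e. lpp (bweight \<alpha> \<beta> e) (Suc i) l) \<in> borel_measurable (noise S)"
      using Suc(2) by (intro Suc(1)) auto
    moreover have "(\<lambda>e. lpp (bweight \<alpha> \<beta> e) i (Suc l)) \<in> borel_measurable (noise S)"
      using Suc(2) by (intro IH) auto
    moreover have "(\<lambda>e. e (Suc i, Suc l)) \<in> borel_measurable (noise S)"
      using Suc(2) by (intro measurable_noise_component) auto
    ultimately show ?case
      unfolding lpp.simps bweight_Suc_Suc by (intro borel_measurable_add borel_measurable_max)
  qed
qed

lemma lpp_noise_cong:
  "(\<And>c. c \<in> {..i} \<times> {..l} \<Longrightarrow> e c = e' c) \<Longrightarrow> lpp (bweight \<alpha> \<beta> e) i l = lpp (bweight \<alpha> \<beta> e') i l"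
  by (rule lpp_cong) (auto simp: bweight_def)

section \<open>Stationary increments and the exact generating function\<close>

locale stationary_lpp =
  fixes p q s :: real and n :: nat
  assumes p: "0 < p" and q: "0 < q" and pq: "p + q = 1" and s: "0 \<le> s" "s < q"
begin

abbreviation "\<alpha> \<equiv> 1 / (p + s)"
abbreviation "\<beta> \<equiv> 1 / q"

definition incr_law :: "(nat \<Rightarrow> real) measure" where
  "incr_law = PiM {..n} (\<lambda>k. expo (if k = 0 then p else q))"

definition col_law :: "(nat \<Rightarrow> real) measure" where
  "col_law = PiM {1..n} (\<lambda>k. expo q)"

lemma sets_incr_law [measurable_cong]: "sets incr_law = sets (PiM {..n} (\<lambda>_. borel))"
  unfolding incr_law_def by (intro sets_PiM_cong) auto

lemma sets_col_law [measurable_cong]: "sets col_law = sets (PiM {1..n} (\<lambda>_. borel))"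
  unfolding col_law_def by (intro sets_PiM_cong) auto

lemma measurable_incr_component: "j \<in> {..n} \<Longrightarrow> (\<lambda>v. v j) \<in> borel_measurable incr_law"
  using measurable_component_singleton[of j "{..n}" "\<lambda>k. expo (if k = 0 then p else q)"]
  by (simp add: incr_law_def)

lemma product_sigma_finite_incr: "product_sigma_finite (\<lambda>k::nat. expo (if k = 0 then p else q))"
  using p q by (intro product_sigma_finite_expo) auto

lemma nn_integral_incr_law:
  assumes f: "f \<in> borel_measurable incr_law"
  shows "(\<integral>\<^sup>+v. f v \<partial>incr_law) = (\<integral>\<^sup>+u. \<integral>\<^sup>+x. f (u(0 := x)) \<partial>expo p \<partial>col_law)"
proof -
  interpret product_sigma_finite "\<lambda>k::nat. expo (if k = 0 then p else q)"
    by (rule product_sigma_finite_incr)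
  have "{..n} = insert 0 {1..n}" by auto
  moreover have "PiM {1..n} (\<lambda>k. expo (if k = 0 then p else q)) = col_law"
    unfolding col_law_def by (intro PiM_cong) auto
  ultimately show ?thesis
    using f product_nn_integral_insert[of "{1..n}" 0 f] by (simp add: incr_law_def)
qed

lemma measurable_flip:
  assumes i: "i \<in> {1..n}" and f: "f \<in> borel_measurable incr_law"
  shows "(\<lambda>z. f ((fst z)(0 := max (fst z 0 - fst z i) 0 + snd z, i := max (fst z i - fst z 0) 0 + snd z)))
      \<in> borel_measurable (incr_law \<Otimes>\<^sub>M expo 1)"
proof -
  have mj: "(\<lambda>z. fst z j) \<in> borel_measurable (incr_law \<Otimes>\<^sub>M expo 1)" if "j \<in> {..n}" for j
    using measurable_comp[OF measurable_fst[of incr_law "expo 1"] measurable_incr_component[OF that]]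
    by (simp add: comp_def)
  have ms: "snd \<in> borel_measurable (incr_law \<Otimes>\<^sub>M expo 1)"
    using measurable_snd[of incr_law "expo 1"] by simp
  have i': "i \<le> n" using i by simp
  have "(\<lambda>z. (fst z)(0 := max (fst z 0 - fst z i) 0 + snd z, i := max (fst z i - fst z 0) 0 + snd z))
      \<in> (incr_law \<Otimes>\<^sub>M expo 1) \<rightarrow>\<^sub>M PiM ({..n}) (\<lambda>_. borel)"
  proof (rule measurable_fun_upd)
    show "{..n} = {..n} \<union> {i}" using i by auto
    show "(\<lambda>z. (fst z)(0 := max (fst z 0 - fst z i) 0 + snd z)) \<in> (incr_law \<Otimes>\<^sub>M expo 1) \<rightarrow>\<^sub>M PiM {..n} (\<lambda>_. borel)"
    proof (rule measurable_fun_upd)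
      show "{..n} = {..n} \<union> {0}" by auto
      show "fst \<in> (incr_law \<Otimes>\<^sub>M expo 1) \<rightarrow>\<^sub>M PiM {..n} (\<lambda>_. borel)"
        using measurable_fst[of incr_law "expo 1"] measurable_cong_sets[OF refl sets_incr_law] by blast
      show "(\<lambda>z. max (fst z 0 - fst z i) 0 + snd z) \<in> (incr_law \<Otimes>\<^sub>M expo 1) \<rightarrow>\<^sub>M borel"
        by (intro borel_measurable_add borel_measurable_max borel_measurable_diff borel_measurable_const mj ms)
          (use i' in auto)
    qed
    show "(\<lambda>z. max (fst z i - fst z 0) 0 + snd z) \<in> (incr_law \<Otimes>\<^sub>M expo 1) \<rightarrow>\<^sub>M borel"
      by (intro borel_measurable_add borel_measurable_max borel_measurable_diff borel_measurable_const mj ms)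
        (use i' in auto)
  qed
  moreover have "f \<in> borel_measurable (PiM {..n} (\<lambda>_. borel))"
    using f measurable_cong_sets[OF sets_incr_law refl] by blast
  ultimately show ?thesis
    using measurable_comp by (fastforce simp: comp_def)
qed

text \<open>Only the coordinates 0 and i change, and their rates are p and q. The others are frozen
  by Fubini, which reduces the claim to \<open>burke_cell\<close>.\<close>

lemma nn_integral_incr_law_flip:
  assumes i: "i \<in> {1..n}" and f[measurable]: "f \<in> borel_measurable incr_law"
  shows "(\<integral>\<^sup>+v. \<integral>\<^sup>+w. f (v(0 := max (v 0 - v i) 0 + w, i := max (v i - v 0) 0 + w)) \<partial>expo 1 \<partial>incr_law)
    = (\<integral>\<^sup>+v. f v \<partial>incr_law)"
proof -
  interpret product_sigma_finite "\<lambda>k::nat. expo (if k = 0 then p else q)"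
    by (rule product_sigma_finite_incr)
  interpret E1: prob_space "expo 1" by (rule prob_space_expo) simp
  define R where "R = {1..n} - {i}"
  have n: "{..n} = insert 0 (insert i R)" using i by (auto simp: R_def)
  have R: "finite R" "i \<notin> R" "0 \<notin> insert i R" "i \<noteq> 0" using i by (auto simp: R_def)
  have fR: "f \<in> borel_measurable (PiM (insert 0 (insert i R)) (\<lambda>_. borel))"
    using f unfolding n[symmetric] by (simp cong: measurable_cong_sets add: sets_incr_law)
  let ?PR = "PiM R (\<lambda>k. expo (if k = 0 then p else q))"
  \<comment> \<open>The coordinates 0 and i are made the innermost integrals, in the order in which
    \<open>burke_cell\<close> expects them.\<close>
  have two: "(\<integral>\<^sup>+v. g v \<partial>incr_law) = (\<integral>\<^sup>+u. \<integral>\<^sup>+x. \<integral>\<^sup>+y. g (u(0 := x, i := y)) \<partial>expo q \<partial>expo p \<partial>?PR)"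
    if g[measurable]: "g \<in> borel_measurable incr_law" for g
  proof -
    have gR: "g \<in> borel_measurable (PiM (insert 0 (insert i R)) (\<lambda>k. expo (if k = 0 then p else q)))"
      using g unfolding incr_law_def n .
    have gR': "g \<in> borel_measurable (PiM (insert i (insert 0 R)) (\<lambda>k. expo (if k = 0 then p else q)))"
      using gR by (simp add: insert_commute)
    have "(\<integral>\<^sup>+v. g v \<partial>incr_law) = (\<integral>\<^sup>+v. g v \<partial>PiM (insert i (insert 0 R)) (\<lambda>k. expo (if k = 0 then p else q)))"
      unfolding incr_law_def n by (simp add: insert_commute)
    also have "\<dots> = (\<integral>\<^sup>+v. \<integral>\<^sup>+y. g (v(i := y)) \<partial>expo q \<partial>PiM (insert 0 R) (\<lambda>k. expo (if k = 0 then p else q)))"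
      using R by (subst product_nn_integral_insert[OF _ _ gR']) auto
    also have "\<dots> = (\<integral>\<^sup>+u. \<integral>\<^sup>+x. \<integral>\<^sup>+y. g (u(0 := x, i := y)) \<partial>expo q \<partial>expo p \<partial>?PR)"
    proof (subst product_nn_integral_insert)
      have "sigma_finite_measure (expo q)" using q by (intro prob_space_imp_sigma_finite prob_space_expo)
      then interpret Q: sigma_finite_measure "expo q" .
      let ?M = "PiM (insert 0 R) (\<lambda>k. expo (if k = 0 then p else q)) \<Otimes>\<^sub>M expo q"
      have "(\<lambda>z. (fst z)(i := snd z)) \<in> ?M \<rightarrow>\<^sub>M
          PiM (insert i (insert 0 R)) (\<lambda>k. expo (if k = 0 then p else q))"
      proof (rule measurable_fun_upd)
        show "insert i (insert 0 R) = insert 0 R \<union> {i}" by blast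
        show "fst \<in> ?M \<rightarrow>\<^sub>M PiM (insert 0 R) (\<lambda>k. expo (if k = 0 then p else q))"
          by (rule measurable_fst)
        show "snd \<in> ?M \<rightarrow>\<^sub>M expo (if i = 0 then p else q)"
          using R(4) by simp
      qed
      from measurable_comp[OF this gR']
      have "(\<lambda>z. g ((fst z)(i := snd z))) \<in> borel_measurable (PiM (insert 0 R) (\<lambda>k. expo (if k = 0 then p else q)) \<Otimes>\<^sub>M expo q)"
        by (simp add: comp_def)
      then show "(\<lambda>v. \<integral>\<^sup>+y. g (v(i := y)) \<partial>expo q) \<in> borel_measurable (PiM (insert 0 R) (\<lambda>k. expo (if k = 0 then p else q)))"
        by (intro Q.borel_measurable_nn_integral) (simp add: case_prod_beta')
    qed (use R in auto)
    finally show ?thesis .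
  qed
  have m2: "(\<lambda>z. f (u(0 := fst z, i := snd z))) \<in> borel_measurable (borel \<Otimes>\<^sub>M borel)"
    if u: "u \<in> space ?PR" for u
  proof -
    have "(\<lambda>z. u(0 := fst z, i := snd z)) \<in> borel \<Otimes>\<^sub>M borel \<rightarrow>\<^sub>M PiM (insert 0 (insert i R)) (\<lambda>_. borel)"
    proof (rule measurable_fun_upd)
      show "insert 0 (insert i R) = insert 0 R \<union> {i}" by blast
      show "(\<lambda>z. u(0 := fst z)) \<in> borel \<Otimes>\<^sub>M borel \<rightarrow>\<^sub>M PiM (insert 0 R) (\<lambda>_. borel)"
      proof (rule measurable_fun_upd)
        show "insert 0 R = R \<union> {0}" by blast
        show "(\<lambda>z. u) \<in> borel \<Otimes>\<^sub>M borel \<rightarrow>\<^sub>M PiM R (\<lambda>_. borel)"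
          using u by (intro measurable_const) (simp add: space_PiM)
      qed (rule measurable_fst)
    qed (rule measurable_snd)
    from measurable_comp[OF this fR] show ?thesis by (simp add: comp_def)
  qed
  have m3: "(\<lambda>v. \<integral>\<^sup>+w. f (v(0 := max (v 0 - v i) 0 + w, i := max (v i - v 0) 0 + w)) \<partial>expo 1) \<in> borel_measurable incr_law"
    using measurable_flip[OF i f] by (intro E1.borel_measurable_nn_integral) (simp add: case_prod_beta')
  have "(\<integral>\<^sup>+v. \<integral>\<^sup>+w. f (v(0 := max (v 0 - v i) 0 + w, i := max (v i - v 0) 0 + w)) \<partial>expo 1 \<partial>incr_law) =
     (\<integral>\<^sup>+u. \<integral>\<^sup>+x. \<integral>\<^sup>+y. \<integral>\<^sup>+w. f (u(0 := max (x - y) 0 + w, i := max (y - x) 0 + w)) \<partial>expo 1 \<partial>expo q \<partial>expo p \<partial>?PR)"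
  proof -
    have "(u(0 := x, i := y))(0 := max ((u(0 := x, i := y)) 0 - (u(0 := x, i := y)) i) 0 + w,
        i := max ((u(0 := x, i := y)) i - (u(0 := x, i := y)) 0) 0 + w) =
        u(0 := max (x - y) 0 + w, i := max (y - x) 0 + w)" for u :: "nat \<Rightarrow> real" and x y w
      using R by auto
    then show ?thesis by (subst two[OF m3]) simp
  qed
  also have "\<dots> = (\<integral>\<^sup>+u. \<integral>\<^sup>+x. \<integral>\<^sup>+y. f (u(0 := x, i := y)) \<partial>expo q \<partial>expo p \<partial>?PR)"
  proof (rule nn_integral_cong)
    fix u assume u: "u \<in> space ?PR"
    show "(\<integral>\<^sup>+x. \<integral>\<^sup>+y. \<integral>\<^sup>+w. f (u(0 := max (x - y) 0 + w, i := max (y - x) 0 + w)) \<partial>expo 1 \<partial>expo q \<partial>expo p) =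
        (\<integral>\<^sup>+x. \<integral>\<^sup>+y. f (u(0 := x, i := y)) \<partial>expo q \<partial>expo p)"
      using burke_cell[OF p q pq, of "\<lambda>x y. f (u(0 := x, i := y))"] m2[OF u]
      by (simp add: case_prod_beta')
  qed
  also have "\<dots> = (\<integral>\<^sup>+v. f v \<partial>incr_law)"
    by (rule two[OF f, symmetric])
  finally show ?thesis .
qed

abbreviation G :: "(nat \<times> nat \<Rightarrow> real) \<Rightarrow> nat \<Rightarrow> nat \<Rightarrow> real" where
  "G e \<equiv> lpp (bweight \<alpha> \<beta> e)"

definition col_incr :: "nat \<Rightarrow> (nat \<times> nat \<Rightarrow> real) \<Rightarrow> nat \<Rightarrow> real" where
  "col_incr l e = (\<lambda>k\<in>{1..n}. G e k l - G e (k - 1) l)"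

text \<open>The increments of \<open>G\<close> along the down-right path that bounds the first \<open>i\<close> cells of column
  \<open>Suc l\<close> together with all columns up to \<open>l\<close>: index \<open>0\<close> holds the horizontal increment, all
  other indices hold vertical ones.\<close>

definition path_incr :: "nat \<Rightarrow> nat \<Rightarrow> (nat \<times> nat \<Rightarrow> real) \<Rightarrow> nat \<Rightarrow> real" where
  "path_incr l i e = (\<lambda>k\<in>{..n}. if k = 0 then G e (i - 1) (Suc l) - G e (i - 1) l
     else if k < i then G e k (Suc l) - G e (k - 1) (Suc l) else G e k l - G e (k - 1) l)"

text \<open>The weights revealed so far: all columns up to l and the first i cells of the next one.
  A finished column, i = n + 1, is the same state as the next column at i = 0; see
  \<open>cells_next\<close>.\<close>

definition cells :: "nat \<Rightarrow> nat \<Rightarrow> (nat \<times> nat) set" where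
  "cells l i = {..n} \<times> {..l} \<union> {..<i} \<times> {Suc l}"

lemma finite_cells: "finite (cells l i)"
  by (simp add: cells_def)

lemma cells_Suc: "cells l (Suc i) = insert (i, Suc l) (cells l i)"
  by (auto simp: cells_def)

lemma cells_next: "cells (Suc l) 0 = cells l (Suc n)"
  by (auto simp: cells_def le_Suc_eq)

lemma measurable_G_cells:
  "k \<le> n \<Longrightarrow> (k < i \<and> l' \<le> Suc l \<or> l' \<le> l) \<Longrightarrow> (\<lambda>e. G e k l') \<in> borel_measurable (noise (cells l i))"
  by (rule measurable_lpp) (auto simp: cells_def)

lemma measurable_path_incr:
  assumes "1 \<le> i" "i \<le> Suc n"
  shows "path_incr l i \<in> noise (cells l i) \<rightarrow>\<^sub>M incr_law"
proof -
  have "path_incr l i \<in> noise (cells l i) \<rightarrow>\<^sub>M PiM {..n} (\<lambda>_. borel)"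
    unfolding path_incr_def
  proof (rule measurable_restrict)
    fix k assume "k \<in> {..n}"
    then show "(\<lambda>e. if k = 0 then G e (i - 1) (Suc l) - G e (i - 1) l
        else if k < i then G e k (Suc l) - G e (k - 1) (Suc l) else G e k l - G e (k - 1) l)
        \<in> borel_measurable (noise (cells l i))"
      using assms by (cases "k = 0"; cases "k < i")
        (simp_all only: if_True if_False simp_thms, (intro borel_measurable_diff measurable_G_cells; force)+)
  qed
  then show ?thesis
    using measurable_cong_sets[OF refl sets_incr_law] by blast
qed

lemma measurable_col_incr: "col_incr l \<in> noise (cells l 0) \<rightarrow>\<^sub>M col_law"
proof -
  have "col_incr l \<in> noise (cells l 0) \<rightarrow>\<^sub>M PiM {1..n} (\<lambda>_. borel)"
    unfolding col_incr_def
    by (intro measurable_restrict borel_measurable_diff measurable_G_cells) auto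
  then show ?thesis
    using measurable_cong_sets[OF refl sets_col_law] by blast
qed

lemma measurable_tilt:
  assumes "(\<lambda>e. g e) \<in> borel_measurable M" "h \<in> M \<rightarrow>\<^sub>M N" "f \<in> borel_measurable N"
  shows "(\<lambda>e. ennreal (exp (s * g e)) * f (h e)) \<in> borel_measurable M"
proof -
  have "(\<lambda>e. exp (s * g e)) \<in> borel_measurable M"
    using assms(1) by measurable
  moreover have "(\<lambda>e. f (h e)) \<in> borel_measurable M"
    using measurable_comp[OF assms(2,3)] by (simp add: comp_def)
  ultimately show ?thesis
    by (intro borel_measurable_times_ennreal measurable_compose[OF _ measurable_ennreal])
qed

text \<open>At the start of a new column the down-right path consists of the vertical increments of
  column l and one fresh step of row 0.\<close>

lemma path_incr_first:
  "path_incr l 1 (e((0, Suc l) := y)) = (col_incr l e)(0 := \<alpha> * y)"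
  "G (e((0, Suc l) := y)) 0 (Suc l) = G e 0 l + \<alpha> * y"
proof -
  have *: "G (e((0, Suc l) := y)) k l = G e k l" for k
    by (rule lpp_noise_cong) auto
  show **: "G (e((0, Suc l) := y)) 0 (Suc l) = G e 0 l + \<alpha> * y"
    by (simp add: *) (simp add: bweight_def)
  show "path_incr l 1 (e((0, Suc l) := y)) = (col_incr l e)(0 := \<alpha> * y)"
    using ** by (auto simp: path_incr_def col_incr_def * fun_eq_iff simp del: lpp.simps)
qed

text \<open>Revealing the cell (i, l + 1) flips a corner of the path: its horizontal step moves from
  level i - 1 to level i. The recursion for G turns the two increments x and y at the corner into
  max (x - y) 0 + w and max (y - x) 0 + w, the map of \<open>burke_cell\<close>.\<close>

lemma path_incr_Suc:
  assumes i: "1 \<le> i" "i \<le> n"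
  shows "path_incr l (Suc i) (e((i, Suc l) := w)) =
     (let v = path_incr l i e in v(0 := max (v 0 - v i) 0 + w, i := max (v i - v 0) 0 + w))"
    "G (e((i, Suc l) := w)) 0 (Suc l) = G e 0 (Suc l)"
proof -
  have 1: "G (e((i, Suc l) := w)) k l = G e k l" for k
    by (rule lpp_noise_cong) auto
  have 2: "G (e((i, Suc l) := w)) k (Suc l) = G e k (Suc l)" if "k < i" for k
    by (rule lpp_noise_cong) (use that in auto)
  show "G (e((i, Suc l) := w)) 0 (Suc l) = G e 0 (Suc l)"
    by (rule 2) (use i in simp)
  obtain j where j: "i = Suc j" using i by (cases i) auto
  have 3: "G (e((i, Suc l) := w)) i (Suc l) = max (G e j (Suc l)) (G e i l) + w"
    using 2[of j] 1[of i] unfolding j by simp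
  show "path_incr l (Suc i) (e((i, Suc l) := w)) =
     (let v = path_incr l i e in v(0 := max (v 0 - v i) 0 + w, i := max (v i - v 0) 0 + w))"
  proof
    fix k
    consider "k = 0" | "k = i" | "k \<noteq> 0" "k < i" | "k > i" "k \<le> n" | "k > n" by linarith
    then show "path_incr l (Suc i) (e((i, Suc l) := w)) k =
     (let v = path_incr l i e in v(0 := max (v 0 - v i) 0 + w, i := max (v i - v 0) 0 + w)) k"
    proof cases
      case 1
      then show ?thesis
        using i 3 \<open>\<And>k. G (e((i, Suc l) := w)) k l = G e k l\<close>
        by (simp add: path_incr_def Let_def j del: lpp.simps)
    next
      case 2
      then show ?thesis
        using i 3 \<open>\<And>k. k < i \<Longrightarrow> G (e((i, Suc l) := w)) k (Suc l) = G e k (Suc l)\<close>[of j]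
        by (simp add: path_incr_def Let_def j del: lpp.simps)
    next
      case 3
      then show ?thesis
        using i 2[of k] 2[of "k - 1"] by (simp add: path_incr_def Let_def del: lpp.simps)
    next
      case 4
      then show ?thesis
        using i by (simp add: path_incr_def Let_def 1 del: lpp.simps)
    next
      case 5
      then show ?thesis
        using i by (simp add: path_incr_def Let_def del: lpp.simps)
    qed
  qed
qed

text \<open>B is the statement for the preceding column. The first cell of the new column adds a
  step of row 0; the tilt acts there and yields one more factor (p + s) / p. Every later cell leaves
  \<open>G e 0 (Suc l)\<close> alone and preserves the law of the increments.\<close>

lemma nn_integral_path_incr:
  assumes B: "\<And>f. f \<in> borel_measurable col_law \<Longrightarrow>
      (\<integral>\<^sup>+e. ennreal (exp (s * G e 0 l)) * f (col_incr l e) \<partial>noise (cells l 0)) =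
        ennreal (((p + s) / p) ^ l) * (\<integral>\<^sup>+u. f u \<partial>col_law)"
    and i: "1 \<le> i" "i \<le> Suc n" and f: "f \<in> borel_measurable incr_law"
  shows "(\<integral>\<^sup>+e. ennreal (exp (s * G e 0 (Suc l))) * f (path_incr l i e) \<partial>noise (cells l i)) =
        ennreal (((p + s) / p) ^ Suc l) * (\<integral>\<^sup>+v. f v \<partial>incr_law)"
  using i f
proof (induction i arbitrary: f rule: dec_induct)
  case base
  note f = base(2)
  have m: "(\<lambda>e. ennreal (exp (s * G e 0 (Suc l))) * f (path_incr l 1 e)) \<in> borel_measurable (noise (cells l 1))"
    by (rule measurable_tilt[OF measurable_G_cells measurable_path_incr f]) auto
  have fu: "(\<lambda>x. f (u(0 := x))) \<in> borel_measurable borel" if u: "u \<in> space col_law" for u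
  proof -
    have "(\<lambda>x. u(0 := x)) \<in> borel \<rightarrow>\<^sub>M PiM {..n} (\<lambda>_. borel)"
    proof (rule measurable_fun_upd)
      show "{..n} = {1..n} \<union> {0}" by auto
      show "(\<lambda>x. u) \<in> borel \<rightarrow>\<^sub>M PiM {1..n} (\<lambda>_. borel)"
        using u by (intro measurable_const) (simp add: col_law_def space_PiM)
    qed simp
    moreover have "f \<in> borel_measurable (PiM {..n} (\<lambda>_. borel))"
      using f measurable_cong_sets[OF sets_incr_law refl] by blast
    ultimately show ?thesis
      using measurable_comp[of "\<lambda>x. u(0 := x)"] by (auto simp: comp_def)
  qed
  define F where "F u = (\<integral>\<^sup>+x. f (u(0 := x)) \<partial>expo p)" for u
  have F: "F \<in> borel_measurable col_law"
  proof -
    interpret P: prob_space "expo p" by (rule prob_space_expo) (rule p)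
    have "(\<lambda>z. (fst z)(0 := snd z)) \<in> col_law \<Otimes>\<^sub>M expo p \<rightarrow>\<^sub>M PiM {..n} (\<lambda>_. borel)"
    proof (rule measurable_fun_upd)
      show "{..n} = {1..n} \<union> {0}" by auto
      show "fst \<in> col_law \<Otimes>\<^sub>M expo p \<rightarrow>\<^sub>M PiM {1..n} (\<lambda>_. borel)"
        using measurable_fst[of col_law "expo p"] measurable_cong_sets[OF refl sets_col_law] by blast
      show "snd \<in> col_law \<Otimes>\<^sub>M expo p \<rightarrow>\<^sub>M borel"
        using measurable_snd[of col_law "expo p"] by simp
    qed
    moreover have "f \<in> borel_measurable (PiM {..n} (\<lambda>_. borel))"
      using f measurable_cong_sets[OF sets_incr_law refl] by blast
    ultimately have "(\<lambda>z. f ((fst z)(0 := snd z))) \<in> borel_measurable (col_law \<Otimes>\<^sub>M expo p)"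
      using measurable_comp by (fastforce simp: comp_def)
    then show ?thesis
      unfolding F_def by (intro P.borel_measurable_nn_integral) (simp add: case_prod_beta')
  qed
  have "(\<integral>\<^sup>+e. ennreal (exp (s * G e 0 (Suc l))) * f (path_incr l 1 e) \<partial>noise (cells l 1)) =
     (\<integral>\<^sup>+e. \<integral>\<^sup>+y. ennreal (exp (s * (G e 0 l + \<alpha> * y))) * f ((col_incr l e)(0 := \<alpha> * y)) \<partial>expo 1 \<partial>noise (cells l 0))"
    using nn_integral_noise_insert[of "cells l 0" "(0, Suc l)", OF finite_cells _ m[unfolded One_nat_def cells_Suc]]
    unfolding One_nat_def[symmetric] path_incr_first
    by (simp add: cells_Suc) (simp add: cells_def)
  also have "\<dots> = (\<integral>\<^sup>+e. ennreal ((p + s) / p) * (ennreal (exp (s * G e 0 l)) * F (col_incr l e)) \<partial>noise (cells l 0))"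
  proof (rule nn_integral_cong)
    fix e assume "e \<in> space (noise (cells l 0))"
    then have sp: "col_incr l e \<in> space col_law"
      using measurable_space[OF measurable_col_incr] by blast
    note [measurable] = fu[OF sp]
    \<comment> \<open>Scaling by \<alpha> gives the new step the rate p + s; its share of the
      exponential weight then lowers this rate to p.\<close>
    have "(\<integral>\<^sup>+y. ennreal (exp (s * (G e 0 l + \<alpha> * y))) * f ((col_incr l e)(0 := \<alpha> * y)) \<partial>expo 1) =
      (\<integral>\<^sup>+x. ennreal (exp (s * (G e 0 l + x))) * f ((col_incr l e)(0 := x)) \<partial>expo (p + s))"
      using p s by (intro nn_integral_expo_scale[of "\<lambda>x. ennreal (exp (s * (G e 0 l + x))) * f ((col_incr l e)(0 := x))"]) auto
    also have "\<dots> = (\<integral>\<^sup>+x. ennreal (exp (s * G e 0 l)) * (ennreal (exp (s * x)) * f ((col_incr l e)(0 := x))) \<partial>expo (p + s))"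
      by (simp add: distrib_left exp_add ennreal_mult mult.assoc)
    also have "\<dots> = ennreal (exp (s * G e 0 l)) * (\<integral>\<^sup>+x. (ennreal (exp (s * x)) * f ((col_incr l e)(0 := x))) \<partial>expo (p + s))"
      by (rule nn_integral_cmult) simp
    also have "\<dots> = ennreal (exp (s * G e 0 l)) * (ennreal ((p + s) / p) * F (col_incr l e))"
      using p s by (subst nn_integral_expo_tilt) (auto simp: F_def)
    finally show "(\<integral>\<^sup>+y. ennreal (exp (s * (G e 0 l + \<alpha> * y))) * f ((col_incr l e)(0 := \<alpha> * y)) \<partial>expo 1) =
        ennreal ((p + s) / p) * (ennreal (exp (s * G e 0 l)) * F (col_incr l e))"
      by (simp add: mult_ac)
  qed
  also have "\<dots> = ennreal ((p + s) / p) * (\<integral>\<^sup>+e. ennreal (exp (s * G e 0 l)) * F (col_incr l e) \<partial>noise (cells l 0))"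
    by (intro nn_integral_cmult measurable_tilt[OF measurable_G_cells measurable_col_incr F]) auto
  also have "\<dots> = ennreal ((p + s) / p) * (ennreal (((p + s) / p) ^ l) * (\<integral>\<^sup>+u. F u \<partial>col_law))"
    by (subst B[OF F]) rule
  also have "\<dots> = ennreal (((p + s) / p) ^ Suc l) * (\<integral>\<^sup>+v. f v \<partial>incr_law)"
  proof -
    have "ennreal (((p + s) / p) ^ Suc l) = ennreal ((p + s) / p) * ennreal (((p + s) / p) ^ l)"
      unfolding power_Suc using p s by (intro ennreal_mult) auto
    then show ?thesis
      unfolding nn_integral_incr_law[OF f] F_def by (simp only: mult.assoc)
  qed
  finally show ?case .
next
  case (step i)
  note f = step(5)
  have i: "1 \<le> i" "i \<le> n" using step by auto
  have m: "(\<lambda>e. ennreal (exp (s * G e 0 (Suc l))) * f (path_incr l (Suc i) e)) \<in> borel_measurable (noise (cells l (Suc i)))"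
    by (rule measurable_tilt[OF measurable_G_cells measurable_path_incr f]) (use i in auto)
  define F where "F v = (\<integral>\<^sup>+w. f (v(0 := max (v 0 - v i) 0 + w, i := max (v i - v 0) 0 + w)) \<partial>expo 1)" for v
  have fu: "(\<lambda>w. f (v(0 := max (v 0 - v i) 0 + w, i := max (v i - v 0) 0 + w))) \<in> borel_measurable (expo 1)"
    if v: "v \<in> space incr_law" for v
  proof -
    have "i \<in> {1..n}" using i by simp
    from measurable_comp[OF measurable_Pair1'[OF v] measurable_flip[OF this f]]
    show ?thesis unfolding comp_def fst_conv snd_conv .
  qed
  interpret E1: prob_space "expo 1" by (rule prob_space_expo) simp
  have F: "F \<in> borel_measurable incr_law"
  proof -
    have "i \<in> {1..n}" using i by simp
    from measurable_flip[OF this f] show ?thesis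
      unfolding F_def by (intro E1.borel_measurable_nn_integral) (simp only: case_prod_beta')
  qed
  have "(\<integral>\<^sup>+e. ennreal (exp (s * G e 0 (Suc l))) * f (path_incr l (Suc i) e) \<partial>noise (cells l (Suc i))) =
     (\<integral>\<^sup>+e. \<integral>\<^sup>+w. ennreal (exp (s * G e 0 (Suc l))) * f (let v = path_incr l i e in v(0 := max (v 0 - v i) 0 + w, i := max (v i - v 0) 0 + w)) \<partial>expo 1 \<partial>noise (cells l i))"
    using nn_integral_noise_insert[of "cells l i" "(i, Suc l)", OF finite_cells _ m[unfolded cells_Suc]]
    unfolding path_incr_Suc[OF i]
    by (simp add: cells_Suc) (simp add: cells_def)
  also have "\<dots> = (\<integral>\<^sup>+e. ennreal (exp (s * G e 0 (Suc l))) * F (path_incr l i e) \<partial>noise (cells l i))"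
  proof (rule nn_integral_cong)
    fix e assume "e \<in> space (noise (cells l i))"
    then have sp: "path_incr l i e \<in> space incr_law"
      using measurable_space[OF measurable_path_incr] i by fastforce
    show "(\<integral>\<^sup>+w. ennreal (exp (s * G e 0 (Suc l))) * f (let v = path_incr l i e in v(0 := max (v 0 - v i) 0 + w, i := max (v i - v 0) 0 + w)) \<partial>expo 1) = 
      ennreal (exp (s * G e 0 (Suc l))) * F (path_incr l i e)"
      unfolding Let_def F_def by (rule nn_integral_cmult) (rule fu[OF sp])
  qed
  also have "\<dots> = ennreal (((p + s) / p) ^ Suc l) * (\<integral>\<^sup>+v. F v \<partial>incr_law)"
    using i by (intro step.IH F) auto
  also have "(\<integral>\<^sup>+v. F v \<partial>incr_law) = (\<integral>\<^sup>+v. f v \<partial>incr_law)"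
    unfolding F_def by (rule nn_integral_incr_law_flip) (use i f in auto)
  finally show ?case .
qed

text \<open>In column 0 the increments are the boundary weights themselves, so this base case only
  rescales the noise to rate q.\<close>

lemma col_incr_0:
  assumes f: "f \<in> borel_measurable col_law"
  shows "(\<integral>\<^sup>+e. f (col_incr 0 e) \<partial>noise (cells 0 0)) = (\<integral>\<^sup>+u. f u \<partial>col_law)"
proof -
  let ?P = "PiM {1..n} (\<lambda>k. expo 1 :: real measure)"
  let ?h = "\<lambda>e. \<lambda>k\<in>{1..n}. e (k, 0::nat)"
  have E1: "prob_space (expo 1)" and EQ: "prob_space (expo q)"
    using q by (auto intro!: prob_space_expo)
  have h: "distr (noise (cells 0 0)) ?P ?h = ?P"
    unfolding noise_def
    using distr_PiM_reindex[of "cells 0 0" "\<lambda>_. expo 1 :: real measure" "\<lambda>k. (k, 0)" "{1..n}"] E1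
    by (auto simp: inj_on_def cells_def)
  have "distr (expo 1) (expo q) (\<lambda>x. \<beta> * x) = expo q"
  proof (rule measure_eqI)
    fix A assume "A \<in> sets (distr (expo 1) (expo q) (\<lambda>x. \<beta> * x))"
    then have A[measurable]: "A \<in> sets borel" by simp
    have "emeasure (distr (expo 1) (expo q) (\<lambda>x. \<beta> * x)) A = (\<integral>\<^sup>+x. indicator A x \<partial>distr (expo 1) (expo q) (\<lambda>x. \<beta> * x))"
      by simp
    also have "\<dots> = (\<integral>\<^sup>+x. indicator A (\<beta> * x) \<partial>expo 1)"
      by (rule nn_integral_distr) auto
    also have "\<dots> = (\<integral>\<^sup>+x. indicator A x \<partial>expo q)"
      by (rule nn_integral_expo_scale) (use q in auto)
    finally show "emeasure (distr (expo 1) (expo q) (\<lambda>x. \<beta> * x)) A = emeasure (expo q) A" by simp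
  qed simp
  then have h2: "distr ?P col_law (compose {1..n} (\<lambda>x. \<beta> * x)) = col_law"
    using distr_PiM_finite_prob_space'[of "{1..n}" "\<lambda>_. expo 1" "\<lambda>_. expo q" "\<lambda>x. \<beta> * x"] E1 EQ
    by (simp add: col_law_def)
  have m1: "?h \<in> noise (cells 0 0) \<rightarrow>\<^sub>M ?P"
    unfolding noise_def by (intro measurable_restrict measurable_component_singleton) (auto simp: cells_def)
  have m2: "compose {1..n} (\<lambda>x. \<beta> * x) \<in> ?P \<rightarrow>\<^sub>M col_law"
    unfolding col_law_def compose_def
  proof (rule measurable_restrict)
    fix k assume "k \<in> {1..n}"
    then have "(\<lambda>x. x k) \<in> borel_measurable ?P"
      using measurable_component_singleton[of k "{1..n}" "\<lambda>_. expo 1"] by simp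
    then show "(\<lambda>x. \<beta> * x k) \<in> ?P \<rightarrow>\<^sub>M expo q"
      by simp
  qed
  have eq: "col_incr 0 e = compose {1..n} (\<lambda>x. \<beta> * x) (?h e)" for e
  proof -
    have "G e k 0 - G e (k - 1) 0 = \<beta> * e (k, 0)" if "1 \<le> k" for k
      using that by (cases k) (auto simp: bweight_def)
    then show ?thesis
      by (auto simp: col_incr_def compose_def fun_eq_iff)
  qed
  have f': "(\<lambda>x. f (compose {1..n} (\<lambda>x. \<beta> * x) x)) \<in> borel_measurable ?P"
    using measurable_comp[OF m2 f] by (simp add: comp_def)
  have "(\<integral>\<^sup>+e. f (col_incr 0 e) \<partial>noise (cells 0 0)) = (\<integral>\<^sup>+x. f (compose {1..n} (\<lambda>x. \<beta> * x) x) \<partial>distr (noise (cells 0 0)) ?P ?h)"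
    unfolding eq by (rule nn_integral_distr[OF m1, symmetric]) (use f' in simp)
  also have "\<dots> = (\<integral>\<^sup>+u. f u \<partial>distr ?P col_law (compose {1..n} (\<lambda>x. \<beta> * x)))"
    unfolding h by (rule nn_integral_distr[OF m2, symmetric]) (use f in simp)
  also have "\<dots> = (\<integral>\<^sup>+u. f u \<partial>col_law)" by (simp only: h2)
  finally show ?thesis .
qed

lemma nn_integral_col_incr:
  "f \<in> borel_measurable col_law \<Longrightarrow>
    (\<integral>\<^sup>+e. ennreal (exp (s * G e 0 l)) * f (col_incr l e) \<partial>noise (cells l 0)) =
      ennreal (((p + s) / p) ^ l) * (\<integral>\<^sup>+u. f u \<partial>col_law)"
proof (induction l arbitrary: f)
  case 0
  have "G e 0 0 = 0" for e by (simp add: bweight_def)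
  with 0 show ?case by (simp add: col_incr_0)
next
  case (Suc l)
  note f = Suc(2)
  \<comment> \<open>Forgets the horizontal step on top of the finished column; its law is integrated
    out with total mass 1.\<close>
  define F where "F v = f (restrict v {1..n})" for v
  have F: "F \<in> borel_measurable incr_law"
  proof -
    have "(\<lambda>v. restrict v {1..n}) \<in> incr_law \<rightarrow>\<^sub>M PiM {1..n} (\<lambda>_. borel)"
      by (intro measurable_restrict measurable_incr_component) auto
    moreover have "f \<in> borel_measurable (PiM {1..n} (\<lambda>_. borel))"
      using f measurable_cong_sets[OF sets_col_law refl] by blast
    ultimately show ?thesis
      unfolding F_def using measurable_comp by (fastforce simp: comp_def)
  qed
  have eq: "col_incr (Suc l) e = restrict (path_incr l (Suc n) e) {1..n}" for e
    by (auto simp: col_incr_def path_incr_def fun_eq_iff simp del: lpp.simps)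
  have "(\<integral>\<^sup>+e. ennreal (exp (s * G e 0 (Suc l))) * f (col_incr (Suc l) e) \<partial>noise (cells (Suc l) 0)) =
     (\<integral>\<^sup>+e. ennreal (exp (s * G e 0 (Suc l))) * F (path_incr l (Suc n) e) \<partial>noise (cells l (Suc n)))"
    unfolding cells_next eq F_def ..
  also have "\<dots> = ennreal (((p + s) / p) ^ Suc l) * (\<integral>\<^sup>+v. F v \<partial>incr_law)"
    by (rule nn_integral_path_incr[OF Suc.IH _ _ F]) auto
  also have "(\<integral>\<^sup>+v. F v \<partial>incr_law) = (\<integral>\<^sup>+u. f u \<partial>col_law)"
  proof -
    have E: "emeasure (expo p) UNIV = 1"
      using prob_space.emeasure_space_1[OF prob_space_expo[OF p]] by simp
    have "restrict (u(0 := x)) {1..n} = u" if "u \<in> space col_law" for u :: "nat \<Rightarrow> real" and x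
      using that by (auto simp: col_law_def space_PiM fun_eq_iff PiE_iff extensional_def restrict_def)
    then show ?thesis
      unfolding nn_integral_incr_law[OF F] by (intro nn_integral_cong) (simp add: E F_def del: restrict_fupd)
  qed
  finally show ?case .
qed

text \<open>G(n,N) is G(0,N) plus the n increments of column N. The weight exp(s G(0,N)) is paid for
  by ((p + s) / p) ^ N, and under the tilted law the increments are independent of rate q, each
  contributing q / (q - s).\<close>

theorem nn_integral_exp_lpp:
  "(\<integral>\<^sup>+e. ennreal (exp (s * G e n N)) \<partial>noise ({..n} \<times> {..N})) =
     ennreal (((p + s) / p) ^ N * (q / (q - s)) ^ n)"
proof -
  define f where "f u = (\<Prod>k\<in>{1..n}. ennreal (exp (s * u k)))" for u :: "nat \<Rightarrow> real"
  have f: "f \<in> borel_measurable col_law"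
  proof -
    have "(\<lambda>u. u k) \<in> borel_measurable col_law" if "k \<in> {1..n}" for k
      using that measurable_component_singleton[of k "{1..n}" "\<lambda>_. expo q"] by (simp add: col_law_def)
    then have "(\<lambda>u. ennreal (exp (s * u k))) \<in> borel_measurable col_law" if "k \<in> {1..n}" for k
      using that by measurable
    then show ?thesis unfolding f_def by (intro borel_measurable_prod_ennreal)
  qed
  have tele: "(\<Sum>k\<in>{1..j}. G e k N - G e (k - 1) N) = G e j N - G e 0 N" for e j
    by (induction j) (auto simp: algebra_simps simp del: lpp.simps)
  have "ennreal (exp (s * G e n N)) = ennreal (exp (s * G e 0 N)) * f (col_incr N e)" for e
  proof -
    have "f (col_incr N e) = (\<Prod>k\<in>{1..n}. ennreal (exp (s * (G e k N - G e (k - 1) N))))"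
      unfolding f_def col_incr_def by (intro prod.cong) auto
    also have "\<dots> = ennreal (exp (\<Sum>k\<in>{1..n}. s * (G e k N - G e (k - 1) N)))"
      by (simp add: prod_ennreal exp_sum)
    also have "(\<Sum>k\<in>{1..n}. s * (G e k N - G e (k - 1) N)) = s * (G e n N - G e 0 N)"
      by (simp only: sum_distrib_left[symmetric] tele)
    finally show ?thesis
      by (simp add: ennreal_mult[symmetric] exp_add[symmetric] algebra_simps)
  qed
  moreover have "{..n} \<times> {..N} = cells N 0" by (simp add: cells_def)
  ultimately have "(\<integral>\<^sup>+e. ennreal (exp (s * G e n N)) \<partial>noise ({..n} \<times> {..N})) =
      ennreal (((p + s) / p) ^ N) * (\<integral>\<^sup>+u. f u \<partial>col_law)"
    using nn_integral_col_incr[OF f] by simp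
  also have "(\<integral>\<^sup>+u. f u \<partial>col_law) = (\<Prod>k\<in>{1..n}. \<integral>\<^sup>+x. ennreal (exp (s * x)) \<partial>expo q)"
  proof -
    interpret product_sigma_finite "\<lambda>_::nat. expo q"
      by (rule product_sigma_finite_expo) (rule q)
    show ?thesis
      unfolding f_def col_law_def by (rule product_nn_integral_prod) auto
  qed
  also have "\<dots> = ennreal ((q / (q - s)) ^ n)"
    using q s by (simp add: nn_integral_expo_exp ennreal_power)
  also have "ennreal (((p + s) / p) ^ N) * \<dots> = ennreal (((p + s) / p) ^ N * (q / (q - s)) ^ n)"
    using p q s by (intro ennreal_mult[symmetric]) auto
  finally show ?thesis .
qed

end

section \<open>Weak convergence on product spaces and a maximal inequality\<close>

lemma indep_vars_PiM_components:
  assumes "\<And>i. i \<in> I \<Longrightarrow> prob_space (M i)" "I \<noteq> {}"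
  shows "prob_space.indep_vars (PiM I M) M (\<lambda>i x. x i) I"
proof -
  interpret prob_space "PiM I M" by (rule prob_space_PiM) fact
  have "distr (PiM I M) (PiM I M) (\<lambda>x. restrict x I) = distr (PiM I M) (PiM I M) (\<lambda>x. x)"
    by (intro distr_cong) (auto simp: space_PiM PiE_def)
  also have "\<dots> = PiM I (\<lambda>i. distr (PiM I M) (M i) (\<lambda>x. x i))"
    using assms(1) by (subst distr_id) (auto intro!: PiM_cong simp: distr_PiM_component)
  finally show ?thesis
    using assms(2) by (subst indep_vars_iff_distr_eq_PiM') auto
qed

lemma measurable_component_compose:
  "i \<in> I \<Longrightarrow> f \<in> M i \<rightarrow>\<^sub>M N \<Longrightarrow> (\<lambda>x. f (x i)) \<in> PiM I M \<rightarrow>\<^sub>M N"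
  by (rule measurable_compose[where f="\<lambda>x. x i" and g=f]) (rule measurable_component_singleton)

lemma distr_PiM_componentwise:
  assumes P: "\<And>i. i \<in> I \<Longrightarrow> prob_space (M i)" and f: "\<And>i. i \<in> I \<Longrightarrow> f i \<in> M i \<rightarrow>\<^sub>M N i" and "I \<noteq> {}"
  shows "distr (PiM I M) (PiM I N) (\<lambda>x. \<lambda>i\<in>I. f i (x i)) = PiM I (\<lambda>i. distr (M i) (N i) (f i))"
proof -
  interpret prob_space "PiM I M" by (rule prob_space_PiM) fact
  have ind: "indep_vars N (\<lambda>i x. f i (x i)) I"
    using indep_vars_compose2[OF indep_vars_PiM_components[OF P \<open>I \<noteq> {}\<close>] f] by auto
  have m: "random_variable (N i) (\<lambda>x. f i (x i))" if "i \<in> I" for i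
    by (rule measurable_component_compose) (use that f in auto)
  have "distr (PiM I M) (PiM I N) (\<lambda>x. \<lambda>i\<in>I. f i (x i)) =
      PiM I (\<lambda>i. distr (PiM I M) (N i) (\<lambda>x. f i (x i)))"
    by (rule iffD1[OF indep_vars_iff_distr_eq_PiM'[OF \<open>I \<noteq> {}\<close> m] ind])
  also have "\<dots> = PiM I (\<lambda>i. distr (M i) (N i) (f i))"
  proof (rule PiM_cong[OF refl])
    fix i assume i: "i \<in> I"
    have "distr (PiM I M) (N i) (\<lambda>x. f i (x i)) = distr (distr (PiM I M) (M i) (\<lambda>x. x i)) (N i) (f i)"
      using i f by (subst distr_distr) (auto simp: comp_def)
    also have "distr (PiM I M) (M i) (\<lambda>x. x i) = M i"
      using P i by (rule distr_PiM_component)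
    finally show "distr (PiM I M) (N i) (\<lambda>x. f i (x i)) = distr (M i) (N i) (f i)" .
  qed
  finally show ?thesis .
qed

text \<open>Skorohod's representation in each coordinate reduces this to Fatou's lemma.\<close>

lemma weak_conv_PiM_Fatou:
  fixes \<mu> :: "'i \<Rightarrow> nat \<Rightarrow> real measure"
  assumes "I \<noteq> {}"
    and real: "\<And>i b. i \<in> I \<Longrightarrow> real_distribution (\<mu> i b)" "\<And>i. i \<in> I \<Longrightarrow> real_distribution (\<nu> i)"
    and weak: "\<And>i. i \<in> I \<Longrightarrow> weak_conv_m (\<mu> i) (\<nu> i)"
    and F: "F \<in> borel_measurable (PiM I (\<lambda>_. borel))"
    and lsc: "\<And>x y. (\<And>i. i \<in> I \<Longrightarrow> (\<lambda>b. y b i) \<longlonglongrightarrow> x i) \<Longrightarrow> (F x :: ennreal) \<le> liminf (\<lambda>b. F (y b))"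
  shows "(\<integral>\<^sup>+x. F x \<partial>PiM I \<nu>) \<le> liminf (\<lambda>b. \<integral>\<^sup>+x. F x \<partial>PiM I (\<lambda>i. \<mu> i b))"
proof -
  \<comment> \<open>A triple consists of a probability space, the approximating variables and their
    limit. The triples are chosen for all coordinates at once; on the product of the spaces the
    coordinates are independent and converge everywhere.\<close>
  define sk where "sk i t \<longleftrightarrow> (case t of (\<Omega> :: real measure, Y :: nat \<Rightarrow> real \<Rightarrow> real, Z :: real \<Rightarrow> real) \<Rightarrow>
      prob_space \<Omega> \<and> (\<forall>b. Y b \<in> borel_measurable \<Omega>) \<and> (\<forall>b. distr \<Omega> borel (Y b) = \<mu> i b) \<and>
      Z \<in> borel_measurable \<Omega> \<and> distr \<Omega> borel Z = \<nu> i \<and> (\<forall>x\<in>space \<Omega>. (\<lambda>b. Y b x) \<longlonglongrightarrow> Z x))" for i t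
  have "\<exists>t. sk i t" if i: "i \<in> I" for i
    using Skorohod[OF real(1)[OF i] real(2)[OF i] weak[OF i]] unfolding sk_def
    by (simp add: measurable_lborel1)
  then have "\<exists>t. \<forall>i\<in>I. sk i (t i)" by (intro bchoice) blast
  then obtain t where t: "\<And>i. i \<in> I \<Longrightarrow> sk i (t i)" by blast
  define \<Omega> where "\<Omega> i = fst (t i)" for i
  define Y where "Y i = fst (snd (t i))" for i
  define Z where "Z i = snd (snd (t i))" for i
  have sk: "prob_space (\<Omega> i)" "Y i b \<in> borel_measurable (\<Omega> i)" "distr (\<Omega> i) borel (Y i b) = \<mu> i b"
      "Z i \<in> borel_measurable (\<Omega> i)" "distr (\<Omega> i) borel (Z i) = \<nu> i"
      "x \<in> space (\<Omega> i) \<Longrightarrow> (\<lambda>b. Y i b x) \<longlonglongrightarrow> Z i x" if "i \<in> I" for i b x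
    using t[OF that] by (simp_all add: sk_def \<Omega>_def Y_def Z_def case_prod_beta)
  let ?P = "PiM I \<Omega>"
  let ?Y = "\<lambda>b x. \<lambda>i\<in>I. Y i b (x i)"
  let ?Z = "\<lambda>x. \<lambda>i\<in>I. Z i (x i)"
  have Y: "?Y b \<in> ?P \<rightarrow>\<^sub>M PiM I (\<lambda>_. borel)" for b
    by (intro measurable_restrict measurable_component_compose sk(2))
  have Z: "?Z \<in> ?P \<rightarrow>\<^sub>M PiM I (\<lambda>_. borel)"
    by (intro measurable_restrict measurable_component_compose sk(4))
  have dY: "distr ?P (PiM I (\<lambda>_. borel)) (?Y b) = PiM I (\<lambda>i. \<mu> i b)" for b
    using distr_PiM_componentwise[of I \<Omega> "\<lambda>i. Y i b" "\<lambda>_. borel"] sk \<open>I \<noteq> {}\<close>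
    by (simp cong: PiM_cong)
  have dZ: "distr ?P (PiM I (\<lambda>_. borel)) ?Z = PiM I \<nu>"
    using distr_PiM_componentwise[of I \<Omega> Z "\<lambda>_. borel"] sk \<open>I \<noteq> {}\<close> by (simp cong: PiM_cong)
  have "(\<integral>\<^sup>+x. F x \<partial>PiM I \<nu>) = (\<integral>\<^sup>+x. F (?Z x) \<partial>?P)"
    unfolding dZ[symmetric] by (rule nn_integral_distr[OF Z]) (use F in simp)
  also have "\<dots> \<le> (\<integral>\<^sup>+x. liminf (\<lambda>b. F (?Y b x)) \<partial>?P)"
    by (intro nn_integral_mono lsc) (auto simp: space_PiM PiE_iff intro!: sk)
  also have "\<dots> \<le> liminf (\<lambda>b. \<integral>\<^sup>+x. F (?Y b x) \<partial>?P)"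
    by (rule nn_integral_liminf) (use measurable_compose[OF Y F] in simp)
  also have "(\<lambda>b. \<integral>\<^sup>+x. F (?Y b x) \<partial>?P) = (\<lambda>b. \<integral>\<^sup>+x. F x \<partial>PiM I (\<lambda>i. \<mu> i b))"
    unfolding dY[symmetric] by (intro ext nn_integral_distr[OF Y, symmetric]) (use F in simp)
  finally show ?thesis .
qed

text \<open>The walk is frozen once it has reached a, so that reaching a at any time becomes an
  event of the final value, to which Markov's inequality applies.\<close>

fun stopped :: "real \<Rightarrow> (real \<Rightarrow> real) \<Rightarrow> nat \<Rightarrow> (nat \<Rightarrow> real) \<Rightarrow> real" where
  "stopped a g 0 x = 0"
| "stopped a g (Suc d) x = (if a \<le> stopped a g d x then stopped a g d x else stopped a g d x + g (x d))"

lemma stopped_cong: "(\<And>k. k < d \<Longrightarrow> x k = y k) \<Longrightarrow> stopped a g d x = stopped a g d y"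
  by (induction d) auto

lemma stopped_eq_sum:
  "(\<And>d'. d' < d \<Longrightarrow> (\<Sum>k<d'. g (x k)) < a) \<Longrightarrow> stopped a g d x = (\<Sum>k<d. g (x k))"
proof (induction d)
  case (Suc d)
  then have "stopped a g d x = (\<Sum>k<d. g (x k))" by simp
  moreover have "(\<Sum>k<d. g (x k)) < a" using Suc(2) by simp
  ultimately show ?case by simp
qed simp

lemma stopped_ge:
  assumes "d \<le> b" "a \<le> (\<Sum>k<d. g (x k))"
  shows "a \<le> stopped a g b x"
proof -
  \<comment> \<open>The first passage index: up to it nothing has been frozen, and from it on the
    value no longer changes.\<close>
  define d0 where "d0 = (LEAST d. a \<le> (\<Sum>k<d. g (x k)))"
  have d0: "a \<le> (\<Sum>k<d0. g (x k))" "d0 \<le> d"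
    unfolding d0_def using assms(2) by (auto intro: LeastI Least_le)
  have "stopped a g d0 x = (\<Sum>k<d0. g (x k))"
  proof (rule stopped_eq_sum)
    fix d' assume "d' < d0"
    then show "(\<Sum>k<d'. g (x k)) < a"
      using not_less_Least[of d' "\<lambda>d. a \<le> (\<Sum>k<d. g (x k))"] by (simp add: d0_def not_le)
  qed
  with d0 have "a \<le> stopped a g d0 x" by simp
  moreover have "a \<le> stopped a g (d0 + j) x" if "a \<le> stopped a g d0 x" for j
    using that by (induction j) auto
  ultimately show ?thesis
    using d0(2) assms(1) by (metis le_add_diff_inverse le_trans)
qed

text \<open>The mean of \<open>exp (K * stopped a g d x)\<close> grows by a factor of at most \<rho>
  per step: by the hypothesis on g while the walk runs, and by 1 \<le> \<rho> once it is frozen.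
  Markov's inequality at level a concludes.\<close>

lemma maximal_inequality:
  fixes \<mu> :: "real measure"
  assumes "prob_space \<mu>" and sets_mu: "sets \<mu> = sets borel"
    and g: "g \<in> borel_measurable borel" and K: "0 \<le> K" and \<rho>: "1 \<le> \<rho>"
    and mgf: "(\<integral>\<^sup>+y. ennreal (exp (K * g y)) \<partial>\<mu>) \<le> ennreal \<rho>"
  shows "emeasure (PiM {..<b} (\<lambda>_. \<mu>)) {x \<in> space (PiM {..<b} (\<lambda>_. \<mu>)). \<exists>d\<le>b. a \<le> (\<Sum>k<d. g (x k))}
    \<le> ennreal (exp (- K * a) * \<rho> ^ b)"
proof -
  interpret mu: prob_space \<mu> by fact
  interpret product_sigma_finite "\<lambda>_::nat. \<mu>"
    by (intro product_sigma_finite.intro) (rule mu.sigma_finite_measure_axioms)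
  have g': "g \<in> borel_measurable \<mu>"
    using g measurable_cong_sets[OF sets_mu refl] by blast
  have meas: "stopped a g d \<in> borel_measurable (PiM {..<b} (\<lambda>_. \<mu>))" if "d \<le> b" for d b
    using that
  proof (induction d)
    case 0
    have "stopped a g 0 = (\<lambda>x. 0)" by (rule ext) simp
    then show ?case by simp
  next
    case (Suc d)
    then have [measurable]: "stopped a g d \<in> borel_measurable (PiM {..<b} (\<lambda>_. \<mu>))" by simp
    have [measurable]: "(\<lambda>x. g (x d)) \<in> borel_measurable (PiM {..<b} (\<lambda>_. \<mu>))"
      by (intro measurable_component_compose g') (use Suc(2) in auto)
    show ?case by (simp only: stopped.simps) measurable
  qed
  have bound: "(\<integral>\<^sup>+x. ennreal (exp (K * stopped a g b x)) \<partial>PiM {..<b} (\<lambda>_. \<mu>)) \<le> ennreal (\<rho> ^ b)" for b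
  proof (induction b)
    case 0
    interpret P: prob_space "PiM {..<0::nat} (\<lambda>_. \<mu>)" by (intro prob_space_PiM assms(1))
    show ?case using P.emeasure_space_1 by simp
  next
    case (Suc b)
    have [measurable]: "stopped a g b \<in> borel_measurable (PiM {..<b} (\<lambda>_. \<mu>))"
      by (rule meas) simp
    have "(\<integral>\<^sup>+x. ennreal (exp (K * stopped a g (Suc b) x)) \<partial>PiM {..<Suc b} (\<lambda>_. \<mu>)) =
       (\<integral>\<^sup>+x. \<integral>\<^sup>+y. ennreal (exp (K * stopped a g (Suc b) (x(b := y)))) \<partial>\<mu> \<partial>PiM {..<b} (\<lambda>_. \<mu>))"
      unfolding lessThan_Suc
    proof (rule product_nn_integral_insert)
      have "stopped a g (Suc b) \<in> borel_measurable (PiM (insert b {..<b}) (\<lambda>_. \<mu>))"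
        using meas[of "Suc b" "Suc b"] by (simp add: lessThan_Suc)
      then show "(\<lambda>x. ennreal (exp (K * stopped a g (Suc b) x))) \<in> borel_measurable (PiM (insert b {..<b}) (\<lambda>_. \<mu>))"
        by measurable
    qed auto
    also have "\<dots> \<le> (\<integral>\<^sup>+x. ennreal \<rho> * ennreal (exp (K * stopped a g b x)) \<partial>PiM {..<b} (\<lambda>_. \<mu>))"
    proof (rule nn_integral_mono)
      fix x
      have s: "stopped a g b (x(b := y)) = stopped a g b x" for y
        by (rule stopped_cong) auto
      show "(\<integral>\<^sup>+y. ennreal (exp (K * stopped a g (Suc b) (x(b := y)))) \<partial>\<mu>) \<le> ennreal \<rho> * ennreal (exp (K * stopped a g b x))"
      proof (cases "a \<le> stopped a g b x")
        case True
        have "1 * ennreal (exp (K * stopped a g b x)) \<le> ennreal \<rho> * ennreal (exp (K * stopped a g b x))"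
          using \<rho> by (intro mult_right_mono) auto
        then show ?thesis using True by (simp add: s mu.emeasure_space_1)
      next
        case False
        then have "(\<integral>\<^sup>+y. ennreal (exp (K * stopped a g (Suc b) (x(b := y)))) \<partial>\<mu>) =
            (\<integral>\<^sup>+y. ennreal (exp (K * stopped a g b x)) * ennreal (exp (K * g y)) \<partial>\<mu>)"
          by (simp add: s distrib_left exp_add ennreal_mult)
        also have "\<dots> = ennreal (exp (K * stopped a g b x)) * (\<integral>\<^sup>+y. ennreal (exp (K * g y)) \<partial>\<mu>)"
          by (rule nn_integral_cmult) (use g' in measurable)
        also have "\<dots> \<le> ennreal (exp (K * stopped a g b x)) * ennreal \<rho>"
          by (intro mult_left_mono mgf) simp
        finally show ?thesis by (simp add: mult.commute)
      qed
    qed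
    also have "\<dots> = ennreal \<rho> * (\<integral>\<^sup>+x. ennreal (exp (K * stopped a g b x)) \<partial>PiM {..<b} (\<lambda>_. \<mu>))"
      by (rule nn_integral_cmult) measurable
    also have "\<dots> \<le> ennreal \<rho> * ennreal (\<rho> ^ b)"
      by (intro mult_left_mono Suc.IH) simp
    also have "\<dots> = ennreal (\<rho> ^ Suc b)"
      using \<rho> by (simp add: ennreal_mult)
    finally show ?case .
  qed
  let ?P = "PiM {..<b} (\<lambda>_. \<mu>)"
  have [measurable]: "stopped a g b \<in> borel_measurable ?P" by (rule meas) simp
  have "emeasure ?P {x \<in> space ?P. \<exists>d\<le>b. a \<le> (\<Sum>k<d. g (x k))} \<le> emeasure ?P {x \<in> space ?P. a \<le> stopped a g b x}"
  proof (rule emeasure_mono)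
    show "{x \<in> space ?P. \<exists>d\<le>b. a \<le> (\<Sum>k<d. g (x k))} \<subseteq> {x \<in> space ?P. a \<le> stopped a g b x}"
      using stopped_ge by blast
  qed measurable
  also have "\<dots> = (\<integral>\<^sup>+x. indicator {x \<in> space ?P. a \<le> stopped a g b x} x \<partial>?P)"
    by (rule nn_integral_indicator[symmetric]) measurable
  also have "\<dots> \<le> (\<integral>\<^sup>+x. ennreal (exp (- K * a)) * ennreal (exp (K * stopped a g b x)) \<partial>?P)"
  proof (rule nn_integral_mono)
    fix x
    show "indicator {x \<in> space ?P. a \<le> stopped a g b x} x \<le> ennreal (exp (- K * a)) * ennreal (exp (K * stopped a g b x))"
    proof (cases "a \<le> stopped a g b x")
      case True
      then have "0 \<le> - K * a + K * stopped a g b x"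
        using K by (simp add: mult_left_mono)
      then have "1 \<le> exp (- K * a) * exp (K * stopped a g b x)"
        unfolding exp_add[symmetric] by simp
      then show ?thesis by (simp add: ennreal_mult[symmetric] indicator_def)
    qed simp
  qed
  also have "\<dots> = ennreal (exp (- K * a)) * (\<integral>\<^sup>+x. ennreal (exp (K * stopped a g b x)) \<partial>?P)"
    by (rule nn_integral_cmult) measurable
  also have "\<dots> \<le> ennreal (exp (- K * a)) * ennreal (\<rho> ^ b)"
    by (intro mult_left_mono bound) simp
  also have "\<dots> = ennreal (exp (- K * a) * \<rho> ^ b)"
    using \<rho> by (simp add: ennreal_mult)
  finally show ?thesis .
qed

section \<open>The Gaussian limit\<close>

definition normalized_sum_law :: "nat \<Rightarrow> real measure" where
  "normalized_sum_law b =
     distr (PiM {..<b} (\<lambda>_. expo 1)) borel (\<lambda>x. (\<Sum>k<b. x k - 1) / sqrt (real b))"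

lemma normalized_sum_measurable:
  "(\<And>k. k < b \<Longrightarrow> c k \<in> I) \<Longrightarrow>
   (\<lambda>x. (\<Sum>k<b. x (c k) - 1) / sqrt (real b)) \<in> borel_measurable (PiM I (\<lambda>_. expo 1))"
proof -
  assume c: "\<And>k. k < b \<Longrightarrow> c k \<in> I"
  have "(\<lambda>x. x (c k)) \<in> borel_measurable (PiM I (\<lambda>_. expo 1))" if "k < b" for k
    using measurable_component_singleton[of "c k" I "\<lambda>_. expo 1"] c[OF that] by simp
  then show ?thesis
    by (intro borel_measurable_divide borel_measurable_sum borel_measurable_diff) auto
qed

lemma distr_normalized_sum:
  assumes "inj_on c {..<b}" "\<And>k. k < b \<Longrightarrow> c k \<in> I"
  shows "distr (PiM I (\<lambda>_. expo 1)) borel (\<lambda>x. (\<Sum>k<b. x (c k) - 1) / sqrt (real b)) = normalized_sum_law b"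
proof -
  let ?t = "\<lambda>x. \<lambda>k\<in>{..<b}. x (c k)"
  have m: "?t \<in> PiM I (\<lambda>_. expo 1) \<rightarrow>\<^sub>M PiM {..<b} (\<lambda>_. expo 1)"
    using assms(2) by (intro measurable_restrict measurable_component_singleton) auto
  have "distr (PiM I (\<lambda>_. expo 1)) (PiM {..<b} (\<lambda>_. expo 1)) ?t = PiM {..<b} (\<lambda>_. expo 1)"
    by (rule distr_PiM_reindex) (use assms prob_space_expo in auto)
  then have "normalized_sum_law b =
      distr (distr (PiM I (\<lambda>_. expo 1)) (PiM {..<b} (\<lambda>_. expo 1)) ?t) borel (\<lambda>x. (\<Sum>k<b. x k - 1) / sqrt (real b))"
    by (simp add: normalized_sum_law_def)
  also have "\<dots> = distr (PiM I (\<lambda>_. expo 1)) borel ((\<lambda>x. (\<Sum>k<b. x k - 1) / sqrt (real b)) \<circ> ?t)"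
    by (rule distr_distr) (use m normalized_sum_measurable[of b "\<lambda>k. k"] in auto)
  also have "(\<lambda>x. (\<Sum>k<b. x k - 1) / sqrt (real b)) \<circ> ?t = (\<lambda>x. (\<Sum>k<b. x (c k) - 1) / sqrt (real b))"
    by (auto simp: fun_eq_iff)
  finally show ?thesis by simp
qed

lemma real_distribution_expo: "0 < r \<Longrightarrow> real_distribution (expo r)"
  using prob_space_expo by (simp add: real_distribution_def real_distribution_axioms_def)

lemma real_distribution_normalized_sum_law: "real_distribution (normalized_sum_law b)"
proof -
  interpret prob_space "PiM {..<b} (\<lambda>_. expo 1)"
    by (intro prob_space_PiM prob_space_expo) simp
  show ?thesis
    unfolding normalized_sum_law_def
    by (rule real_distribution_distr) (rule normalized_sum_measurable, simp)
qed

lemma weak_conv_normalized_sum: "weak_conv_m normalized_sum_law std_normal_distribution"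
proof -
  let ?P = "PiM UNIV (\<lambda>_::nat. expo 1)"
  have E: "prob_space (expo 1)" by (rule prob_space_expo) simp
  interpret P: prob_space ?P by (intro prob_space_PiM E)
  have ind: "P.indep_vars (\<lambda>_. expo 1) (\<lambda>i x. x i) UNIV"
    using indep_vars_PiM_components[of UNIV "\<lambda>_::nat. expo 1"] E by simp
  have ind': "P.indep_vars (\<lambda>_. borel) (\<lambda>i x. x i) UNIV"
    using P.indep_vars_compose2[OF ind, of "\<lambda>_ x. x" "\<lambda>_. borel"] by simp
  have d: "distr ?P borel (\<lambda>x. x k) = expo 1" for k
  proof -
    have "distr ?P borel (\<lambda>x. x k) = distr ?P (expo 1) (\<lambda>x. x k)"
      by (rule distr_cong) auto
    also have "\<dots> = expo 1" by (rule distr_PiM_component) (use E in auto)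
    finally show ?thesis .
  qed
  have rv: "(\<lambda>x. x k) \<in> borel_measurable ?P" for k
    using measurable_component_singleton[of k UNIV "\<lambda>_. expo 1"] by simp
  have D: "distributed ?P lborel (\<lambda>x. x k) (exponential_density 1)" for k
  proof -
    have "distr ?P lborel (\<lambda>x. x k) = distr ?P borel (\<lambda>x. x k)"
      by (rule distr_cong) auto
    then show ?thesis
      unfolding distributed_def using d[of k] rv[of k] by (simp add: measurable_lborel1)
  qed
  have sq: "integrable ?P (\<lambda>x. (x k)\<^sup>2)" for k
  proof -
    have "(\<integral>\<^sup>+ x. ennreal (erlang_density 0 1 x * x ^ 2) \<partial>lborel) < \<infinity>"
      by (subst nn_integral_erlang_ith_moment) (auto simp: ennreal_mult_less_top)
    then have "integrable lborel (\<lambda>x. exponential_density 1 x * x\<^sup>2)"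
      by (intro integrableI_nonneg) (auto simp: AE_I2)
    then show ?thesis
      using distributed_integrable[OF D[of k], of "\<lambda>x. x\<^sup>2"] by simp
  qed
  have var: "P.variance (\<lambda>x. x k) = 1\<^sup>2" for k
    using P.exponential_distributed_variance[OF _ D] by simp
  have ex: "P.expectation (\<lambda>x. x k) = 1" for k
    using P.exponential_distributed_expectation[OF _ D] by simp
  have "weak_conv_m (\<lambda>n. distr ?P borel (\<lambda>x. (\<Sum>i<n. x i - 1) / sqrt (real n * 1\<^sup>2))) std_normal_distribution"
    by (rule P.central_limit_theorem[where X="\<lambda>i x. x i" and \<mu>="expo 1" and \<sigma>=1 and m=1])
       (use ind' sq var ex d in \<open>auto simp del: power_one\<close>)
  moreover have "distr ?P borel (\<lambda>x. (\<Sum>i<n. x i - 1) / sqrt (real n * 1\<^sup>2)) = normalized_sum_law n" for n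
    using distr_normalized_sum[of "\<lambda>k. k" n UNIV] by (simp add: inj_on_def)
  ultimately show ?thesis by simp
qed

text \<open>In the index set of the limit, \<open>(i, 0)\<close> carries the initial gap below level \<open>i\<close> and
  \<open>(i, Suc j)\<close> the normalised increment of level \<open>i\<close> in the \<open>j\<close>-th time step.\<close>

definition cell_index :: "nat \<Rightarrow> nat \<Rightarrow> (nat \<times> nat) set" where
  "cell_index n m = {..<n} \<times> {..m}"

definition block_law :: "nat \<Rightarrow> nat \<Rightarrow> nat \<Rightarrow> (nat \<times> nat \<Rightarrow> real) measure" where
  "block_law n m b = PiM (cell_index n m) (\<lambda>c. if snd c = 0 then expo 1 else normalized_sum_law b)"

definition gauss_law :: "nat \<Rightarrow> nat \<Rightarrow> (nat \<times> nat \<Rightarrow> real) measure" where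
  "gauss_law n m = PiM (cell_index n m) (\<lambda>c. if snd c = 0 then expo 1 else std_normal_distribution)"

text \<open>Level i reads row i + 1, as row 0 of the noise is a boundary. Likewise time step j reads
  the columns j b + 1 to j b + b, as column 0 holds the gaps.\<close>

definition block_map :: "nat \<Rightarrow> (nat \<times> nat \<Rightarrow> real) \<Rightarrow> nat \<times> nat \<Rightarrow> real" where
  "block_map b e c = (case snd c of 0 \<Rightarrow> e (Suc (fst c), 0)
     | Suc j \<Rightarrow> (\<Sum>k<b. e (Suc (fst c), Suc (j * b + k)) - 1) / sqrt (real b))"

lemma block_index_less: "j < m \<Longrightarrow> k < b \<Longrightarrow> Suc (j * b + k) \<le> m * (b::nat)"
proof -
  assume "j < m" "k < b"
  then have "j * b + k < Suc j * b" by simp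
  also have "\<dots> \<le> m * b" using \<open>j < m\<close> by (intro mult_right_mono) auto
  finally show ?thesis by simp
qed

lemma distr_block_map:
  assumes b: "0 < b" and n: "0 < n"
  shows "distr (noise ({..n} \<times> {..m * b})) (PiM (cell_index n m) (\<lambda>_. borel))
     (\<lambda>e. restrict (block_map b e) (cell_index n m)) = block_law n m b"
proof -
  let ?S = "{..n} \<times> {..m * b}"
  let ?N = "PiM ?S (\<lambda>_. expo 1)"
  let ?C = "cell_index n m"
  \<comment> \<open>The weights read by component c. These sets are disjoint for different
    components, which gives the independence of gaps and block sums.\<close>
  define K where "K c = (case snd c of 0 \<Rightarrow> {(Suc (fst c), 0)}
     | Suc j \<Rightarrow> (\<lambda>k. (Suc (fst c), Suc (j * b + k))) ` {..<b})" for c :: "nat \<times> nat"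
  have E: "prob_space (expo 1)" by (rule prob_space_expo) simp
  interpret P: prob_space ?N by (intro prob_space_PiM E)
  have ind: "P.indep_vars (\<lambda>_. expo 1) (\<lambda>c x. x c) ?S"
    by (rule indep_vars_PiM_components) (use E in auto)
  have KS: "K c \<subseteq> ?S" if "c \<in> ?C" for c
    using that block_index_less[of _ m _ b] by (auto simp: K_def cell_index_def split: nat.split)
  have disj: "disjoint_family_on K ?C"
  proof -
    have blk: "j = j'" if "j * b + k = j' * b + k'" "k < b" "k' < b" for j j' k k' :: nat
    proof -
      have "(j * b + k) div b = j" "(j' * b + k') div b = j'" using that(2,3) by auto
      then show ?thesis using that(1) by metis
    qed
    show ?thesis
      unfolding disjoint_family_on_def
    proof (intro ballI impI)
      fix c c' assume "c \<in> ?C" "c' \<in> ?C" and ne: "c \<noteq> c'"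
      show "K c \<inter> K c' = {}"
      proof (rule ccontr)
        assume "K c \<inter> K c' \<noteq> {}"
        then obtain x where "x \<in> K c" "x \<in> K c'" by blast
        then have "c = c'"
          by (cases c; cases c'; cases "snd c"; cases "snd c'") (auto simp: K_def dest: blk)
        with ne show False by simp
      qed
    qed
  qed
  have r: "P.indep_vars (\<lambda>c. PiM (K c) (\<lambda>_. expo 1)) (\<lambda>c x. restrict (\<lambda>i. x i) (K c)) ?C"
    by (rule P.indep_vars_restrict[OF ind KS disj])
  have "P.indep_vars (\<lambda>_. borel) (\<lambda>c x. block_map b (restrict (\<lambda>i. x i) (K c)) c) ?C"
  proof (rule P.indep_vars_compose2[OF r])
    fix c assume "c \<in> ?C"
    show "(\<lambda>x. block_map b x c) \<in> borel_measurable (PiM (K c) (\<lambda>_. expo 1))"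
    proof (cases "snd c")
      case 0
      then show ?thesis
        using measurable_component_singleton[of "(Suc (fst c), 0)" "K c" "\<lambda>_. expo 1"]
        by (simp add: block_map_def K_def)
    next
      case (Suc j)
      then show ?thesis
        using normalized_sum_measurable[of b "\<lambda>k. (Suc (fst c), Suc (j * b + k))" "K c"]
        by (simp add: block_map_def K_def)
    qed
  qed
  moreover have "block_map b (restrict (\<lambda>i. x i) (K c)) c = block_map b x c" for x c
    by (auto simp: block_map_def K_def split: nat.split intro!: sum.cong)
  ultimately have ind2: "P.indep_vars (\<lambda>_. borel) (\<lambda>c x. block_map b x c) ?C" by simp
  have rv: "(\<lambda>x. block_map b x c) \<in> borel_measurable ?N" if "c \<in> ?C" for c
    using ind2 that unfolding P.indep_vars_def by blast
  have ne: "?C \<noteq> {}" using n by (auto simp: cell_index_def)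
  have "distr ?N (PiM ?C (\<lambda>_. borel)) (\<lambda>x. \<lambda>c\<in>?C. block_map b x c) =
      PiM ?C (\<lambda>c. distr ?N borel (\<lambda>x. block_map b x c))"
    by (rule iffD1[OF P.indep_vars_iff_distr_eq_PiM'[OF ne rv] ind2])
  also have "\<dots> = block_law n m b"
    unfolding block_law_def
  proof (rule PiM_cong[OF refl])
    fix c assume c: "c \<in> ?C"
    show "distr ?N borel (\<lambda>x. block_map b x c) = (if snd c = 0 then expo 1 else normalized_sum_law b)"
    proof (cases "snd c")
      case 0
      have "(Suc (fst c), 0) \<in> ?S" using c by (auto simp: cell_index_def)
      then have "distr ?N (expo 1) (\<lambda>x. x (Suc (fst c), 0)) = expo 1"
        using E by (intro distr_PiM_component) auto
      moreover have "distr ?N (expo 1) (\<lambda>x. x (Suc (fst c), 0)) = distr ?N borel (\<lambda>x. x (Suc (fst c), 0))"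
        by (rule distr_cong) auto
      ultimately show ?thesis using 0 by (simp add: block_map_def)
    next
      case (Suc j)
      have "inj_on (\<lambda>k. (Suc (fst c), Suc (j * b + k))) {..<b}" by (auto simp: inj_on_def)
      moreover have "(Suc (fst c), Suc (j * b + k)) \<in> ?S" if "k < b" for k
        using c Suc that block_index_less[of j m k b] by (auto simp: cell_index_def)
      ultimately show ?thesis
        using Suc distr_normalized_sum[of "\<lambda>k. (Suc (fst c), Suc (j * b + k))" b ?S]
        by (simp add: block_map_def)
    qed
  qed
  finally show ?thesis by (simp add: noise_def)
qed

lemma measurable_block_map:
  "(\<lambda>e. restrict (block_map b e) (cell_index n m)) \<in> noise ({..n} \<times> {..m * b}) \<rightarrow>\<^sub>M PiM (cell_index n m) (\<lambda>_. borel)"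
  unfolding noise_def
proof (rule measurable_restrict)
  fix c assume c: "c \<in> cell_index n m"
  show "(\<lambda>e. block_map b e c) \<in> borel_measurable (PiM ({..n} \<times> {..m * b}) (\<lambda>_. expo 1))"
  proof (cases "snd c")
    case 0
    then show ?thesis
      using measurable_component_singleton[of "(Suc (fst c), 0)" "{..n} \<times> {..m * b}" "\<lambda>_. expo 1"] c
      by (auto simp: block_map_def cell_index_def)
  next
    case (Suc j)
    then show ?thesis
      using normalized_sum_measurable[of b "\<lambda>k. (Suc (fst c), Suc (j * b + k))" "{..n} \<times> {..m * b}"]
        c block_index_less[of j m _ b]
      by (auto simp: block_map_def cell_index_def)
  qed
qed

lemma gauss_law_Fatou:
  assumes n: "0 < n" and F: "F \<in> borel_measurable (PiM (cell_index n m) (\<lambda>_. borel))"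
    and lsc: "\<And>x y. (\<And>c. c \<in> cell_index n m \<Longrightarrow> (\<lambda>b. y b c) \<longlonglongrightarrow> x c) \<Longrightarrow>
      (F x :: ennreal) \<le> liminf (\<lambda>b. F (y b))"
  shows "(\<integral>\<^sup>+x. F x \<partial>gauss_law n m) \<le>
    liminf (\<lambda>b. \<integral>\<^sup>+e. F (restrict (block_map b e) (cell_index n m)) \<partial>noise ({..n} \<times> {..m * b}))"
proof -
  have "(\<integral>\<^sup>+x. F x \<partial>gauss_law n m) \<le> liminf (\<lambda>b. \<integral>\<^sup>+x. F x \<partial>block_law n m b)"
    unfolding gauss_law_def block_law_def
  proof (rule weak_conv_PiM_Fatou[OF _ _ _ _ F lsc])
    show "cell_index n m \<noteq> {}" using n by (auto simp: cell_index_def)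
    fix c :: "nat \<times> nat"
    show "real_distribution (if snd c = 0 then expo 1 else normalized_sum_law b)" for b
      by (simp add: real_distribution_expo real_distribution_normalized_sum_law)
    show "real_distribution (if snd c = 0 then expo 1 else std_normal_distribution)"
      using real_dist_normal_dist real_distribution_expo[of 1] by (cases "snd c = 0") (simp_all only: if_True if_False, simp)
    show "weak_conv_m (\<lambda>b. if snd c = 0 then expo 1 else normalized_sum_law b)
        (if snd c = 0 then expo 1 else std_normal_distribution)"
      using weak_conv_normalized_sum by (cases "snd c = 0") (simp_all add: weak_conv_m_def weak_conv_def)
  qed
  also have "\<dots> = liminf (\<lambda>b. \<integral>\<^sup>+e. F (restrict (block_map b e) (cell_index n m)) \<partial>noise ({..n} \<times> {..m * b}))"
  proof (rule Liminf_eq)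
    have "(\<integral>\<^sup>+x. F x \<partial>block_law n m b) =
      (\<integral>\<^sup>+e. F (restrict (block_map b e) (cell_index n m)) \<partial>noise ({..n} \<times> {..m * b}))" if "0 < b" for b
      unfolding distr_block_map[OF that n, of m, symmetric]
    proof (rule nn_integral_distr)
      show "(\<lambda>e. restrict (block_map b e) (cell_index n m)) \<in> noise ({..n} \<times> {..m * b}) \<rightarrow>\<^sub>M PiM (cell_index n m) (\<lambda>_. borel)"
        by (rule measurable_block_map)
    qed (use F in simp)
    then show "\<forall>\<^sub>F b in sequentially. (\<integral>\<^sup>+x. F x \<partial>block_law n m b) =
      (\<integral>\<^sup>+e. F (restrict (block_map b e) (cell_index n m)) \<partial>noise ({..n} \<times> {..m * b}))"
      by (auto simp: eventually_sequentially intro!: exI[of _ 1])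
  qed
  finally show ?thesis .
qed

text \<open>Generating function at la - \<nu> of the Brownian passage time up to T, over a level 0
  with drift \<nu> and n further levels without drift, whose starting points are separated by
  exponential gaps of rate la.\<close>

definition mgf_lim :: "real \<Rightarrow> nat \<Rightarrow> real \<Rightarrow> real \<Rightarrow> real" where
  "mgf_lim T n \<nu> la = exp (T * (la\<^sup>2 - \<nu>\<^sup>2) / 2) * (la / \<nu>) ^ n"

text \<open>The exact value for N columns: \<open>nn_integral_exp_lpp\<close> with q = la \<kappa>
  and s = (la - \<nu>) \<kappa>, where the first factor is the centring by N. In q / (q - s) the
  scale \<kappa> cancels, so the last factor is already that of the limit.\<close>

definition mgf_lpp :: "real \<Rightarrow> nat \<Rightarrow> real \<Rightarrow> real \<Rightarrow> nat \<Rightarrow> real" where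
  "mgf_lpp T n \<nu> la N = (let \<kappa> = sqrt (T / real N) in
     exp (- ((la - \<nu>) * \<kappa> * real N)) * ((1 - \<nu> * \<kappa>) / (1 - la * \<kappa>)) ^ N * (la / \<nu>) ^ n)"

text \<open>With x = \<kappa> and N = T / x^2, the logarithm without its last term is T / x^2 times
  ln (1 - \<nu> x) - ln (1 - la x) - (la - \<nu>) x. The linear terms cancel against the centring
  and the quadratic ones give (la^2 - \<nu>^2) / 2.\<close>

lemma tendsto_mgf_lpp:
  assumes "0 < T"
  shows "mgf_lpp T n \<nu> la \<longlonglongrightarrow> mgf_lim T n \<nu> la"
proof -
  define c where "c = sqrt T"
  have c: "0 < c" "T = c\<^sup>2" using assms by (auto simp: c_def)
  define g where "g x = (c\<^sup>2 / x\<^sup>2) * (ln (1 - \<nu> * x) - ln (1 - la * x) - (la - \<nu>) * x)" for x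
  have "(g \<longlongrightarrow> c\<^sup>2 * (la * la / 2 - \<nu> * \<nu> / 2)) (at_right 0)"
    unfolding g_def by real_asymp
  moreover have "c\<^sup>2 * (la * la / 2 - \<nu> * \<nu> / 2) = c\<^sup>2 * (la\<^sup>2 - \<nu>\<^sup>2) / 2"
    by (simp add: power2_eq_square algebra_simps)
  ultimately have g: "(g \<longlongrightarrow> c\<^sup>2 * (la\<^sup>2 - \<nu>\<^sup>2) / 2) (at_right 0)"
    by simp
  have k: "filterlim (\<lambda>N. c / sqrt (real N)) (at_right 0) sequentially"
    using c(1) by real_asymp
  have "(\<lambda>N. exp (g (c / sqrt (real N))) * (la / \<nu>) ^ n) \<longlonglongrightarrow> mgf_lim T n \<nu> la"
    unfolding mgf_lim_def c(2) by (intro tendsto_mult tendsto_exp filterlim_compose[OF g k] tendsto_const)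
  moreover have "\<forall>\<^sub>F N in sequentially. exp (g (c / sqrt (real N))) * (la / \<nu>) ^ n = mgf_lpp T n \<nu> la N"
  proof -
    have "\<forall>\<^sub>F N in sequentially. \<nu> * (c / sqrt (real N)) < 1"
      "\<forall>\<^sub>F N in sequentially. la * (c / sqrt (real N)) < 1"
      by real_asymp+
    with eventually_gt_at_top[of 0] show ?thesis
    proof eventually_elim
      case (elim N)
      define x where "x = c / sqrt (real N)"
      have x: "sqrt (T / real N) = x" "0 < x" "real N = c\<^sup>2 / x\<^sup>2" "\<nu> * x < 1" "la * x < 1"
        using elim c by (auto simp: x_def real_sqrt_divide power_divide)
      have "exp (real N * (ln (1 - \<nu> * x) - ln (1 - la * x))) = exp (ln (1 - \<nu> * x) - ln (1 - la * x)) ^ N"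
        by (rule exp_of_nat_mult)
      also have "exp (ln (1 - \<nu> * x) - ln (1 - la * x)) = (1 - \<nu> * x) / (1 - la * x)"
        using x(4,5) by (simp add: exp_diff)
      finally have e: "((1 - \<nu> * x) / (1 - la * x)) ^ N = exp (real N * (ln (1 - \<nu> * x) - ln (1 - la * x)))" ..
      have "g x = - ((la - \<nu>) * x * real N) + real N * (ln (1 - \<nu> * x) - ln (1 - la * x))"
        unfolding g_def x(3)[symmetric] by (simp add: algebra_simps)
      then show ?case
        unfolding x_def[symmetric] mgf_lpp_def Let_def x(1) e by (simp only: exp_add)
    qed
  qed
  ultimately show ?thesis by (rule Lim_transform_eventually)
qed

lemma nn_integral_mgf_lpp:
  assumes "0 < T" "0 < N" "0 < \<nu>" "\<nu> \<le> la" "la * sqrt (T / real N) < 1"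
  defines "\<kappa> \<equiv> sqrt (T / real N)"
  shows "(\<integral>\<^sup>+e. ennreal (exp ((la - \<nu>) * (\<kappa> * (lpp (bweight (1 / (1 - \<nu> * \<kappa>)) (1 / (la * \<kappa>)) e) n N - real N))))
     \<partial>noise ({..n} \<times> {..N})) = ennreal (mgf_lpp T n \<nu> la N)"
proof -
  have k: "0 < \<kappa>" using assms by (simp add: \<kappa>_def)
  have nk: "\<nu> * \<kappa> < 1" using assms k by (smt (verit) mult_right_mono)
  \<comment> \<open>Under this choice p + s = 1 - \<nu> \<kappa> and q - s = \<nu> \<kappa>, both
    positive.\<close>
  interpret stationary_lpp "1 - la * \<kappa>" "la * \<kappa>" "(la - \<nu>) * \<kappa>" n
    using assms k by unfold_locales (auto simp: algebra_simps)
  have p: "1 - la * \<kappa> + (la - \<nu>) * \<kappa> = 1 - \<nu> * \<kappa>" and q: "la * \<kappa> - (la - \<nu>) * \<kappa> = \<nu> * \<kappa>"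
    by (auto simp: algebra_simps)
  let ?G = "\<lambda>e. lpp (bweight (1 / (1 - \<nu> * \<kappa>)) (1 / (la * \<kappa>)) e) n N"
  have "(\<integral>\<^sup>+e. ennreal (exp ((la - \<nu>) * (\<kappa> * (?G e - real N)))) \<partial>noise ({..n} \<times> {..N})) =
      (\<integral>\<^sup>+e. ennreal (exp (- ((la - \<nu>) * \<kappa> * real N))) * ennreal (exp ((la - \<nu>) * \<kappa> * ?G e)) \<partial>noise ({..n} \<times> {..N}))"
    by (simp add: ennreal_mult[symmetric] exp_add[symmetric] algebra_simps)
  also have "\<dots> = ennreal (exp (- ((la - \<nu>) * \<kappa> * real N))) *
      (\<integral>\<^sup>+e. ennreal (exp ((la - \<nu>) * \<kappa> * ?G e)) \<partial>noise ({..n} \<times> {..N}))"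
  proof (rule nn_integral_cmult)
    have "?G \<in> borel_measurable (noise ({..n} \<times> {..N}))" by (rule measurable_lpp) simp
    then show "(\<lambda>e. ennreal (exp ((la - \<nu>) * \<kappa> * ?G e))) \<in> borel_measurable (noise ({..n} \<times> {..N}))"
      by measurable
  qed
  also have "(\<integral>\<^sup>+e. ennreal (exp ((la - \<nu>) * \<kappa> * ?G e)) \<partial>noise ({..n} \<times> {..N})) =
      ennreal (((1 - \<nu> * \<kappa>) / (1 - la * \<kappa>)) ^ N * ((la * \<kappa>) / (\<nu> * \<kappa>)) ^ n)"
    using nn_integral_exp_lpp[of N] unfolding p q .
  also have "ennreal (exp (- ((la - \<nu>) * \<kappa> * real N))) * \<dots> = ennreal (mgf_lpp T n \<nu> la N)"
  proof -
    have "la * \<kappa> / (\<nu> * \<kappa>) = la / \<nu>" using k by simp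
    moreover have "0 \<le> (1 - \<nu> * \<kappa>) / (1 - la * \<kappa>)" "0 \<le> la / \<nu>"
      using nk assms(3,4,5) unfolding \<kappa>_def by auto
    ultimately show ?thesis
      unfolding mgf_lpp_def Let_def \<kappa>_def[symmetric] by (simp add: ennreal_mult mult.assoc)
  qed
  finally show ?thesis .
qed

section \<open>Discrete passage times as functions of finitely many coordinates\<close>

lemma tendsto_rpass:
  assumes "\<And>i'. i' \<le> i \<Longrightarrow> (\<lambda>b. z b i') \<longlonglongrightarrow> z' i'"
    "\<And>i' l'. i' \<le> i \<Longrightarrow> l' < l \<Longrightarrow> (\<lambda>b. X b i' l') \<longlonglongrightarrow> X' i' l'"
  shows "(\<lambda>b. rpass A (z b) (X b) i l) \<longlonglongrightarrow> rpass A z' X' i l"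
  using assms
proof (induction i arbitrary: l)
  case 0
  from 0(2) show ?case
  proof (induction l)
    case 0
    then show ?case using \<open>\<And>i'. i' \<le> 0 \<Longrightarrow> (\<lambda>b. z b i') \<longlonglongrightarrow> z' i'\<close> by simp
  next
    case (Suc l)
    then show ?case by (auto intro!: tendsto_add)
  qed
next
  case (Suc i)
  note IH = Suc.IH and z = Suc.prems(1)
  from Suc.prems(2) show ?case
  proof (induction l)
    case 0
    have "(\<lambda>b. rpass A (z b) (X b) i 0) \<longlonglongrightarrow> rpass A z' X' i 0"
      by (rule IH) (use z 0 in auto)
    then show ?case using z by (auto intro!: tendsto_max)
  next
    case (Suc l)
    have "(\<lambda>b. rpass A (z b) (X b) i (Suc l)) \<longlonglongrightarrow> rpass A z' X' i (Suc l)"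
      by (rule IH) (use z Suc(2) in auto)
    moreover have "(\<lambda>b. rpass A (z b) (X b) (Suc i) l) \<longlonglongrightarrow> rpass A z' X' (Suc i) l"
      using Suc by auto
    moreover have "(\<lambda>b. X b (Suc i) l) \<longlonglongrightarrow> X' (Suc i) l" using Suc(2) by auto
    ultimately show ?case by (auto intro!: tendsto_max tendsto_add)
  qed
qed

lemma measurable_rpass:
  assumes "\<And>i'. i' \<le> i \<Longrightarrow> (\<lambda>x. z x i') \<in> borel_measurable M"
    "\<And>i' l'. i' \<le> i \<Longrightarrow> l' < l \<Longrightarrow> (\<lambda>x. X x i' l') \<in> borel_measurable M"
  shows "(\<lambda>x. rpass A (z x) (X x) i l :: real) \<in> borel_measurable M"
  using assms
proof (induction i arbitrary: l)
  case 0
  from 0(2) show ?case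
  proof (induction l)
    case 0
    then show ?case using \<open>\<And>i'. i' \<le> 0 \<Longrightarrow> (\<lambda>x. z x i') \<in> borel_measurable M\<close> by simp
  next
    case (Suc l)
    then show ?case by (auto intro!: borel_measurable_add)
  qed
next
  case (Suc i)
  note IH = Suc.IH and z = Suc.prems(1)
  from Suc.prems(2) show ?case
  proof (induction l)
    case 0
    have "(\<lambda>x. rpass A (z x) (X x) i 0) \<in> borel_measurable M"
      by (rule IH) (use z 0 in auto)
    then show ?case using z by (auto intro!: borel_measurable_max)
  next
    case (Suc l)
    have "(\<lambda>x. rpass A (z x) (X x) i (Suc l)) \<in> borel_measurable M"
      by (rule IH) (use z Suc(2) in auto)
    moreover have "(\<lambda>x. rpass A (z x) (X x) (Suc i) l) \<in> borel_measurable M"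
      using Suc by auto
    moreover have "(\<lambda>x. X x (Suc i) l) \<in> borel_measurable M" using Suc(2) by auto
    ultimately show ?case by (auto intro!: borel_measurable_max borel_measurable_add)
  qed
qed

text \<open>The gap \<open>x (0, 0)\<close> is included: the lowest level counted here is level 1 of
  the particle system, one gap above the origin.\<close>

definition start :: "(nat \<times> nat \<Rightarrow> real) \<Rightarrow> nat \<Rightarrow> real" where
  "start x i = (\<Sum>k<Suc i. x (k, 0))"

definition incr :: "real \<Rightarrow> nat \<Rightarrow> (nat \<times> nat \<Rightarrow> real) \<Rightarrow> nat \<Rightarrow> nat \<Rightarrow> real" where
  "incr T m x i j = sqrt (T / real m) * x (i, Suc j)"

lemma measurable_cell: "c \<in> I \<Longrightarrow> (\<lambda>x. x c) \<in> borel_measurable (PiM I (\<lambda>_. borel))"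
  by (rule measurable_component_singleton)

lemma measurable_pass_incr:
  "(\<lambda>x. pass (\<lambda>_. 0) (incr T m x) n m) \<in> borel_measurable (PiM (cell_index (Suc n) m) (\<lambda>_. borel))"
  unfolding incr_def
  by (intro measurable_rpass borel_measurable_times borel_measurable_const measurable_cell)
     (auto simp: cell_index_def)

lemma measurable_pass_start:
  "(\<lambda>x. pass (start x) (incr T m x) n m) \<in> borel_measurable (PiM (cell_index (Suc n) m) (\<lambda>_. borel))"
  unfolding incr_def start_def
  by (intro measurable_rpass borel_measurable_times borel_measurable_const borel_measurable_sum measurable_cell)
     (auto simp: cell_index_def)

text \<open>Scaling a normalised block sum by sqrt (T / m) amounts to scaling each weight by sqrt (T
  / (m b)). This common factor comes out, and \<open>rpass_block\<close> turns the coarse grid into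
  level changes at multiples of b.\<close>

lemma pass_block_map:
  assumes "0 < T" "0 < m" "0 < b"
    and z: "\<And>i. i \<le> n \<Longrightarrow> z' i = sqrt (T / real (m * b)) * z i"
  shows "pass z' (incr T m (restrict (block_map b e) (cell_index (Suc n) m))) n m =
    sqrt (T / real (m * b)) * rpass (\<lambda>l. b dvd l) z (\<lambda>i l. e (Suc i, Suc l) - 1) n (m * b)"
proof -
  let ?\<kappa> = "sqrt (T / real (m * b))"
  have shift: "(\<Sum>l=j*b..<j*b+c. f l) = (\<Sum>k<c. f (j * b + k))" for j c and f :: "nat \<Rightarrow> real"
    by (induction c) auto
  have "incr T m (restrict (block_map b e) (cell_index (Suc n) m)) i j =
      ?\<kappa> * (\<Sum>l=j*b..<j*b+b. e (Suc i, Suc l) - 1)" if "i \<le> n" "j < m" for i j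
    using that assms unfolding shift
    by (simp add: incr_def block_map_def cell_index_def real_sqrt_divide real_sqrt_mult)
  then have "pass z' (incr T m (restrict (block_map b e) (cell_index (Suc n) m))) n m =
      pass (\<lambda>i. ?\<kappa> * z i) (\<lambda>i j. ?\<kappa> * (\<Sum>l=j*b..<j*b+b. e (Suc i, Suc l) - 1)) n m"
    by (intro rpass_cong) (auto simp: z)
  also have "\<dots> = ?\<kappa> * pass z (\<lambda>i j. \<Sum>l=j*b..<j*b+b. e (Suc i, Suc l) - 1) n m"
    using assms(1) by (intro rpass_scale) auto
  also have "\<dots> = ?\<kappa> * rpass (\<lambda>l. b dvd l) z (\<lambda>i l. e (Suc i, Suc l) - 1) n (m * b)"
    using rpass_block[OF \<open>0 < b\<close>, of z "\<lambda>i l. e (Suc i, Suc l) - 1" n m] by simp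
  finally show ?thesis .
qed

lemma eventually_small_rate:
  assumes "0 < T" "0 < m"
  shows "\<forall>\<^sub>F b in sequentially. c * sqrt (T / real (m * b)) < 1"
proof -
  have "(\<lambda>b. c * sqrt (T / real (m * b))) \<longlonglongrightarrow> 0"
  proof -
    have "0 < T / real m" using assms by simp
    then have "(\<lambda>b. c * sqrt ((T / real m) / real b)) \<longlonglongrightarrow> 0" by real_asymp
    then show ?thesis by simp
  qed
  then show ?thesis by (rule order_tendstoD) simp
qed

lemma tendsto_mgf_lpp_blocks:
  assumes "0 < T" "0 < m"
  shows "(\<lambda>b. mgf_lpp T n \<nu> la (m * b)) \<longlonglongrightarrow> mgf_lim T n \<nu> la"
proof -
  have "filterlim (\<lambda>b. m * b) at_top sequentially"
    by (rule filterlim_subseq) (use assms in \<open>auto simp: strict_mono_def\<close>)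
  from filterlim_compose[OF tendsto_mgf_lpp[OF assms(1)] this] show ?thesis .
qed

text \<open>Boundary weights are nonnegative, so the passage time started from zero lies below the
  boundary model for every pair (\<nu>, la); this freedom is used later to treat starting levels
  above and below 0 differently. The integrand is continuous and nonnegative, so Fatou carries the
  bound to the limit. The exponent is \<open>Suc n\<close> because levels 0 to n are the rows 1 to n
  + 1.\<close>

theorem gauss_mgf_bound:
  assumes T: "0 < T" and m: "0 < m" and nu: "0 < \<nu>" "\<nu> \<le> la"
  shows "(\<integral>\<^sup>+x. ennreal (exp ((la - \<nu>) * pass (\<lambda>_. 0) (incr T m x) n m)) \<partial>gauss_law (Suc n) m)
    \<le> ennreal (mgf_lim T (Suc n) \<nu> la)"
proof -
  let ?F = "\<lambda>x. ennreal (exp ((la - \<nu>) * pass (\<lambda>_. 0) (incr T m x) n m))"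
  let ?C = "cell_index (Suc n) m"
  have "(\<integral>\<^sup>+x. ?F x \<partial>gauss_law (Suc n) m) \<le>
      liminf (\<lambda>b. \<integral>\<^sup>+e. ?F (restrict (block_map b e) ?C) \<partial>noise ({..Suc n} \<times> {..m * b}))"
  proof (rule gauss_law_Fatou)
    show "?F \<in> borel_measurable (PiM ?C (\<lambda>_. borel))"
      using measurable_pass_incr[of T m n] by measurable
    fix x and y :: "nat \<Rightarrow> nat \<times> nat \<Rightarrow> real" assume y: "\<And>c. c \<in> ?C \<Longrightarrow> (\<lambda>b. y b c) \<longlonglongrightarrow> x c"
    have "(\<lambda>b. pass (\<lambda>_. 0) (incr T m (y b)) n m) \<longlonglongrightarrow> pass (\<lambda>_. 0) (incr T m x) n m"
      unfolding incr_def by (intro tendsto_rpass tendsto_const tendsto_mult y) (auto simp: cell_index_def)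
    then have "(\<lambda>b. ?F (y b)) \<longlonglongrightarrow> ?F x"
      by (intro tendsto_ennrealI tendsto_exp tendsto_mult tendsto_const)
    then have "liminf (\<lambda>b. ?F (y b)) = ?F x"
      by (rule lim_imp_Liminf[OF sequentially_bot])
    then show "?F x \<le> liminf (\<lambda>b. ?F (y b))"
      by (rule eq_refl[OF sym])
  qed simp
  also have "\<dots> \<le> liminf (\<lambda>b. ennreal (mgf_lpp T (Suc n) \<nu> la (m * b)))"
  proof (rule Liminf_mono)
    show "\<forall>\<^sub>F b in sequentially. (\<integral>\<^sup>+e. ?F (restrict (block_map b e) ?C) \<partial>noise ({..Suc n} \<times> {..m * b}))
        \<le> ennreal (mgf_lpp T (Suc n) \<nu> la (m * b))"
      using eventually_small_rate[OF T m, of la] eventually_gt_at_top[of 0]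
    proof eventually_elim
      case (elim b)
      define \<kappa> where "\<kappa> = sqrt (T / real (m * b))"
      have \<kappa>: "0 < \<kappa>" "la * \<kappa> < 1" using elim T m by (auto simp: \<kappa>_def)
      have "\<nu> * \<kappa> < 1" using mult_right_mono[OF nu(2), of \<kappa>] \<kappa> by linarith
      let ?G = "\<lambda>e. lpp (bweight (1 / (1 - \<nu> * \<kappa>)) (1 / (la * \<kappa>)) e) (Suc n) (m * b)"
      have "(\<integral>\<^sup>+e. ?F (restrict (block_map b e) ?C) \<partial>noise ({..Suc n} \<times> {..m * b})) \<le>
          (\<integral>\<^sup>+e. ennreal (exp ((la - \<nu>) * (\<kappa> * (?G e - real (m * b))))) \<partial>noise ({..Suc n} \<times> {..m * b}))"
      proof (rule nn_integral_mono_AE)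
        show "AE e in noise ({..Suc n} \<times> {..m * b}). ?F (restrict (block_map b e) ?C) \<le>
            ennreal (exp ((la - \<nu>) * (\<kappa> * (?G e - real (m * b)))))"
          using AE_noise_nonneg[of "{..Suc n} \<times> {..m * b}"]
        proof (rule AE_mp, goal_cases)
          case 2
          show ?case
          proof (rule AE_I2, rule impI)
            fix e :: "nat \<times> nat \<Rightarrow> real" assume e: "\<forall>c\<in>{..Suc n} \<times> {..m * b}. 0 \<le> e c"
            have "pass (\<lambda>_. 0) (incr T m (restrict (block_map b e) ?C)) n m =
                \<kappa> * rpass (\<lambda>l. b dvd l) (\<lambda>_. 0) (\<lambda>i l. e (Suc i, Suc l) - 1) n (m * b)"
              unfolding \<kappa>_def by (rule pass_block_map) (use elim T m in auto)
            also have "\<dots> \<le> \<kappa> * (?G e - real (m * b))"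
            proof (rule mult_left_mono)
              have "real (m * b) + rpass (\<lambda>l. b dvd l) (\<lambda>_. 0) (\<lambda>i l. e (Suc i, Suc l) - 1) n (m * b) \<le> ?G e"
                by (rule lpp_ge_rpass) (use e \<kappa> nu \<open>\<nu> * \<kappa> < 1\<close> in auto)
              then show "rpass (\<lambda>l. b dvd l) (\<lambda>_. 0) (\<lambda>i l. e (Suc i, Suc l) - 1) n (m * b) \<le> ?G e - real (m * b)"
                by linarith
            qed (use \<kappa> in simp)
            finally show "?F (restrict (block_map b e) ?C) \<le> ennreal (exp ((la - \<nu>) * (\<kappa> * (?G e - real (m * b)))))"
              using nu by (intro ennreal_leI) (simp add: mult_left_mono)
          qed
        qed simp
      qed
      also have "\<dots> = ennreal (mgf_lpp T (Suc n) \<nu> la (m * b))"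
        unfolding \<kappa>_def by (rule nn_integral_mgf_lpp) (use elim T m nu in auto)
      finally show ?case .
    qed
  qed
  also have "\<dots> = ennreal (mgf_lim T (Suc n) \<nu> la)"
    using tendsto_mgf_lpp_blocks[OF T m] by (intro lim_imp_Liminf tendsto_ennrealI) auto
  finally show ?thesis .
qed

text \<open>Failure of a modulus of continuity for the scaled walks over one time step. Outside this
  event, moving a change of level to a block boundary costs little.\<close>

definition bad :: "real \<Rightarrow> nat \<Rightarrow> nat \<Rightarrow> nat \<Rightarrow> real \<Rightarrow> (nat \<times> nat \<Rightarrow> real) \<Rightarrow> bool" where
  "bad \<kappa> n m b \<epsilon> e \<longleftrightarrow> (\<exists>i<n. \<exists>j<m. \<exists>d\<le>b. \<epsilon> \<le> \<bar>\<kappa> * (\<Sum>k<d. e (Suc i, Suc (j * b + k)) - 1)\<bar>)"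

text \<open>The exact value is exp (- v - ln (1 - v)). For v = u the bound follows from - ln (1 - u)
  \<le> u + 2 u^2, available up to u = 1/2, and for v = - u from ln (1 + u) \<ge> u - u^2.\<close>

lemma expo_centered_mgf:
  assumes "0 \<le> u" "u \<le> 1/2"
  shows "(\<integral>\<^sup>+y. ennreal (exp (u * (y - 1))) \<partial>expo 1) \<le> ennreal (exp (2 * u\<^sup>2))"
    "(\<integral>\<^sup>+y. ennreal (exp (u * (1 - y))) \<partial>expo 1) \<le> ennreal (exp (2 * u\<^sup>2))"
proof -
  have *: "(\<integral>\<^sup>+y. ennreal (exp (v * (y - 1))) \<partial>expo 1) = ennreal (exp (- v - ln (1 - v)))" if "v < 1" for v
  proof -
    have "(\<integral>\<^sup>+y. ennreal (exp (v * (y - 1))) \<partial>expo 1) = (\<integral>\<^sup>+y. ennreal (exp (- v)) * ennreal (exp (v * y)) \<partial>expo 1)"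
      by (simp add: ennreal_mult[symmetric] exp_add[symmetric] algebra_simps)
    also have "\<dots> = ennreal (exp (- v)) * (\<integral>\<^sup>+y. ennreal (exp (v * y)) \<partial>expo 1)"
      by (rule nn_integral_cmult) simp
    also have "\<dots> = ennreal (exp (- v)) * ennreal (1 / (1 - v))"
      using that by (subst nn_integral_expo_exp) auto
    also have "\<dots> = ennreal (exp (- v - ln (1 - v)))"
      using that by (simp add: exp_diff ennreal_mult[symmetric])
    finally show ?thesis .
  qed
  show "(\<integral>\<^sup>+y. ennreal (exp (u * (y - 1))) \<partial>expo 1) \<le> ennreal (exp (2 * u\<^sup>2))"
    using assms ln_one_minus_pos_lower_bound[of u] by (subst *) (auto intro!: ennreal_leI)
  have "(\<integral>\<^sup>+y. ennreal (exp (u * (1 - y))) \<partial>expo 1) = (\<integral>\<^sup>+y. ennreal (exp ((- u) * (y - 1))) \<partial>expo 1)"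
    by (simp add: algebra_simps)
  also have "\<dots> = ennreal (exp (u - ln (1 + u)))"
    using assms by (subst *) auto
  also have "\<dots> \<le> ennreal (exp (2 * u\<^sup>2))"
    using assms ln_one_plus_pos_lower_bound[of u] by (intro ennreal_leI) (simp, smt (verit) zero_le_power2)
  finally show "(\<integral>\<^sup>+y. ennreal (exp (u * (1 - y))) \<partial>expo 1) \<le> ennreal (exp (2 * u\<^sup>2))" .
qed

lemma emeasure_noise_maximal:
  assumes c: "inj_on c {..<b}" "\<And>k. k < b \<Longrightarrow> c k \<in> S"
    and g: "g \<in> borel_measurable borel" and K: "0 \<le> K" "1 \<le> \<rho>"
    and mgf: "(\<integral>\<^sup>+y. ennreal (exp (K * g y)) \<partial>expo 1) \<le> ennreal \<rho>"
  shows "emeasure (noise S) {e \<in> space (noise S). \<exists>d\<le>b. a \<le> (\<Sum>k<d. g (e (c k)))} \<le> ennreal (exp (- K * a) * \<rho> ^ b)"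
proof -
  let ?P = "PiM {..<b} (\<lambda>_. expo 1)"
  let ?t = "\<lambda>e. \<lambda>k\<in>{..<b}. e (c k)"
  have E: "prob_space (expo 1)" by (rule prob_space_expo) simp
  have t: "?t \<in> noise S \<rightarrow>\<^sub>M ?P"
    unfolding noise_def using c(2) by (intro measurable_restrict measurable_component_singleton) auto
  have d: "distr (noise S) ?P ?t = ?P"
    unfolding noise_def by (rule distr_PiM_reindex) (use c E in auto)
  have g': "g \<in> borel_measurable (expo 1)" using g by simp
  have meas: "{x \<in> space ?P. \<exists>d\<in>{..b}. a \<le> (\<Sum>k<d. g (x k))} \<in> sets ?P"
  proof (rule sets.sets_Collect_finite_Ex)
    fix d assume "d \<in> {..b}"
    then have "(\<lambda>x. \<Sum>k<d. g (x k)) \<in> borel_measurable ?P"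
      by (intro borel_measurable_sum measurable_component_compose g') auto
    then show "{x \<in> space ?P. a \<le> (\<Sum>k<d. g (x k))} \<in> sets ?P" by measurable
  qed simp
  have "emeasure ?P {x \<in> space ?P. \<exists>d\<in>{..b}. a \<le> (\<Sum>k<d. g (x k))} =
      emeasure (distr (noise S) ?P ?t) {x \<in> space ?P. \<exists>d\<in>{..b}. a \<le> (\<Sum>k<d. g (x k))}"
    by (simp only: d)
  also have "\<dots> = emeasure (noise S) (?t -` {x \<in> space ?P. \<exists>d\<in>{..b}. a \<le> (\<Sum>k<d. g (x k))} \<inter> space (noise S))"
    by (rule emeasure_distr[OF t meas])
  also have "?t -` {x \<in> space ?P. \<exists>d\<in>{..b}. a \<le> (\<Sum>k<d. g (x k))} \<inter> space (noise S) =
      {e \<in> space (noise S). \<exists>d\<le>b. a \<le> (\<Sum>k<d. g (e (c k)))}"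
    using measurable_space[OF t] by (auto simp: Bex_def cong: conj_cong)
  finally show ?thesis
    using maximal_inequality[OF E _ g K mgf, of b a] by (simp add: Bex_def)
qed

lemma measurable_noise_sum:
  assumes "i < n" "j < m" "d \<le> b"
  shows "(\<lambda>e. \<Sum>k<d. e (Suc i, Suc (j * b + k)) - 1) \<in> borel_measurable (noise ({..n} \<times> {..m * b}))"
proof -
  have "(\<lambda>e. e (Suc i, Suc (j * b + k))) \<in> borel_measurable (noise ({..n} \<times> {..m * b}))" if "k < d" for k
    using that assms block_index_less[of j m k b] by (intro measurable_noise_component) auto
  then show ?thesis
    by (intro borel_measurable_sum borel_measurable_diff borel_measurable_const) (simp only: lessThan_iff)
qed

lemma sets_bad: "{e \<in> space (noise ({..n} \<times> {..m * b})). bad \<kappa> n m b \<epsilon> e} \<in> sets (noise ({..n} \<times> {..m * b}))"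
proof -
  let ?N = "noise ({..n} \<times> {..m * b})"
  have "{e \<in> space ?N. \<exists>i\<in>{..<n}. \<exists>j\<in>{..<m}. \<exists>d\<in>{..b}. \<epsilon> \<le> \<bar>\<kappa> * (\<Sum>k<d. e (Suc i, Suc (j * b + k)) - 1)\<bar>} \<in> sets ?N"
  proof (intro sets.sets_Collect_finite_Ex)
    fix i j d assume "i \<in> {..<n}" "j \<in> {..<m}" "d \<in> {..b}"
    then have "(\<lambda>e. \<bar>\<kappa> * (\<Sum>k<d. e (Suc i, Suc (j * b + k)) - 1)\<bar>) \<in> borel_measurable ?N"
      by (intro borel_measurable_abs borel_measurable_times borel_measurable_const measurable_noise_sum) auto
    then show "{e \<in> space ?N. \<epsilon> \<le> \<bar>\<kappa> * (\<Sum>k<d. e (Suc i, Suc (j * b + k)) - 1)\<bar>} \<in> sets ?N"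
      by measurable
  qed auto
  moreover have "{e \<in> space ?N. \<exists>i\<in>{..<n}. \<exists>j\<in>{..<m}. \<exists>d\<in>{..b}. \<epsilon> \<le> \<bar>\<kappa> * (\<Sum>k<d. e (Suc i, Suc (j * b + k)) - 1)\<bar>}
     = {e \<in> space ?N. bad \<kappa> n m b \<epsilon> e}"
    by (auto simp: bad_def Bex_def)
  ultimately show ?thesis by simp
qed

text \<open>The Chernoff parameter sqrt m makes sqrt m * \<kappa> equal to sqrt (T / b), so that the
  b steps of a block together contribute exp (2 T) whatever b is. The estimate is thus uniform in b
  and tends to 0 as m grows. The factor 2 n m counts signs, levels and blocks.\<close>

lemma emeasure_bad:
  assumes T: "0 < T" and m: "0 < m" and b: "0 < b" "sqrt (T / real b) \<le> 1/2"
  defines "\<kappa> \<equiv> sqrt (T / real (m * b))"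
  shows "emeasure (noise ({..n} \<times> {..m * b})) {e \<in> space (noise ({..n} \<times> {..m * b})). bad \<kappa> n m b \<epsilon> e}
    \<le> ennreal (2 * real n * real m * exp (2 * T - sqrt (real m) * \<epsilon>))"
proof -
  let ?S = "{..n} \<times> {..m * b}"
  let ?N = "noise ?S"
  let ?K = "sqrt (real m)"
  have u: "?K * \<kappa> = sqrt (T / real b)"
    using m b by (simp add: \<kappa>_def real_sqrt_mult[symmetric])
  have u0: "0 \<le> sqrt (T / real b)" using T by simp
  have \<rho>: "1 \<le> exp (2 * (sqrt (T / real b))\<^sup>2)" by simp
  have \<rho>b: "exp (2 * (sqrt (T / real b))\<^sup>2) ^ b = exp (2 * T)"
    using T b by (simp add: exp_of_nat_mult[symmetric])
  define A where "A sg i j = {e \<in> space ?N. \<exists>d\<le>b. \<epsilon> \<le> (\<Sum>k<d. (sg * \<kappa>) * (e (Suc i, Suc (j * b + k)) - 1))}"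
    for sg :: real and i j
  have A: "emeasure ?N (A sg i j) \<le> ennreal (exp (2 * T - ?K * \<epsilon>))" if ij: "i < n" "j < m" and sg: "sg \<in> {1, -1}" for sg i j
  proof -
    have "emeasure ?N (A sg i j) \<le> ennreal (exp (- ?K * \<epsilon>) * exp (2 * (sqrt (T / real b))\<^sup>2) ^ b)"
      unfolding A_def
    proof (rule emeasure_noise_maximal)
      show "inj_on (\<lambda>k. (Suc i, Suc (j * b + k))) {..<b}" by (auto simp: inj_on_def)
      show "(Suc i, Suc (j * b + k)) \<in> ?S" if "k < b" for k
        using ij that block_index_less[of j m k b] by auto
      show "(\<integral>\<^sup>+y. ennreal (exp (?K * ((sg * \<kappa>) * (y - 1)))) \<partial>expo 1) \<le> ennreal (exp (2 * (sqrt (T / real b))\<^sup>2))"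
      proof -
        have eq: "?K * ((sg * \<kappa>) * (y - 1)) = (if sg = 1 then sqrt (T / real b) * (y - 1) else sqrt (T / real b) * (1 - y))" for y
          unfolding u[symmetric] using sg by (auto simp: algebra_simps)
        show ?thesis
          unfolding eq using expo_centered_mgf[OF u0 b(2)] by (cases "sg = 1") simp_all
      qed
    qed (use \<rho> in auto)
    also have "exp (- ?K * \<epsilon>) * exp (2 * (sqrt (T / real b))\<^sup>2) ^ b = exp (2 * T - ?K * \<epsilon>)"
      unfolding \<rho>b by (simp add: exp_add[symmetric])
    finally show ?thesis .
  qed
  have mA: "A sg i j \<in> sets ?N" if ij: "i < n" "j < m" for sg i j
  proof -
    have "{e \<in> space ?N. \<exists>d\<in>{..b}. \<epsilon> \<le> (sg * \<kappa>) * (\<Sum>k<d. (e (Suc i, Suc (j * b + k)) - 1))} \<in> sets ?N"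
    proof (intro sets.sets_Collect_finite_Ex)
      fix d assume "d \<in> {..b}"
      then have "(\<lambda>e. (sg * \<kappa>) * (\<Sum>k<d. e (Suc i, Suc (j * b + k)) - 1)) \<in> borel_measurable ?N"
        using ij by (intro borel_measurable_times borel_measurable_const measurable_noise_sum) auto
      then show "{e \<in> space ?N. \<epsilon> \<le> (sg * \<kappa>) * (\<Sum>k<d. e (Suc i, Suc (j * b + k)) - 1)} \<in> sets ?N"
        by measurable
    qed auto
    moreover have "{e \<in> space ?N. \<exists>d\<in>{..b}. \<epsilon> \<le> (sg * \<kappa>) * (\<Sum>k<d. (e (Suc i, Suc (j * b + k)) - 1))} = A sg i j"
      unfolding A_def sum_distrib_left Bex_def atMost_iff ..
    ultimately show ?thesis by (simp only:)
  qed
  let ?I = "{1, -1::real} \<times> {..<n} \<times> {..<m}"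
  have "{e \<in> space ?N. bad \<kappa> n m b \<epsilon> e} \<subseteq> (\<Union>(sg, i, j)\<in>?I. A sg i j)"
  proof
    fix e assume e: "e \<in> {e \<in> space ?N. bad \<kappa> n m b \<epsilon> e}"
    then obtain i j d where ijd: "i < n" "j < m" "d \<le> b" "\<epsilon> \<le> \<bar>\<kappa> * (\<Sum>k<d. e (Suc i, Suc (j * b + k)) - 1)\<bar>"
      by (auto simp: bad_def)
    define sg where "sg = (if 0 \<le> \<kappa> * (\<Sum>k<d. e (Suc i, Suc (j * b + k)) - 1) then 1 else -1 :: real)"
    have "\<epsilon> \<le> (\<Sum>k<d. (sg * \<kappa>) * (e (Suc i, Suc (j * b + k)) - 1))"
      unfolding sum_distrib_left[symmetric] using ijd(4) by (auto simp: sg_def split: if_splits)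
    then have "e \<in> A sg i j" using e ijd by (auto simp: A_def)
    moreover have "sg \<in> {1, -1}" by (simp add: sg_def)
    ultimately show "e \<in> (\<Union>(sg, i, j)\<in>?I. A sg i j)" using ijd by blast
  qed
  then have "emeasure ?N {e \<in> space ?N. bad \<kappa> n m b \<epsilon> e} \<le> emeasure ?N (\<Union>(sg, i, j)\<in>?I. A sg i j)"
    by (intro emeasure_mono sets.finite_UN) (auto intro!: mA)
  also have "\<dots> \<le> (\<Sum>x\<in>?I. emeasure ?N (case x of (sg, i, j) \<Rightarrow> A sg i j))"
    by (intro emeasure_subadditive_finite) (auto intro!: mA)
  also have "\<dots> \<le> (\<Sum>x\<in>?I. ennreal (exp (2 * T - ?K * \<epsilon>)))"
    by (intro sum_mono) (auto intro!: A)
  also have "\<dots> = ennreal (2 * real n * real m * exp (2 * T - sqrt (real m) * \<epsilon>))"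
  proof -
    have "card ?I = 2 * n * m" by (simp add: card_cartesian_product)
    then have "(\<Sum>x\<in>?I. ennreal (exp (2 * T - ?K * \<epsilon>))) = ennreal (real (2 * n * m)) * ennreal (exp (2 * T - ?K * \<epsilon>))"
      by (simp only: sum_constant ennreal_of_nat_eq_real_of_nat)
    then show ?thesis by (simp add: ennreal_mult[symmetric])
  qed
  finally show ?thesis .
qed

text \<open>Above y2 the exponent may be raised to \<theta> + \<eta> and below y1 it may be lowered
  to \<theta> - \<eta>, each against a constant that is exact at the edge of the window; inside, the
  value at y2 is an upper bound.\<close>

lemma exp_le_three_regions:
  assumes "0 \<le> \<theta>" "0 \<le> \<eta>" "y1 \<le> y2"
  shows "exp (\<theta> * v) \<le> exp (\<theta> * y2) * indicator {y1..} v + exp (- \<eta> * y2) * exp ((\<theta> + \<eta>) * v) +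
     exp (\<eta> * y1) * exp ((\<theta> - \<eta>) * (v::real))"
proof -
  consider "v < y1" | "y1 \<le> v" "v \<le> y2" | "y2 < v" by linarith
  then show ?thesis
  proof cases
    case 1
    have "\<theta> * v \<le> \<eta> * y1 + (\<theta> - \<eta>) * v"
      using mult_left_mono[of v y1 \<eta>] 1 assms by (simp add: algebra_simps)
    then have "exp (\<theta> * v) \<le> exp (\<eta> * y1) * exp ((\<theta> - \<eta>) * v)"
      unfolding exp_add[symmetric] by simp
    then show ?thesis by (simp add: add_increasing)
  next
    case 2
    have "exp (\<theta> * v) \<le> exp (\<theta> * y2)" using 2 assms by (simp add: mult_left_mono)
    then show ?thesis using 2 by (simp add: add_increasing2)
  next
    case 3
    have "\<theta> * v \<le> - \<eta> * y2 + (\<theta> + \<eta>) * v"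
      using mult_left_mono[of y2 v \<eta>] 3 assms by (simp add: algebra_simps)
    then have "exp (\<theta> * v) \<le> exp (- \<eta> * y2) * exp ((\<theta> + \<eta>) * v)"
      unfolding exp_add[symmetric] by simp
    then show ?thesis by (simp add: add_increasing add_increasing2)
  qed
qed

text \<open>The probability of the coarse event is bounded from below by comparing the moment generating
  function of the stationary model with those at two neighbouring parameters, as in the
  Gaertner--Ellis theorem, and by separating off the paths that leave through row \<open>0\<close>.\<close>

lemma noise_lower_bound:
  fixes \<theta> \<eta> y y1 y2 \<epsilon> T :: real and n m b :: nat
  assumes T: "0 < T" and m: "0 < m" and b: "0 < b"
    and th: "0 < \<eta>" "\<eta> < \<theta>" "\<theta> + \<eta> < 1" and y: "y1 \<le> y2" and \<epsilon>: "0 < \<epsilon>"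
  defines "\<kappa> \<equiv> sqrt (T / real (m * b))"
  defines "N \<equiv> noise ({..Suc n} \<times> {..m * b})"
  defines "C \<equiv> cell_index (Suc n) m"
  assumes k2: "(1 + \<theta>) * \<kappa> < 1" and gap: "real n * (4 * \<epsilon> + \<kappa>) \<le> y1 - y"
  shows "ennreal (mgf_lpp T (Suc n) (1 - \<theta>) 1 (m * b)) \<le>
     ennreal (mgf_lpp T (Suc n) 1 (1 + \<theta>) (m * b)) +
     ennreal (exp (\<theta> * y2)) *
       (emeasure N {e \<in> space N. y \<le> pass (start (restrict (block_map b e) C)) (incr T m (restrict (block_map b e) C)) n m} +
        emeasure N {e \<in> space N. bad \<kappa> (Suc n) m b \<epsilon> e}) +
     ennreal (exp (- \<eta> * y2)) * ennreal (mgf_lpp T (Suc n) (1 - (\<theta> + \<eta>)) 1 (m * b)) +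
     ennreal (exp (\<eta> * y1)) * ennreal (mgf_lpp T (Suc n) (1 - (\<theta> - \<eta>)) 1 (m * b))"
proof -
  let ?S = "{..Suc n} \<times> {..m * b}"
  let ?M = "real (m * b)"
  let ?P = "\<lambda>e. pass (start (restrict (block_map b e) C)) (incr T m (restrict (block_map b e) C)) n m"
  let ?A = "{e \<in> space N. y \<le> ?P e}"
  let ?B = "{e \<in> space N. bad \<kappa> (Suc n) m b \<epsilon> e}"
  have k: "0 < \<kappa>" using T m b by (simp add: \<kappa>_def)
  have k1: "\<kappa> < 1" using k2 k th by (smt (verit) mult_less_cancel_right1)
  have km: "v * \<kappa> < 1" if "v \<le> 1 + \<theta>" for v
    using mult_right_mono[OF that, of \<kappa>] k k2 by linarith
  define G where "G \<nu> la e = lpp (bweight (1 / (1 - \<nu> * \<kappa>)) (1 / (la * \<kappa>)) e) (Suc n) (m * b)" for \<nu> la e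
  \<comment> \<open>Passage with the weights of one boundary only. After scaling, column 0 in
    \<open>ver\<close> supplies gaps of rate 1, as in the particle system.\<close>
  define hor where "hor e = lpp (bweight (1 / (1 - (1 - \<theta>) * \<kappa>)) 0 e) (Suc n) (m * b)" for e
  define ver where "ver e = lpp (bweight 0 (1 / (1 * \<kappa>)) e) (Suc n) (m * b)" for e
  have mG[measurable]: "G \<nu> la \<in> borel_measurable N" for \<nu> la
    unfolding G_def N_def by (rule measurable_lpp) simp
  have mver[measurable]: "ver \<in> borel_measurable N"
    unfolding ver_def N_def by (rule measurable_lpp) simp
  have mB[measurable]: "?B \<in> sets N" unfolding N_def by (rule sets_bad)
  have mblock: "(\<lambda>e. restrict (block_map b e) C) \<in> N \<rightarrow>\<^sub>M PiM C (\<lambda>_. borel)"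
    unfolding N_def C_def by (rule measurable_block_map)
  have mA[measurable]: "?A \<in> sets N"
  proof -
    have [measurable]: "?P \<in> borel_measurable N"
      using measurable_compose[OF mblock measurable_pass_start[of T m n, folded C_def]] .
    show ?thesis by measurable
  qed
  have mgf: "(\<integral>\<^sup>+e. ennreal (exp ((la - \<nu>) * (\<kappa> * (G \<nu> la e - ?M)))) \<partial>N) = ennreal (mgf_lpp T (Suc n) \<nu> la (m * b))"
    if "0 < \<nu>" "\<nu> \<le> la" "la \<le> 1 + \<theta>" for \<nu> la
    unfolding \<kappa>_def G_def N_def
    by (rule nn_integral_mgf_lpp) (use that T m b km[of la] in \<open>auto simp: \<kappa>_def\<close>)
  define h1 where "h1 e = exp (\<theta> * (\<kappa> * (G 1 (1 + \<theta>) e - ?M)))" for e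
  define h2 where "h2 e = exp ((\<theta> + \<eta>) * (\<kappa> * (G (1 - (\<theta> + \<eta>)) 1 e - ?M)))" for e
  define h3 where "h3 e = exp ((\<theta> - \<eta>) * (\<kappa> * (G (1 - (\<theta> - \<eta>)) 1 e - ?M)))" for e
  have m1[measurable]: "h1 \<in> borel_measurable N" unfolding h1_def by measurable
  have m2[measurable]: "h2 \<in> borel_measurable N" unfolding h2_def by measurable
  have m3[measurable]: "h3 \<in> borel_measurable N" unfolding h3_def by measurable
  have pointwise: "exp (\<theta> * (\<kappa> * (G (1 - \<theta>) 1 e - ?M))) \<le>
     h1 e + exp (\<theta> * y2) * (indicator ?A e + indicator ?B e) + exp (- \<eta> * y2) * h2 e + exp (\<eta> * y1) * h3 e"
    if sp: "e \<in> space N" and e: "\<forall>c\<in>?S. 0 \<le> e c" for e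
  proof -
    have e': "0 \<le> e (i, l)" if "i \<le> Suc n" "l \<le> m * b" for i l using e that by auto
    have bm: "lpp (bweight a c e) (Suc n) (m * b) \<le> lpp (bweight a' c' e) (Suc n) (m * b)" if "a \<le> a'" "c \<le> c'" for a c a' c'
      by (rule lpp_mono) (use that e' in \<open>auto simp: bweight_def intro!: mult_right_mono\<close>)
    have full: "G (1 - \<theta>) 1 e \<le> max (hor e) (ver e)"
      unfolding G_def hor_def ver_def by (rule lpp_le_max_boundaries)
    \<comment> \<open>The pair (1, 1 + \<theta>) has the same difference \<theta> as (1 - \<theta>,
      1) but a smaller exponent, by \<open>cgf_right_less\<close>. Passing to it only raises the
      drift of row 0 and adds weights in column 0.\<close>
    have horG: "hor e \<le> G 1 (1 + \<theta>) e"
      unfolding hor_def G_def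
    proof (rule bm)
      show "1 / (1 - (1 - \<theta>) * \<kappa>) \<le> 1 / (1 - 1 * \<kappa>)"
      proof (rule frac_le)
        show "1 - 1 * \<kappa> \<le> 1 - (1 - \<theta>) * \<kappa>" using k th by (simp add: mult_le_cancel_right1)
      qed (use k1 in auto)
      show "0 \<le> 1 / ((1 + \<theta>) * \<kappa>)" using k th by simp
    qed
    \<comment> \<open>Adding a row 0 of any drift \<nu> \<le> 1 can only help, so the exponents
      \<theta> + \<eta> and \<theta> - \<eta> each get the boundary model in which they are
      computable.\<close>
    have verG: "ver e \<le> G \<nu> 1 e" if "\<nu> \<le> 1" for \<nu>
      unfolding ver_def G_def by (rule bm) (use km[of \<nu>] that th k in auto)
    let ?v = "\<kappa> * (ver e - ?M)"
    have v1: "exp (\<theta> * ?v) \<le> exp (\<theta> * y2) * indicator {y1..} ?v + exp (- \<eta> * y2) * exp ((\<theta> + \<eta>) * ?v) +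
         exp (\<eta> * y1) * exp ((\<theta> - \<eta>) * ?v)"
      by (rule exp_le_three_regions) (use th y in auto)
    have v2: "exp ((\<theta> + \<eta>) * ?v) \<le> h2 e" "exp ((\<theta> - \<eta>) * ?v) \<le> h3 e"
      unfolding h2_def h3_def exp_le_cancel_iff using th k verG[of "1 - (\<theta> + \<eta>)"] verG[of "1 - (\<theta> - \<eta>)"]
      by (intro mult_left_mono; simp)+
    have v3: "indicator {y1..} ?v \<le> (indicator ?A e + indicator ?B e :: real)"
    proof (cases "y1 \<le> ?v \<and> e \<notin> ?B")
      case True
      then have nb: "\<not> bad \<kappa> (Suc n) m b \<epsilon> e" using sp by simp
      have small: "\<bar>\<Sum>k<d. e (Suc i, Suc (j * b + k)) - 1\<bar> \<le> \<epsilon> / \<kappa>" if "i < Suc n" "j < m" "d \<le> b" for i j d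
      proof -
        have "\<not> \<epsilon> \<le> \<bar>\<kappa> * (\<Sum>k<d. e (Suc i, Suc (j * b + k)) - 1)\<bar>"
          using nb that unfolding bad_def by blast
        then show ?thesis using k by (simp add: abs_mult pos_le_divide_eq mult.commute)
      qed
      let ?r = "\<lambda>z. rpass (\<lambda>l. b dvd l) z (\<lambda>i l. e (Suc i, Suc l) - 1) n (m * b)"
      have shift: "(\<Sum>l=a..<a+c. f l) = (\<Sum>k<c. f (a + k))" for a c and f :: "nat \<Rightarrow> real"
        by (induction c) auto
      \<comment> \<open>In unscaled units a partial sum is at most \<epsilon> / \<kappa> and a
        weight at most 1 + 2 \<epsilon> / \<kappa>. Multiplied by \<kappa>, the total error becomes
        n (4 \<epsilon> + \<kappa>), the quantity in \<open>gap\<close>.\<close>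
      have "ver e \<le> ?M + ?r (\<lambda>i. 1 / (1 * \<kappa>) * (\<Sum>k<Suc i. e (Suc k, 0))) + real n * (2 * (\<epsilon> / \<kappa>) + (1 + 2 * (\<epsilon> / \<kappa>)))"
        unfolding ver_def
      proof (rule lpp_le_rpass[where N = "m * b"])
        show "0 \<le> e c" if "c \<in> {..Suc n} \<times> {..m * b}" for c using e that by blast
        fix i l d :: nat
        assume "Suc i \<le> Suc n" "b dvd l" "d < b" "l + d \<le> m * b"
        then obtain j where l: "l = j * b" by (auto elim!: dvdE simp: mult.commute)
        show "\<bar>\<Sum>k=l..<l+d. e (Suc i, Suc k) - 1\<bar> \<le> \<epsilon> / \<kappa>"
        proof (cases "d = 0")
          case False
          then have "j * b < m * b" using \<open>l + d \<le> m * b\<close> l by linarith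
          then have "j < m" by simp
          then show ?thesis
            unfolding l shift using small[of i j d] \<open>Suc i \<le> Suc n\<close> \<open>d < b\<close> by simp
        qed (use \<epsilon> k in simp)
      next
        fix i l assume il: "Suc i \<le> Suc n" "Suc l \<le> m * b"
        define j d where "j = l div b" and "d = l mod b"
        have ld: "l = j * b + d" "d < b" using b by (auto simp: j_def d_def)
        have "j * b < m * b" using il ld by linarith
        then have j: "j < m" by simp
        \<comment> \<open>A centred weight is the difference of two consecutive partial sums of its
          block, so control of the partial sums also bounds single weights.\<close>
        have "e (Suc i, Suc l) - 1 = (\<Sum>k<Suc d. e (Suc i, Suc (j * b + k)) - 1) - (\<Sum>k<d. e (Suc i, Suc (j * b + k)) - 1)"
          using ld by simp
        moreover have "\<bar>\<Sum>k<Suc d. e (Suc i, Suc (j * b + k)) - 1\<bar> \<le> \<epsilon> / \<kappa>" "\<bar>\<Sum>k<d. e (Suc i, Suc (j * b + k)) - 1\<bar> \<le> \<epsilon> / \<kappa>"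
          using il j ld by (intro small; simp)+
        ultimately show "e (Suc i, Suc l) \<le> 1 + 2 * (\<epsilon> / \<kappa>)" by linarith
      qed (use \<epsilon> k b in auto)
      then have "\<kappa> * (ver e - ?M) \<le> \<kappa> * (?r (\<lambda>i. 1 / (1 * \<kappa>) * (\<Sum>k<Suc i. e (Suc k, 0))) + real n * (2 * (\<epsilon> / \<kappa>) + (1 + 2 * (\<epsilon> / \<kappa>))))"
        using k by (intro mult_left_mono) auto
      also have "\<dots> = ?P e + real n * (4 * \<epsilon> + \<kappa>)"
      proof -
        have "?P e = \<kappa> * ?r (\<lambda>i. 1 / (1 * \<kappa>) * (\<Sum>k<Suc i. e (Suc k, 0)))"
          unfolding \<kappa>_def C_def
        proof (rule pass_block_map[OF T m b])
          fix i assume "i \<le> n"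
          then have "start (restrict (block_map b e) (cell_index (Suc n) m)) i = (\<Sum>k<Suc i. e (Suc k, 0))"
            unfolding start_def by (intro sum.cong) (auto simp: cell_index_def block_map_def)
          then show "start (restrict (block_map b e) (cell_index (Suc n) m)) i =
              sqrt (T / real (m * b)) * (1 / (1 * sqrt (T / real (m * b))) * (\<Sum>k<Suc i. e (Suc k, 0)))"
            using T m b by simp
        qed
        then show ?thesis using k by (simp add: algebra_simps)
      qed
      finally have "y \<le> ?P e" using True gap by linarith
      then show ?thesis using sp by (simp add: indicator_def)
    qed (auto simp: indicator_def)
    have "exp (\<theta> * (\<kappa> * (G (1 - \<theta>) 1 e - ?M))) \<le> exp (\<theta> * (\<kappa> * (max (hor e) (ver e) - ?M)))"
      using full k th by (simp add: mult_left_mono)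
    also have "\<dots> \<le> exp (\<theta> * (\<kappa> * (hor e - ?M))) + exp (\<theta> * ?v)"
      by (cases "hor e \<le> ver e") (auto simp: max_def)
    also have "exp (\<theta> * (\<kappa> * (hor e - ?M))) \<le> h1 e"
      unfolding h1_def using horG k th by (simp add: mult_left_mono)
    also have "exp (\<theta> * ?v) \<le> exp (\<theta> * y2) * (indicator ?A e + indicator ?B e) + exp (- \<eta> * y2) * h2 e + exp (\<eta> * y1) * h3 e"
      by (rule order_trans[OF v1]) (intro add_mono mult_left_mono v2 v3; simp)
    finally show ?thesis by (simp add: add.assoc)
  qed
  have "ennreal (mgf_lpp T (Suc n) (1 - \<theta>) 1 (m * b)) = (\<integral>\<^sup>+e. ennreal (exp (\<theta> * (\<kappa> * (G (1 - \<theta>) 1 e - ?M)))) \<partial>N)"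
    using mgf[of "1 - \<theta>" 1] th by simp
  also have "\<dots> \<le> (\<integral>\<^sup>+e. ennreal (h1 e) + ennreal (exp (\<theta> * y2)) * (indicator ?A e + indicator ?B e) +
      ennreal (exp (- \<eta> * y2)) * ennreal (h2 e) + ennreal (exp (\<eta> * y1)) * ennreal (h3 e) \<partial>N)"
  proof (rule nn_integral_mono_AE)
    have "AE e in N. \<forall>c\<in>?S. 0 \<le> e c" unfolding N_def by (rule AE_noise_nonneg) simp
    moreover have "AE e in N. e \<in> space N" by simp
    ultimately show "AE e in N. ennreal (exp (\<theta> * (\<kappa> * (G (1 - \<theta>) 1 e - ?M)))) \<le>
        ennreal (h1 e) + ennreal (exp (\<theta> * y2)) * (indicator ?A e + indicator ?B e) +
        ennreal (exp (- \<eta> * y2)) * ennreal (h2 e) + ennreal (exp (\<eta> * y1)) * ennreal (h3 e)"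
    proof eventually_elim
      case (elim e)
      have i: "indicator X e = ennreal (indicator X e)" for X by (simp add: indicator_def)
      have "ennreal (h1 e) + ennreal (exp (\<theta> * y2)) * (indicator ?A e + indicator ?B e) +
        ennreal (exp (- \<eta> * y2)) * ennreal (h2 e) + ennreal (exp (\<eta> * y1)) * ennreal (h3 e) =
        ennreal (h1 e + exp (\<theta> * y2) * (indicator ?A e + indicator ?B e) + exp (- \<eta> * y2) * h2 e + exp (\<eta> * y1) * h3 e)"
        unfolding i by (simp add: ennreal_mult[symmetric] ennreal_plus[symmetric] h1_def h2_def h3_def del: ennreal_plus)
      then show ?case using pointwise[OF elim(2,1)] by (simp add: ennreal_leI)
    qed
  qed
  also have "\<dots> = (\<integral>\<^sup>+e. ennreal (h1 e) \<partial>N) + ennreal (exp (\<theta> * y2)) * (emeasure N ?A + emeasure N ?B) +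
      ennreal (exp (- \<eta> * y2)) * (\<integral>\<^sup>+e. ennreal (h2 e) \<partial>N) + ennreal (exp (\<eta> * y1)) * (\<integral>\<^sup>+e. ennreal (h3 e) \<partial>N)"
    by (simp add: nn_integral_add nn_integral_cmult)
  also have "(\<integral>\<^sup>+e. ennreal (h1 e) \<partial>N) = ennreal (mgf_lpp T (Suc n) 1 (1 + \<theta>) (m * b))"
    using mgf[of 1 "1 + \<theta>"] th by (simp add: h1_def)
  also have "(\<integral>\<^sup>+e. ennreal (h2 e) \<partial>N) = ennreal (mgf_lpp T (Suc n) (1 - (\<theta> + \<eta>)) 1 (m * b))"
    using mgf[of "1 - (\<theta> + \<eta>)" 1] th by (simp add: h2_def)
  also have "(\<integral>\<^sup>+e. ennreal (h3 e) \<partial>N) = ennreal (mgf_lpp T (Suc n) (1 - (\<theta> - \<eta>)) 1 (m * b))"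
    using mgf[of "1 - (\<theta> - \<eta>)" 1] th by (simp add: h3_def)
  finally show ?thesis .
qed

text \<open>Fatou's lemma bounds a limit from one side only and is therefore applied to the
  complement: staying below y is an open condition, its indicator is lower semicontinuous, and its
  Gaussian probability is at most the limit L of the bounds R. The oscillation term remains in the
  result because m is still fixed.\<close>

theorem gauss_lower_bound:
  fixes \<theta> \<eta> y y1 y2 \<epsilon> T :: real and n m :: nat
  assumes T: "0 < T" and m: "0 < m"
    and th: "0 < \<eta>" "\<eta> < \<theta>" "\<theta> + \<eta> < 1" and y: "y1 \<le> y2" and \<epsilon>: "0 < \<epsilon>"
    and gap: "4 * real n * \<epsilon> < y1 - y"
  shows "mgf_lim T (Suc n) (1 - \<theta>) 1 - mgf_lim T (Suc n) 1 (1 + \<theta>)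
      - exp (- \<eta> * y2) * mgf_lim T (Suc n) (1 - (\<theta> + \<eta>)) 1
      - exp (\<eta> * y1) * mgf_lim T (Suc n) (1 - (\<theta> - \<eta>)) 1
    \<le> exp (\<theta> * y2) *
      (measure (gauss_law (Suc n) m) {x \<in> space (gauss_law (Suc n) m). y \<le> pass (start x) (incr T m x) n m} +
       2 * real (Suc n) * real m * exp (2 * T - sqrt (real m) * \<epsilon>))"
proof -
  let ?C = "cell_index (Suc n) m"
  let ?Q = "gauss_law (Suc n) m"
  define p where "p x = pass (start x) (incr T m x) n m" for x
  let ?F = "\<lambda>x. indicator {x. p x < y} x :: ennreal"
  let ?N = "\<lambda>b. noise ({..Suc n} \<times> {..m * b})"
  let ?r = "\<lambda>b e. restrict (block_map b e) ?C"
  define bd where "bd = 2 * real (Suc n) * real m * exp (2 * T - sqrt (real m) * \<epsilon>)"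
  define q where "q b = measure (?N b) {e \<in> space (?N b). p (?r b e) < y}" for b
  have mp: "p \<in> borel_measurable (PiM ?C (\<lambda>_. borel))"
    unfolding p_def[abs_def] by (rule measurable_pass_start)
  have setsQ: "sets ?Q = sets (PiM ?C (\<lambda>_. borel))"
    unfolding gauss_law_def by (intro sets_PiM_cong) auto
  have mpQ[measurable]: "p \<in> borel_measurable ?Q"
    using mp measurable_cong_sets[OF setsQ refl] by blast
  have pr: "(\<lambda>e. p (?r b e)) \<in> borel_measurable (?N b)" for b
    by (rule measurable_compose[OF measurable_block_map mp])
  interpret Q: prob_space ?Q
    unfolding gauss_law_def using prob_space_expo[of 1] real_dist_normal_dist
    by (intro prob_space_PiM) (auto simp: real_distribution_def)
  \<comment> \<open>\<open>noise_lower_bound\<close> solved for the probability of staying below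
    y.\<close>
  define R where "R b = 1 + bd - exp (- \<theta> * y2) * (mgf_lpp T (Suc n) (1 - \<theta>) 1 (m * b) - mgf_lpp T (Suc n) 1 (1 + \<theta>) (m * b)
      - exp (- \<eta> * y2) * mgf_lpp T (Suc n) (1 - (\<theta> + \<eta>)) 1 (m * b)
      - exp (\<eta> * y1) * mgf_lpp T (Suc n) (1 - (\<theta> - \<eta>)) 1 (m * b))" for b
  define L where "L = 1 + bd - exp (- \<theta> * y2) * (mgf_lim T (Suc n) (1 - \<theta>) 1 - mgf_lim T (Suc n) 1 (1 + \<theta>)
      - exp (- \<eta> * y2) * mgf_lim T (Suc n) (1 - (\<theta> + \<eta>)) 1
      - exp (\<eta> * y1) * mgf_lim T (Suc n) (1 - (\<theta> - \<eta>)) 1)"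
  have RL: "R \<longlonglongrightarrow> L"
    unfolding R_def L_def by (intro tendsto_intros tendsto_mgf_lpp_blocks T m)
  have qR: "\<forall>\<^sub>F b in sequentially. q b \<le> R b"
  proof -
    have k0: "(\<lambda>b. real n * (4 * \<epsilon> + sqrt (T / real (m * b)))) \<longlonglongrightarrow> real n * (4 * \<epsilon> + 0)"
    proof -
      have "0 < T / real m" using T m by simp
      then have "(\<lambda>b. sqrt ((T / real m) / real b)) \<longlonglongrightarrow> 0" by real_asymp
      then have "(\<lambda>b. sqrt (T / real (m * b))) \<longlonglongrightarrow> 0" by simp
      then show ?thesis by (intro tendsto_intros)
    qed
    have "\<forall>\<^sub>F b in sequentially. real n * (4 * \<epsilon> + sqrt (T / real (m * b))) < y1 - y"
      using order_tendstoD(2)[OF k0] gap by (simp add: mult_ac)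
    \<comment> \<open>The condition sqrt (T / b) \<le> 1/2 of \<open>emeasure_bad\<close>, in the
      form of \<open>eventually_small_rate\<close> with factor 2 and a single block.\<close>
    moreover have "\<forall>\<^sub>F b in sequentially. 2 * sqrt (T / real (1 * b)) < 1"
      by (rule eventually_small_rate) (use T in auto)
    ultimately show ?thesis
      using eventually_small_rate[OF T m, of "1 + \<theta>"] eventually_gt_at_top[of 0]
    proof eventually_elim
      case (elim b)
      interpret N: prob_space "?N b" by (rule prob_space_noise)
      let ?A = "{e \<in> space (?N b). y \<le> p (?r b e)}"
      let ?B = "{e \<in> space (?N b). bad (sqrt (T / real (m * b))) (Suc n) m b \<epsilon> e}"
      have A: "emeasure (?N b) ?A = ennreal (1 - q b)"
      proof -
        have "N.prob ?A = 1 - q b"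
        proof -
          have S: "{e \<in> space (?N b). p (?r b e) < y} \<in> N.events" using pr[of b] by measurable
          have "?A = space (?N b) - {e \<in> space (?N b). p (?r b e) < y}" by auto
          then show ?thesis using N.prob_compl[OF S] by (simp add: q_def)
        qed
        then show ?thesis by (simp add: N.emeasure_eq_measure)
      qed
      have B: "emeasure (?N b) ?B \<le> ennreal bd"
        unfolding bd_def by (rule emeasure_bad) (use T m elim in auto)
      have nn: "0 \<le> 1 - q b" by (simp add: q_def)
      have pos: "0 \<le> mgf_lpp T (Suc n) \<nu> la (m * b)" if "0 < \<nu>" "\<nu> \<le> la" "la \<le> 1 + \<theta>" for \<nu> la
      proof -
        have "0 \<le> sqrt (T / real (m * b))" using T by simp
        then have "la * sqrt (T / real (m * b)) < 1" "\<nu> * sqrt (T / real (m * b)) < 1"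
          using mult_right_mono[of la "1 + \<theta>"] mult_right_mono[of \<nu> "1 + \<theta>"] that elim(3)
          by (smt (verit))+
        then show ?thesis using that by (simp add: mgf_lpp_def Let_def)
      qed
      have "ennreal (mgf_lpp T (Suc n) (1 - \<theta>) 1 (m * b)) \<le>
          ennreal (mgf_lpp T (Suc n) 1 (1 + \<theta>) (m * b)) +
          ennreal (exp (\<theta> * y2)) * (emeasure (?N b) ?A + emeasure (?N b) ?B) +
          ennreal (exp (- \<eta> * y2)) * ennreal (mgf_lpp T (Suc n) (1 - (\<theta> + \<eta>)) 1 (m * b)) +
          ennreal (exp (\<eta> * y1)) * ennreal (mgf_lpp T (Suc n) (1 - (\<theta> - \<eta>)) 1 (m * b))"
        unfolding p_def by (rule noise_lower_bound) (use T m th y \<epsilon> elim in auto)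
      also have "\<dots> \<le> ennreal (mgf_lpp T (Suc n) 1 (1 + \<theta>) (m * b)) +
          ennreal (exp (\<theta> * y2)) * (ennreal (1 - q b) + ennreal bd) +
          ennreal (exp (- \<eta> * y2)) * ennreal (mgf_lpp T (Suc n) (1 - (\<theta> + \<eta>)) 1 (m * b)) +
          ennreal (exp (\<eta> * y1)) * ennreal (mgf_lpp T (Suc n) (1 - (\<theta> - \<eta>)) 1 (m * b))"
        unfolding A by (intro add_mono mult_left_mono order_refl B) auto
      also have "\<dots> = ennreal (mgf_lpp T (Suc n) 1 (1 + \<theta>) (m * b) + exp (\<theta> * y2) * ((1 - q b) + bd) +
          exp (- \<eta> * y2) * mgf_lpp T (Suc n) (1 - (\<theta> + \<eta>)) 1 (m * b) +
          exp (\<eta> * y1) * mgf_lpp T (Suc n) (1 - (\<theta> - \<eta>)) 1 (m * b))"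
      proof -
        have "0 \<le> bd" by (simp add: bd_def)
        then show ?thesis
          using nn th pos[of 1 "1 + \<theta>"] pos[of "1 - (\<theta> + \<eta>)" 1] pos[of "1 - (\<theta> - \<eta>)" 1]
          by (simp add: ennreal_mult[symmetric] ennreal_plus[symmetric] del: ennreal_plus)
      qed
      finally have "mgf_lpp T (Suc n) (1 - \<theta>) 1 (m * b) \<le> mgf_lpp T (Suc n) 1 (1 + \<theta>) (m * b) + exp (\<theta> * y2) * ((1 - q b) + bd) +
          exp (- \<eta> * y2) * mgf_lpp T (Suc n) (1 - (\<theta> + \<eta>)) 1 (m * b) +
          exp (\<eta> * y1) * mgf_lpp T (Suc n) (1 - (\<theta> - \<eta>)) 1 (m * b)"
      proof (subst (asm) ennreal_le_iff)
        have "0 \<le> bd" by (simp add: bd_def)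
        then show "0 \<le> mgf_lpp T (Suc n) 1 (1 + \<theta>) (m * b) + exp (\<theta> * y2) * ((1 - q b) + bd) +
          exp (- \<eta> * y2) * mgf_lpp T (Suc n) (1 - (\<theta> + \<eta>)) 1 (m * b) +
          exp (\<eta> * y1) * mgf_lpp T (Suc n) (1 - (\<theta> - \<eta>)) 1 (m * b)"
          using nn th pos[of 1 "1 + \<theta>"] pos[of "1 - (\<theta> + \<eta>)" 1] pos[of "1 - (\<theta> - \<eta>)" 1] by simp
      qed
      then have "mgf_lpp T (Suc n) (1 - \<theta>) 1 (m * b) - mgf_lpp T (Suc n) 1 (1 + \<theta>) (m * b)
          - exp (- \<eta> * y2) * mgf_lpp T (Suc n) (1 - (\<theta> + \<eta>)) 1 (m * b)
          - exp (\<eta> * y1) * mgf_lpp T (Suc n) (1 - (\<theta> - \<eta>)) 1 (m * b) \<le> exp (\<theta> * y2) * ((1 - q b) + bd)" (is "?l \<le> _")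
        by linarith
      then have "exp (- \<theta> * y2) * ?l \<le> exp (- \<theta> * y2) * (exp (\<theta> * y2) * ((1 - q b) + bd))"
        by (intro mult_left_mono) auto
      also have "\<dots> = (1 - q b) + bd"
        by (simp add: mult.assoc[symmetric] exp_add[symmetric])
      finally show ?case unfolding R_def by linarith
    qed
  qed
  have "emeasure ?Q {x \<in> space ?Q. p x < y} = (\<integral>\<^sup>+x. ?F x \<partial>?Q)"
  proof -
    have "emeasure ?Q {x \<in> space ?Q. p x < y} = (\<integral>\<^sup>+x. indicator {x \<in> space ?Q. p x < y} x \<partial>?Q)"
      by (rule nn_integral_indicator[symmetric]) measurable
    also have "\<dots> = (\<integral>\<^sup>+x. ?F x \<partial>?Q)"
      by (intro nn_integral_cong) (auto simp: indicator_def)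
    finally show ?thesis .
  qed
  also have "\<dots> \<le> liminf (\<lambda>b. \<integral>\<^sup>+e. ?F (?r b e) \<partial>?N b)"
  proof (rule gauss_law_Fatou)
    have "{x \<in> space (PiM ?C (\<lambda>_. borel)). p x < y} \<in> sets (PiM ?C (\<lambda>_. borel))"
      using mp by measurable
    then have "indicator {x \<in> space (PiM ?C (\<lambda>_. borel)). p x < y} \<in> borel_measurable (PiM ?C (\<lambda>_. borel))"
      by (rule borel_measurable_indicator)
    then show "?F \<in> borel_measurable (PiM ?C (\<lambda>_. borel))"
      by (rule measurable_cong[THEN iffD1, rotated]) (auto simp: indicator_def)
    fix x and z :: "nat \<Rightarrow> nat \<times> nat \<Rightarrow> real" assume z: "\<And>c. c \<in> ?C \<Longrightarrow> (\<lambda>b. z b c) \<longlonglongrightarrow> x c"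
    show "?F x \<le> liminf (\<lambda>b. ?F (z b))"
    proof (cases "p x < y")
      case True
      have "(\<lambda>b. p (z b)) \<longlonglongrightarrow> p x"
        unfolding p_def incr_def start_def
        by (intro tendsto_rpass tendsto_sum tendsto_const tendsto_mult z) (auto simp: cell_index_def)
      from order_tendstoD(2)[OF this True] have "\<forall>\<^sub>F b in sequentially. 1 \<le> ?F (z b)"
        by eventually_elim (simp add: indicator_def)
      then have "1 \<le> liminf (\<lambda>b. ?F (z b))" by (rule Liminf_bounded)
      then show ?thesis using True by (simp add: indicator_def)
    qed simp
  qed simp
  also have "\<dots> \<le> liminf (\<lambda>b. ennreal (R b))"
  proof (rule Liminf_mono)
    show "\<forall>\<^sub>F b in sequentially. (\<integral>\<^sup>+e. ?F (?r b e) \<partial>?N b) \<le> ennreal (R b)"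
      using qR
    proof eventually_elim
      case (elim b)
      interpret N: prob_space "?N b" by (rule prob_space_noise)
      have "(\<integral>\<^sup>+e. ?F (?r b e) \<partial>?N b) = (\<integral>\<^sup>+e. indicator {e \<in> space (?N b). p (?r b e) < y} e \<partial>?N b)"
        by (intro nn_integral_cong) (auto simp: indicator_def)
      also have "\<dots> = emeasure (?N b) {e \<in> space (?N b). p (?r b e) < y}"
        by (rule nn_integral_indicator) (use pr[of b] in measurable)
      also have "\<dots> = ennreal (q b)" by (simp add: q_def N.emeasure_eq_measure)
      finally show ?case using elim by (simp add: ennreal_leI)
    qed
  qed
  also have "\<dots> = ennreal L"
    by (intro lim_imp_Liminf tendsto_ennrealI RL) simp
  finally have "ennreal (Q.prob {x \<in> space ?Q. p x < y}) \<le> ennreal L"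
    by (simp add: Q.emeasure_eq_measure)
  \<comment> \<open>\<open>ennreal\<close> sends negative reals to 0, so the comparison returns to
    the reals only for a nonnegative right-hand side.\<close>
  moreover have "0 \<le> L"
  proof (rule tendsto_lowerbound[OF RL])
    show "\<forall>\<^sub>F b in sequentially. 0 \<le> R b"
      using qR by eventually_elim (auto simp: q_def intro: order_trans[OF measure_nonneg])
  qed simp
  ultimately have "Q.prob {x \<in> space ?Q. p x < y} \<le> L" by simp
  moreover have "Q.prob {x \<in> space ?Q. y \<le> p x} = 1 - Q.prob {x \<in> space ?Q. p x < y}"
  proof -
    have "{x \<in> space ?Q. p x < y} \<in> Q.events" by measurable
    from Q.prob_compl[OF this] show ?thesis
      by (simp add: set_diff_eq not_less cong: conj_cong)
  qed
  ultimately have "exp (- \<theta> * y2) * (mgf_lim T (Suc n) (1 - \<theta>) 1 - mgf_lim T (Suc n) 1 (1 + \<theta>)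
      - exp (- \<eta> * y2) * mgf_lim T (Suc n) (1 - (\<theta> + \<eta>)) 1
      - exp (\<eta> * y1) * mgf_lim T (Suc n) (1 - (\<theta> - \<eta>)) 1) \<le> Q.prob {x \<in> space ?Q. y \<le> p x} + bd" (is "_ * ?l \<le> _")
    unfolding L_def by linarith
  then have "exp (\<theta> * y2) * (exp (- \<theta> * y2) * ?l) \<le> exp (\<theta> * y2) * (Q.prob {x \<in> space ?Q. y \<le> p x} + bd)"
    by (intro mult_left_mono) auto
  moreover have "exp (\<theta> * y2) * (exp (- \<theta> * y2) * ?l) = ?l"
    by (simp add: mult.assoc[symmetric] exp_add[symmetric])
  ultimately have "?l \<le> exp (\<theta> * y2) * (Q.prob {x \<in> space ?Q. y \<le> p x} + bd)"
    by (simp only:)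
  then show ?thesis unfolding p_def bd_def .
qed

section \<open>Last passage along continuous paths\<close>

text \<open>Raising the last jump time from t to t' keeps a sequence admissible and adds exactly the
  increment of level n.\<close>

lemma last_passage_advance:
  assumes kn: "k \<le> n" and t: "0 \<le> t" "t \<le> t'"
  shows "last_passage b k n t + ereal (b n t' - b n t) \<le> last_passage b k n t'"
proof -
  have ne: "jump_times k n t \<noteq> {}"
  proof -
    have "(\<lambda>i. if i < k then 0 else t) \<in> jump_times k n t" using kn t by (auto simp: jump_times_def)
    then show ?thesis by blast
  qed
  have "last_passage b k n t + ereal (b n t' - b n t) =
      (SUP s\<in>jump_times k n t. ereal (\<Sum>i=k..n. b i (s i) - b i (s (i - 1))) + ereal (b n t' - b n t))"
    unfolding last_passage_def by (rule SUP_ereal_add_left[symmetric]) (use ne in auto)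
  also have "\<dots> \<le> last_passage b k n t'"
  proof (rule SUP_least)
    fix s assume s: "s \<in> jump_times k n t"
    define s' where "s' = s(n := t')"
    have s': "s' \<in> jump_times k n t'"
      using s kn t by (auto simp: jump_times_def s'_def intro: order_trans)
    have split: "{k..n} = insert n {k..n - 1}" using kn by auto
    have "(\<Sum>i=k..n. b i (s' i) - b i (s' (i - 1))) = (\<Sum>i=k..n. b i (s i) - b i (s (i - 1))) + (b n t' - b n t)"
    proof -
      have "(\<Sum>i=k..n-1. b i (s' i) - b i (s' (i - 1))) = (\<Sum>i=k..n-1. b i (s i) - b i (s (i - 1)))"
        by (rule sum.cong) (auto simp: s'_def)
      then show ?thesis
        using s by (simp add: split) (simp add: s'_def jump_times_def)
    qed
    then have "ereal (\<Sum>i=k..n. b i (s i) - b i (s (i - 1))) + ereal (b n t' - b n t) =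
        ereal (\<Sum>i=k..n. b i (s' i) - b i (s' (i - 1)))" by simp
    also have "\<dots> \<le> last_passage b k n t'"
      unfolding last_passage_def by (rule SUP_upper[OF s'])
    finally show "ereal (\<Sum>i=k..n. b i (s i) - b i (s (i - 1))) + ereal (b n t' - b n t) \<le> last_passage b k n t'" .
  qed
  finally show ?thesis .
qed

text \<open>The additional level is entered at the final time t, where it contributes 0.\<close>

lemma last_passage_Suc_level:
  assumes kn: "k \<le> n"
  shows "last_passage b k n t \<le> last_passage b k (n + 1) t"
  unfolding last_passage_def[of b k n t]
proof (rule SUP_least)
  fix s assume s: "s \<in> jump_times k n t"
  define s' where "s' = s(n + 1 := t)"
  have s': "s' \<in> jump_times k (n + 1) t"
    using s kn by (auto simp: jump_times_def s'_def)
  have split: "{k..n + 1} = insert (n + 1) {k..n}" using kn by auto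
  have "(\<Sum>i=k..n. b i (s' i) - b i (s' (i - 1))) = (\<Sum>i=k..n. b i (s i) - b i (s (i - 1)))"
    by (rule sum.cong) (auto simp: s'_def)
  then have "(\<Sum>i=k..n+1. b i (s' i) - b i (s' (i - 1))) = (\<Sum>i=k..n. b i (s i) - b i (s (i - 1)))"
    using s by (simp add: split) (simp add: s'_def jump_times_def)
  moreover have "ereal (\<Sum>i=k..n+1. b i (s' i) - b i (s' (i - 1))) \<le> last_passage b k (n + 1) t"
    unfolding last_passage_def by (rule SUP_upper[OF s'])
  ultimately show "ereal (\<Sum>i=k..n. b i (s i) - b i (s (i - 1))) \<le> last_passage b k (n + 1) t"
    by simp
qed

lemma last_passage_0_nonneg: "0 \<le> last_passage b k n 0"
proof -
  have "(\<lambda>_. 0) \<in> jump_times k n 0" by (auto simp: jump_times_def)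
  from SUP_upper[OF this, of "\<lambda>s. ereal (\<Sum>i=k..n. b i (s i) - b i (s (i - 1)))"]
  show ?thesis by (simp add: last_passage_def zero_ereal_def)
qed

abbreviation path_incr_grid :: "(int \<Rightarrow> real \<Rightarrow> real) \<Rightarrow> int \<Rightarrow> real \<Rightarrow> nat \<Rightarrow> nat \<Rightarrow> real" where
  "path_incr_grid b k \<delta> i j \<equiv> b (k + int i) (real (Suc j) * \<delta>) - b (k + int i) (real j * \<delta>)"

lemma pass_le_last_passage:
  assumes "0 \<le> \<delta>"
  shows "ereal (pass (\<lambda>_. 0) (path_incr_grid b k \<delta>) i j) \<le> last_passage b k (k + int i) (real j * \<delta>)"
proof (rule pass_le[where F = "\<lambda>i j. last_passage b k (k + int i) (real j * \<delta>)"])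
  show "ereal 0 \<le> last_passage b k (k + int i) (real 0 * \<delta>)" for i
    using last_passage_0_nonneg by (simp add: zero_ereal_def)
  show "last_passage b k (k + int i) (real j * \<delta>) + ereal (path_incr_grid b k \<delta> i j) \<le>
      last_passage b k (k + int i) (real (Suc j) * \<delta>)" for i j
    by (rule last_passage_advance) (use assms in \<open>auto intro: mult_right_mono\<close>)
  show "last_passage b k (k + int i) (real j * \<delta>) \<le> last_passage b k (k + int (Suc i)) (real j * \<delta>)" for i j
    using last_passage_Suc_level[of k "k + int i"] by (simp add: ac_simps)
qed

lemma pass_le_reflected_system:
  assumes "0 \<le> \<delta>"
  shows "ereal (pass (\<lambda>i. x (k + int i)) (path_incr_grid b k \<delta>) i j) \<le>
    reflected_system x b (k + int i) (real j * \<delta>)"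
proof (rule pass_le[where F = "\<lambda>i j. reflected_system x b (k + int i) (real j * \<delta>)"])
  show "ereal (x (k + int i)) \<le> reflected_system x b (k + int i) (real 0 * \<delta>)" for i
    unfolding reflected_system_def
    by (rule SUP_upper2[of "k + int i"])
       (use last_passage_0_nonneg[of b "k + int i" "k + int i"] in \<open>simp_all add: add_increasing2\<close>)
  fix i j
  show "reflected_system x b (k + int i) (real j * \<delta>) + ereal (path_incr_grid b k \<delta> i j) \<le>
      reflected_system x b (k + int i) (real (Suc j) * \<delta>)"
  proof -
    have "reflected_system x b (k + int i) (real j * \<delta>) + ereal (path_incr_grid b k \<delta> i j) =
        (SUP l\<in>{..k + int i}. ereal (x l) + last_passage b l (k + int i) (real j * \<delta>) + ereal (path_incr_grid b k \<delta> i j))"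
      unfolding reflected_system_def by (rule SUP_ereal_add_left[symmetric]) auto
    also have "\<dots> \<le> reflected_system x b (k + int i) (real (Suc j) * \<delta>)"
    proof (rule SUP_least)
      fix l assume l: "l \<in> {..k + int i}"
      have "ereal (x l) + (last_passage b l (k + int i) (real j * \<delta>) + ereal (path_incr_grid b k \<delta> i j)) \<le>
          ereal (x l) + last_passage b l (k + int i) (real (Suc j) * \<delta>)"
        by (intro add_left_mono last_passage_advance) (use assms l in \<open>auto intro: mult_right_mono\<close>)
      also have "\<dots> \<le> reflected_system x b (k + int i) (real (Suc j) * \<delta>)"
        unfolding reflected_system_def by (rule SUP_upper[OF l])
      finally show "ereal (x l) + last_passage b l (k + int i) (real j * \<delta>) + ereal (path_incr_grid b k \<delta> i j) \<le>
          reflected_system x b (k + int i) (real (Suc j) * \<delta>)"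
        by (simp add: add.assoc)
    qed
    finally show ?thesis .
  qed
  show "reflected_system x b (k + int i) (real j * \<delta>) \<le> reflected_system x b (k + int (Suc i)) (real j * \<delta>)"
    unfolding reflected_system_def[of x b "k + int i"]
  proof (rule SUP_least)
    fix l assume l: "l \<in> {..k + int i}"
    have "ereal (x l) + last_passage b l (k + int i) (real j * \<delta>) \<le> ereal (x l) + last_passage b l (k + int i + 1) (real j * \<delta>)"
      by (intro add_left_mono last_passage_Suc_level) (use l in auto)
    also have "\<dots> \<le> reflected_system x b (k + int i + 1) (real j * \<delta>)"
      unfolding reflected_system_def by (rule SUP_upper) (use l in auto)
    finally show "ereal (x l) + last_passage b l (k + int i) (real j * \<delta>) \<le> reflected_system x b (k + int (Suc i)) (real j * \<delta>)"
      by (simp add: ac_simps)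
  qed
qed

text \<open>A path that changes level at grid times is one of those maximised by
  \<open>pass\<close>; it is built level by level, first moving up at the old time and then
  advancing.\<close>

lemma grid_sum_le_pass:
  fixes c :: "int \<Rightarrow> nat"
  assumes c0: "c (k - 1) = 0" and mono: "\<And>i. k \<le> i \<Longrightarrow> i \<le> k + int j \<Longrightarrow> c (i - 1) \<le> c i"
  shows "(\<Sum>i=k..k + int j. b i (real (c i) * \<delta>) - b i (real (c (i - 1)) * \<delta>)) \<le>
    pass (\<lambda>_. 0) (path_incr_grid b k \<delta>) j (c (k + int j))"
  using mono
proof (induction j)
  have tele: "(\<Sum>l=u..<u+d. path_incr_grid b k \<delta> i l) = b (k + int i) (real (u + d) * \<delta>) - b (k + int i) (real u * \<delta>)" for u d i
    by (induction d) auto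
  case 0
  have "pass (\<lambda>_. 0) (path_incr_grid b k \<delta>) 0 0 + (\<Sum>l=0..<0 + c k. path_incr_grid b k \<delta> 0 l) \<le>
      pass (\<lambda>_. 0) (path_incr_grid b k \<delta>) 0 (0 + c k)"
    by (rule rpass_advance)
  then show ?case unfolding tele using c0 by simp
next
  case (Suc j)
  have tele: "(\<Sum>l=u..<u+d. path_incr_grid b k \<delta> i l) = b (k + int i) (real (u + d) * \<delta>) - b (k + int i) (real u * \<delta>)" for u d i
    by (induction d) auto
  let ?p = "pass (\<lambda>_. 0) (path_incr_grid b k \<delta>)"
  let ?f = "\<lambda>i. b i (real (c i) * \<delta>) - b i (real (c (i - 1)) * \<delta>)"
  have IH: "(\<Sum>i=k..k + int j. ?f i) \<le> ?p j (c (k + int j))"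
    by (rule Suc.IH) (use Suc.prems in auto)
  obtain d where d: "c (k + int (Suc j)) = c (k + int j) + d"
    using Suc.prems[of "k + int (Suc j)"] by (auto simp: le_iff_add)
  have "{k..k + int (Suc j)} = insert (k + int (Suc j)) {k..k + int j}" by auto
  then have "(\<Sum>i=k..k + int (Suc j). ?f i) = ?f (k + int (Suc j)) + (\<Sum>i=k..k + int j. ?f i)"
    by simp
  also have "\<dots> \<le> ?f (k + int (Suc j)) + ?p (Suc j) (c (k + int j))"
    by (rule add_left_mono[OF order_trans[OF IH rpass_up]]) simp
  also have "?f (k + int (Suc j)) = (\<Sum>l=c (k + int j)..<c (k + int j)+d. path_incr_grid b k \<delta> (Suc j) l)"
    by (simp only: d tele) simp
  also have "(\<Sum>l=c (k + int j)..<c (k + int j)+d. path_incr_grid b k \<delta> (Suc j) l) + ?p (Suc j) (c (k + int j)) \<le> ?p (Suc j) (c (k + int (Suc j)))"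
    unfolding d using rpass_advance[of "\<lambda>_. True" "\<lambda>_. 0" "path_incr_grid b k \<delta>" "Suc j" "c (k + int j)" d] by linarith
  finally show ?case .
qed

text \<open>Rounding the jump times down to the grid of mesh T / m keeps their order, leaves the
  first at 0 and sends the last exactly to index m. The rounded times converge, and so do the sums
  along continuous paths; hence the grid maxima cannot stay behind in the limit.\<close>

lemma last_passage_le_liminf:
  assumes T: "0 < T" and cont: "\<And>i. continuous_on {0..} (b i)"
  shows "last_passage b k (k + int j) T \<le>
    liminf (\<lambda>m. ereal (pass (\<lambda>_. 0) (path_incr_grid b k (T / real m)) j m))"
  unfolding last_passage_def
proof (rule SUP_least)
  fix s assume s: "s \<in> jump_times k (k + int j) T"
  have mono: "s (i - 1) \<le> s i" if "k \<le> i" "i \<le> k + int j" for i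
    using s that by (auto simp: jump_times_def)
  have s0: "s (k - 1) = 0" and sT: "s (k + int j) = T" using s by (auto simp: jump_times_def)
  have pos': "0 \<le> s (k - 1 + int d)" if "d \<le> Suc j" for d
    using that
  proof (induction d)
    case (Suc d)
    then have "s (k - 1 + int d) \<le> s (k - 1 + int (Suc d))"
    proof -
      have "k - 1 + int (Suc d) - 1 = k - 1 + int d" by simp
      then show ?thesis using mono[of "k - 1 + int (Suc d)"] Suc(2) by (simp only:)
    qed
    with Suc show ?case by simp
  qed (simp add: s0)
  have pos: "0 \<le> s i" if "k - 1 \<le> i" "i \<le> k + int j" for i
    using pos'[of "nat (i - (k - 1))"] that by simp
  define c where "c m i = nat \<lfloor>s i * real m / T\<rfloor>" for m i
  have lim: "(\<lambda>m. real (c m i) * (T / real m)) \<longlonglongrightarrow> s i" if "k - 1 \<le> i" "i \<le> k + int j" for i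
  proof -
    have ev: "\<forall>\<^sub>F m in sequentially. s i - T / real m \<le> real (c m i) * (T / real m) \<and> real (c m i) * (T / real m) \<le> s i"
      using eventually_gt_at_top[of 0]
    proof eventually_elim
      case (elim m)
      have "0 \<le> s i * real m / T" using pos[OF that] T by simp
      then have c: "real (c m i) = of_int \<lfloor>s i * real m / T\<rfloor>" by (simp add: c_def)
      have fl: "s i * real m / T - 1 \<le> real (c m i)" "real (c m i) \<le> s i * real m / T"
        unfolding c by linarith+
      have \<delta>: "0 \<le> T / real m" using T by simp
      note mult_right_mono[OF fl(1) \<delta>] mult_right_mono[OF fl(2) \<delta>]
      then show ?case using T elim by (simp add: left_diff_distrib diff_divide_distrib)
    qed
    have "(\<lambda>m. s i - T / real m) \<longlonglongrightarrow> s i - 0"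
      by (intro tendsto_diff tendsto_const lim_const_over_n)
    then have l1: "(\<lambda>m. s i - T / real m) \<longlonglongrightarrow> s i" by simp
    show ?thesis
      by (rule tendsto_sandwich[OF _ _ l1 tendsto_const]) (use ev in \<open>auto elim: eventually_mono\<close>)
  qed
  have limb: "(\<lambda>m. b i (real (c m i') * (T / real m))) \<longlonglongrightarrow> b i (s i')" if "k - 1 \<le> i'" "i' \<le> k + int j" for i i'
    by (rule continuous_on_tendsto_compose[OF cont lim[OF that]]) (use pos[OF that] T in auto)
  let ?S = "\<lambda>m. \<Sum>i=k..k + int j. b i (real (c m i) * (T / real m)) - b i (real (c m (i - 1)) * (T / real m))"
  have "?S \<longlonglongrightarrow> (\<Sum>i=k..k + int j. b i (s i) - b i (s (i - 1)))"
    by (intro tendsto_sum tendsto_diff limb) auto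
  then have "(\<lambda>m. ereal (?S m)) \<longlonglongrightarrow> ereal (\<Sum>i=k..k + int j. b i (s i) - b i (s (i - 1)))"
    by (rule tendsto_ereal)
  then have "ereal (\<Sum>i=k..k + int j. b i (s i) - b i (s (i - 1))) = liminf (\<lambda>m. ereal (?S m))"
    by (rule lim_imp_Liminf[OF sequentially_bot, symmetric])
  also have "\<dots> \<le> liminf (\<lambda>m. ereal (pass (\<lambda>_. 0) (path_incr_grid b k (T / real m)) j m))"
  proof (rule Liminf_mono)
    show "\<forall>\<^sub>F m in sequentially. ereal (?S m) \<le> ereal (pass (\<lambda>_. 0) (path_incr_grid b k (T / real m)) j m)"
      using eventually_gt_at_top[of 0]
    proof eventually_elim
      case (elim m)
      have "c m (k + int j) = m" using T by (simp add: c_def sT)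
      moreover have "c m (i - 1) \<le> c m i" if "k \<le> i" "i \<le> k + int j" for i
        unfolding c_def using mono[OF that] T
        by (intro nat_mono floor_mono divide_right_mono mult_right_mono) auto
      ultimately show ?case
        using grid_sum_le_pass[of "c m" k j b "T / real m"] by (simp add: c_def s0)
    qed
  qed
  finally show "ereal (\<Sum>i=k..k + int j. b i (s i) - b i (s (i - 1))) \<le>
      liminf (\<lambda>m. ereal (pass (\<lambda>_. 0) (path_incr_grid b k (T / real m)) j m))" .
qed

section \<open>The stationary system\<close>

lemma (in prob_space) indep_vars_reindex:
  assumes "indep_vars M' X I" "inj_on f J" "f ` J \<subseteq> I"
  shows "indep_vars (\<lambda>j. M' (f j)) (\<lambda>j. X (f j)) J"
proof -
  have "indep_vars (\<lambda>j. PiM {f j} M') (\<lambda>j \<omega>. restrict (\<lambda>i. X i \<omega>) {f j}) J"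
    by (rule indep_vars_restrict[OF assms(1)])
       (use assms in \<open>auto simp: disjoint_family_on_def inj_on_def\<close>)
  from indep_vars_compose2[OF this, of "\<lambda>j x. x (f j)" "\<lambda>j. M' (f j)"] show ?thesis
    by simp
qed

lemma (in prob_space) indep_var_nn_integral:
  assumes ind: "indep_var S X T Y" and u: "u \<in> borel_measurable S" and v: "v \<in> borel_measurable T"
  shows "(\<integral>\<^sup>+\<omega>. u (X \<omega>) * v (Y \<omega>) \<partial>M) = (\<integral>\<^sup>+\<omega>. u (X \<omega>) \<partial>M) * (\<integral>\<^sup>+\<omega>. v (Y \<omega>) \<partial>M :: ennreal)"
proof -
  have X: "X \<in> M \<rightarrow>\<^sub>M S" and Y: "Y \<in> M \<rightarrow>\<^sub>M T"
    and joint: "distr M S X \<Otimes>\<^sub>M distr M T Y = distr M (S \<Otimes>\<^sub>M T) (\<lambda>x. (X x, Y x))"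
    using ind unfolding indep_var_distribution_eq by auto
  interpret DY: prob_space "distr M T Y" by (rule prob_space_distr[OF Y])
  have m: "(\<lambda>z. u (fst z) * v (snd z)) \<in> borel_measurable (S \<Otimes>\<^sub>M T)"
    using u v by measurable
  have "(\<integral>\<^sup>+\<omega>. u (X \<omega>) * v (Y \<omega>) \<partial>M) = (\<integral>\<^sup>+z. u (fst z) * v (snd z) \<partial>distr M (S \<Otimes>\<^sub>M T) (\<lambda>x. (X x, Y x)))"
    by (subst nn_integral_distr) (use X Y m in auto)
  also have "\<dots> = (\<integral>\<^sup>+z. u (fst z) * v (snd z) \<partial>(distr M S X \<Otimes>\<^sub>M distr M T Y))"
    by (simp only: joint)
  also have "\<dots> = (\<integral>\<^sup>+x. \<integral>\<^sup>+y. u x * v y \<partial>distr M T Y \<partial>distr M S X)"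
    by (subst DY.nn_integral_fst[symmetric]) (use m in auto)
  also have "\<dots> = (\<integral>\<^sup>+x. u x * (\<integral>\<^sup>+y. v y \<partial>distr M T Y) \<partial>distr M S X)"
    by (intro nn_integral_cong nn_integral_cmult) (use v in simp)
  also have "\<dots> = (\<integral>\<^sup>+x. u x \<partial>distr M S X) * (\<integral>\<^sup>+y. v y \<partial>distr M T Y)"
    by (rule nn_integral_multc) (use u in simp)
  also have "\<dots> = (\<integral>\<^sup>+\<omega>. u (X \<omega>) \<partial>M) * (\<integral>\<^sup>+\<omega>. v (Y \<omega>) \<partial>M)"
    using X Y u v by (simp add: nn_integral_distr)
  finally show ?thesis .
qed

locale stationary_rbm = prob_space M
  for M :: "'a measure" +
  fixes B :: "int \<Rightarrow> real \<Rightarrow> 'a \<Rightarrow> real" and \<zeta> :: "int \<Rightarrow> 'a \<Rightarrow> real" and x0 :: "int \<Rightarrow> 'a \<Rightarrow> real"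
  assumes bm: "\<And>n. standard_brownian_motion M (B n)"
    and indep_B: "indep_vars (\<lambda>_. path_space) (\<lambda>n. trajectory (B n)) UNIV"
    and exp_\<zeta>: "\<And>n. distributed M lborel (\<zeta> n) (exponential_density 1)"
    and indep_\<zeta>: "indep_vars (\<lambda>_. borel) \<zeta> UNIV"
    and indep_\<zeta>_B: "indep_set
           (sets (vimage_algebra (space M) (\<lambda>\<omega> n. \<zeta> n \<omega>) (PiM UNIV (\<lambda>_. borel))))
           (sets (vimage_algebra (space M) (\<lambda>\<omega> n. trajectory (B n) \<omega>) (PiM UNIV (\<lambda>_. path_space))))"
    and x0_0: "\<And>\<omega>. \<omega> \<in> space M \<Longrightarrow> x0 0 \<omega> = 0"
    and x0_diff: "\<And>n \<omega>. \<omega> \<in> space M \<Longrightarrow> x0 n \<omega> - x0 (n - 1) \<omega> = \<zeta> n \<omega>"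
begin

lemma measurable_B: "0 \<le> t \<Longrightarrow> B n t \<in> borel_measurable M"
  using bm[of n] by (simp add: standard_brownian_motion_def)

lemma continuous_B: "\<omega> \<in> space M \<Longrightarrow> continuous_on {0..} (\<lambda>t. B n t \<omega>)"
  using bm[of n] by (simp add: standard_brownian_motion_def)

lemma measurable_\<zeta>: "\<zeta> n \<in> borel_measurable M"
  using exp_\<zeta>[of n] by (simp add: distributed_def measurable_lborel1)

lemma measurable_trajectory: "trajectory (B n) \<in> M \<rightarrow>\<^sub>M path_space"
proof -
  have "trajectory (B n) = (\<lambda>\<omega>. \<lambda>t\<in>{0..}. B n t \<omega>)" by (rule ext) (simp add: trajectory_def)
  then show ?thesis using measurable_B by (simp only:) (intro measurable_restrict, simp)
qed

abbreviation "gaps \<omega> \<equiv> (\<lambda>n. \<zeta> n \<omega>)"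
abbreviation "paths \<omega> \<equiv> (\<lambda>n. trajectory (B n) \<omega>)"

lemma measurable_gaps: "gaps \<in> M \<rightarrow>\<^sub>M PiM UNIV (\<lambda>_. borel)"
  by (rule measurable_PiM_single') (auto simp: measurable_\<zeta>)

lemma measurable_paths: "paths \<in> M \<rightarrow>\<^sub>M PiM UNIV (\<lambda>_. path_space)"
proof (rule measurable_PiM_single')
  show "(\<lambda>\<omega> n. trajectory (B n) \<omega>) \<in> space M \<rightarrow> (\<Pi>\<^sub>E i\<in>UNIV. space path_space)"
    using measurable_space[OF measurable_trajectory] by auto
qed (rule measurable_trajectory)

lemma prob_gaps_paths:
  assumes "SZ \<in> sets (PiM UNIV (\<lambda>_. borel))" "SB \<in> sets (PiM UNIV (\<lambda>_. path_space))"
  shows "prob ((gaps -` SZ \<inter> space M) \<inter> (paths -` SB \<inter> space M)) =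
    prob (gaps -` SZ \<inter> space M) * prob (paths -` SB \<inter> space M)"
  using indep_\<zeta>_B in_vimage_algebra[OF assms(1), of gaps "space M"] in_vimage_algebra[OF assms(2), of paths "space M"]
  unfolding indep_sets2_eq by blast

text \<open>Each of the two generated sigma-algebras lies in one of the vimage algebras whose
  independence is assumed.\<close>

lemma indep_var_gaps_paths:
  assumes u: "u \<in> borel_measurable (PiM UNIV (\<lambda>_. borel))" and v: "v \<in> borel_measurable (PiM UNIV (\<lambda>_. path_space))"
  shows "indep_var borel (\<lambda>\<omega>. u (gaps \<omega>) :: real) borel (\<lambda>\<omega>. v (paths \<omega>))"
  unfolding indep_var_eq
proof (intro conjI)
  show "(\<lambda>\<omega>. u (gaps \<omega>)) \<in> borel_measurable M" by (rule measurable_compose[OF measurable_gaps u])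
  show "(\<lambda>\<omega>. v (paths \<omega>)) \<in> borel_measurable M" by (rule measurable_compose[OF measurable_paths v])
  have 1: "sigma_sets (space M) {(\<lambda>\<omega>. u (gaps \<omega>)) -` A \<inter> space M |A. A \<in> sets borel} \<subseteq>
      sets (vimage_algebra (space M) gaps (PiM UNIV (\<lambda>_. borel)))"
    unfolding sets_vimage_algebra
  proof (rule sigma_sets_mono, rule subsetI)
    fix x assume "x \<in> {(\<lambda>\<omega>. u (gaps \<omega>)) -` A \<inter> space M |A. A \<in> sets borel}"
    then obtain A where A: "A \<in> sets borel" "x = (\<lambda>\<omega>. u (gaps \<omega>)) -` A \<inter> space M" by blast
    have "x = gaps -` (u -` A \<inter> space (PiM UNIV (\<lambda>_. borel))) \<inter> space M"
      using measurable_space[OF measurable_gaps] by (auto simp: A(2))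
    then show "x \<in> sigma_sets (space M) {gaps -` A \<inter> space M |A. A \<in> sets (PiM UNIV (\<lambda>_. borel))}"
      using measurable_sets[OF u A(1)] by (intro sigma_sets.Basic) blast
  qed
  have 2: "sigma_sets (space M) {(\<lambda>\<omega>. v (paths \<omega>)) -` A \<inter> space M |A. A \<in> sets borel} \<subseteq>
      sets (vimage_algebra (space M) paths (PiM UNIV (\<lambda>_. path_space)))"
    unfolding sets_vimage_algebra
  proof (rule sigma_sets_mono, rule subsetI)
    fix x assume "x \<in> {(\<lambda>\<omega>. v (paths \<omega>)) -` A \<inter> space M |A. A \<in> sets borel}"
    then obtain A where A: "A \<in> sets borel" "x = (\<lambda>\<omega>. v (paths \<omega>)) -` A \<inter> space M" by blast
    have "x = paths -` (v -` A \<inter> space (PiM UNIV (\<lambda>_. path_space))) \<inter> space M"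
      using measurable_space[OF measurable_paths] by (auto simp: A(2))
    then show "x \<in> sigma_sets (space M) {paths -` A \<inter> space M |A. A \<in> sets (PiM UNIV (\<lambda>_. path_space))}"
      using measurable_sets[OF v A(1)] by (intro sigma_sets.Basic) blast
  qed
  show "indep_set (sigma_sets (space M) {(\<lambda>\<omega>. u (gaps \<omega>)) -` A \<inter> space M |A. A \<in> sets borel})
      (sigma_sets (space M) {(\<lambda>\<omega>. v (paths \<omega>)) -` A \<inter> space M |A. A \<in> sets borel})"
    using indep_\<zeta>_B 1 2 unfolding indep_sets2_eq by blast
qed

lemma measurable_path_value: "0 \<le> t \<Longrightarrow> (\<lambda>p. p n t) \<in> borel_measurable (PiM UNIV (\<lambda>_::int. path_space))"
  by (rule measurable_compose[where f="\<lambda>p. p n" and g="\<lambda>p. p t" and N=path_space])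
     (auto intro!: measurable_component_singleton)

text \<open>The coordinates of the particle system from level k on, arranged as in
  \<open>cell_index\<close>. Brownian increments are exactly Gaussian, so the joint law is
  \<open>gauss_law\<close> at every mesh and not only in a limit.\<close>

definition W :: "int \<Rightarrow> real \<Rightarrow> nat \<times> nat \<Rightarrow> 'a \<Rightarrow> real" where
  "W k \<delta> c \<omega> = (case snd c of 0 \<Rightarrow> \<zeta> (k + int (fst c)) \<omega>
     | Suc j \<Rightarrow> (B (k + int (fst c)) (real (Suc j) * \<delta>) \<omega> - B (k + int (fst c)) (real j * \<delta>) \<omega>) / sqrt \<delta>)"

lemma measurable_W: "0 \<le> \<delta> \<Longrightarrow> W k \<delta> c \<in> borel_measurable M"
  unfolding W_def[abs_def]
  by (cases "snd c") (auto intro!: measurable_\<zeta> borel_measurable_divide borel_measurable_diff measurable_B)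

lemma distr_W:
  assumes "0 < \<delta>"
  shows "distr M borel (W k \<delta> c) = (if snd c = 0 then expo 1 else std_normal_distribution)"
proof (cases "snd c")
  case 0
  have "distr M lborel (\<zeta> n) = expo 1" for n
    using exp_\<zeta>[of n] by (simp add: distributed_def)
  moreover have "distr M lborel (\<zeta> n) = distr M borel (\<zeta> n)" for n
    by (rule distr_cong) auto
  moreover have "W k \<delta> c = \<zeta> (k + int (fst c))" by (rule ext) (simp add: W_def 0)
  ultimately show ?thesis using 0 by simp
next
  case (Suc j)
  let ?i = "k + int (fst c)"
  have lt: "0 \<le> real j * \<delta>" "real j * \<delta> < real (Suc j) * \<delta>" using assms by (auto intro: mult_strict_right_mono)
  have "real (Suc j) * \<delta> - real j * \<delta> = \<delta>" by (simp add: algebra_simps)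
  then have "distributed M lborel (\<lambda>\<omega>. B ?i (real (Suc j) * \<delta>) \<omega> - B ?i (real j * \<delta>) \<omega>) (normal_density 0 (sqrt \<delta>))"
    using bm[of ?i] lt unfolding standard_brownian_motion_def by metis
  then have "distributed M lborel (\<lambda>\<omega>. (B ?i (real (Suc j) * \<delta>) \<omega> - B ?i (real j * \<delta>) \<omega> - 0) / sqrt \<delta>) std_normal_density"
    using assms by (subst (asm) normal_standard_normal_convert) auto
  then have "distr M lborel (\<lambda>\<omega>. (B ?i (real (Suc j) * \<delta>) \<omega> - B ?i (real j * \<delta>) \<omega>) / sqrt \<delta>) = std_normal_distribution"
    by (simp add: distributed_def)
  moreover have "W k \<delta> c = (\<lambda>\<omega>. (B ?i (real (Suc j) * \<delta>) \<omega> - B ?i (real j * \<delta>) \<omega>) / sqrt \<delta>)"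
    by (rule ext) (simp add: W_def Suc)
  moreover have "distr M lborel (W k \<delta> c) = distr M borel (W k \<delta> c)"
    by (rule distr_cong) auto
  ultimately show ?thesis using Suc by simp
qed

text \<open>On a rectangle A the three sources of independence are used in turn: gaps against paths,
  level against level, and the increments of one path among themselves. The event U collects the
  conditions on a single path.\<close>

lemma indep_W:
  assumes \<delta>: "0 < \<delta>" and nm: "0 < n" "0 < m"
  shows "indep_vars (\<lambda>_. borel) (W k \<delta>) (cell_index n m)"
proof (subst indep_vars_finite[where E="\<lambda>_. sets borel"])
  show "cell_index n m \<noteq> {}" "finite (cell_index n m)" using nm by (auto simp: cell_index_def)
  show "sets borel = sigma_sets (space borel) (sets borel)" for i :: "nat \<times> nat"
    by (rule sets.sigma_sets_eq[symmetric])
  show "random_variable borel (W k \<delta> c)" for c using \<delta> by (simp add: measurable_W)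
  show "Int_stable (sets borel)" for i :: "nat \<times> nat" by (rule sets.Int_stable)
  show "space borel \<in> sets borel" "sets borel \<subseteq> Pow (space borel)" for i :: "nat \<times> nat"
    using sets.space_closed by auto
  show "\<forall>A\<in>cell_index n m \<rightarrow> sets borel. prob (\<Inter>c\<in>cell_index n m. W k \<delta> c -` A c \<inter> space M) =
      (\<Prod>c\<in>cell_index n m. prob (W k \<delta> c -` A c \<inter> space M))"
  proof
    fix A :: "nat \<times> nat \<Rightarrow> real set" assume "A \<in> cell_index n m \<rightarrow> sets borel"
    then have A: "A c \<in> sets borel" if "c \<in> cell_index n m" for c using that by blast
    have A0: "A (i, 0) \<in> sets borel" if "i < n" for i using A[of "(i, 0)"] that by (simp add: cell_index_def)
    have A1: "A (i, Suc j) \<in> sets borel" if "i < n" "j < m" for i j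
      using A[of "(i, Suc j)"] that by (simp add: cell_index_def)
    define SZ where "SZ = {f \<in> space (PiM UNIV (\<lambda>_::int. borel :: real measure)). \<forall>i\<in>{..<n}. f (k + int i) \<in> A (i, 0)}"
    define U where "U i = {p \<in> space path_space. \<forall>j\<in>{..<m}. (p (real (Suc j) * \<delta>) - p (real j * \<delta>)) / sqrt \<delta> \<in> A (i, Suc j)}" for i
    define SB where "SB = {f \<in> space (PiM UNIV (\<lambda>_::int. path_space)). \<forall>i\<in>{..<n}. f (k + int i) \<in> U i}"
    have SZ: "SZ \<in> sets (PiM UNIV (\<lambda>_. borel))"
      unfolding SZ_def
    proof (rule sets.sets_Collect_finite_All')
      fix i assume "i \<in> {..<n}"
      then show "{f \<in> space (PiM UNIV (\<lambda>_::int. borel :: real measure)). f (k + int i) \<in> A (i, 0)} \<in> sets (PiM UNIV (\<lambda>_. borel))"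
        using A0[of i] measurable_sets[OF measurable_component_singleton[of "k + int i" UNIV "\<lambda>_::int. borel :: real measure"], of "A (i, 0)"]
        by (simp add: vimage_def Int_def conj_commute)
    qed (use nm in auto)
    have U: "U i \<in> sets path_space" if i: "i < n" for i
      unfolding U_def
    proof (rule sets.sets_Collect_finite_All')
      fix j assume j: "j \<in> {..<m}"
      have "(\<lambda>p. (p (real (Suc j) * \<delta>) - p (real j * \<delta>)) / sqrt \<delta>) \<in> borel_measurable path_space"
        using \<delta> by (intro borel_measurable_divide borel_measurable_diff borel_measurable_const measurable_component_singleton) auto
      from measurable_sets[OF this A1[OF i, of j]] j
      show "{p \<in> space path_space. (p (real (Suc j) * \<delta>) - p (real j * \<delta>)) / sqrt \<delta> \<in> A (i, Suc j)} \<in> sets path_space"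
        by (simp add: vimage_def Int_def conj_commute)
    qed (use nm in auto)
    have SB: "SB \<in> sets (PiM UNIV (\<lambda>_. path_space))"
      unfolding SB_def
    proof (rule sets.sets_Collect_finite_All')
      fix i assume "i \<in> {..<n}"
      then have "U i \<in> sets path_space" using U by simp
      moreover have "(\<lambda>f. f (k + int i)) \<in> PiM UNIV (\<lambda>_::int. path_space) \<rightarrow>\<^sub>M path_space"
        by (rule measurable_component_singleton) simp
      ultimately show "{f \<in> space (PiM UNIV (\<lambda>_::int. path_space)). f (k + int i) \<in> U i} \<in> sets (PiM UNIV (\<lambda>_. path_space))"
        using measurable_sets[of "\<lambda>f. f (k + int i)" "PiM UNIV (\<lambda>_::int. path_space)" path_space "U i"]
        by (simp add: vimage_def Int_def conj_commute)
    qed (use nm in auto)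
    have split: "(\<Inter>c\<in>cell_index n m. W k \<delta> c -` A c \<inter> space M) = (gaps -` SZ \<inter> space M) \<inter> (paths -` SB \<inter> space M)"
    proof -
      have tr: "trajectory (B i) \<omega> \<in> space path_space" if "\<omega> \<in> space M" for i \<omega>
        using measurable_space[OF measurable_trajectory that] .
      have tv: "trajectory (B i) \<omega> t = B i t \<omega>" if "0 \<le> t" for i t \<omega>
        using that by (simp add: trajectory_def)
      \<comment> \<open>Separates the index 0, which carries the gap, from the time steps.\<close>
      have P: "(\<forall>j\<le>m. Q j) \<longleftrightarrow> Q 0 \<and> (\<forall>j<m. Q (Suc j))" for Q :: "nat \<Rightarrow> bool"
        by (metis Suc_le_eq le0 not0_implies_Suc)
      have "(\<omega> \<in> (\<Inter>c\<in>cell_index n m. W k \<delta> c -` A c \<inter> space M)) \<longleftrightarrow>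
          \<omega> \<in> space M \<and> (\<forall>i<n. \<forall>j\<le>m. W k \<delta> (i, j) \<omega> \<in> A (i, j))" for \<omega>
        using nm by (auto simp: cell_index_def)
      also have "\<dots> \<omega> \<longleftrightarrow> \<omega> \<in> (gaps -` SZ \<inter> space M) \<inter> (paths -` SB \<inter> space M)" for \<omega>
        unfolding P using tr[of \<omega>] \<delta> tv
        by (auto simp: SZ_def SB_def U_def space_PiM W_def)
      finally show ?thesis by blast
    qed
    have "prob (\<Inter>c\<in>cell_index n m. W k \<delta> c -` A c \<inter> space M) = prob (gaps -` SZ \<inter> space M) * prob (paths -` SB \<inter> space M)"
      unfolding split by (rule prob_gaps_paths[OF SZ SB])
    also have "prob (gaps -` SZ \<inter> space M) = (\<Prod>i<n. prob (W k \<delta> (i, 0) -` A (i, 0) \<inter> space M))"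
    proof -
      have "indep_vars (\<lambda>_. borel) (\<lambda>i. \<zeta> (k + int i)) {..<n}"
        using indep_vars_reindex[OF indep_\<zeta>, of "\<lambda>i. k + int i" "{..<n}"] by (simp add: inj_on_def)
      from indep_varsD_finite[OF this, of "\<lambda>i. A (i, 0)"] A0 nm
      have "prob (\<Inter>i<n. \<zeta> (k + int i) -` A (i, 0) \<inter> space M) = (\<Prod>i<n. prob (\<zeta> (k + int i) -` A (i, 0) \<inter> space M))"
        by auto
      moreover have "(\<Inter>i<n. \<zeta> (k + int i) -` A (i, 0) \<inter> space M) = gaps -` SZ \<inter> space M"
        using nm by (auto simp: SZ_def space_PiM)
      moreover have "W k \<delta> (i, 0) = \<zeta> (k + int i)" for i by (rule ext) (simp add: W_def)
      ultimately show ?thesis by simp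
    qed
    also have "prob (paths -` SB \<inter> space M) = (\<Prod>i<n. \<Prod>j<m. prob (W k \<delta> (i, Suc j) -` A (i, Suc j) \<inter> space M))"
    proof -
      have "indep_vars (\<lambda>_. path_space) (\<lambda>i. trajectory (B (k + int i))) {..<n}"
        using indep_vars_reindex[OF indep_B, of "\<lambda>i. k + int i" "{..<n}"] by (simp add: inj_on_def)
      from indep_varsD_finite[OF this, of U] U nm
      have "prob (\<Inter>i<n. trajectory (B (k + int i)) -` U i \<inter> space M) = (\<Prod>i<n. prob (trajectory (B (k + int i)) -` U i \<inter> space M))"
        by auto
      moreover have "(\<Inter>i<n. trajectory (B (k + int i)) -` U i \<inter> space M) = paths -` SB \<inter> space M"
        using nm measurable_space[OF measurable_trajectory] by (auto simp: SB_def space_PiM[of UNIV])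
      moreover have "prob (trajectory (B (k + int i)) -` U i \<inter> space M) = (\<Prod>j<m. prob (W k \<delta> (i, Suc j) -` A (i, Suc j) \<inter> space M))"
        if i: "i < n" for i
      proof -
        let ?\<tau> = "\<lambda>j::nat. real j * \<delta>"
        have \<tau>: "0 \<le> ?\<tau> 0" "mono ?\<tau>" using \<delta> by (simp, intro monoI mult_right_mono) auto
        have "\<forall>\<tau> :: nat \<Rightarrow> real. 0 \<le> \<tau> 0 \<longrightarrow> mono \<tau> \<longrightarrow>
            indep_vars (\<lambda>_. borel) (\<lambda>j \<omega>. B (k + int i) (\<tau> (Suc j)) \<omega> - B (k + int i) (\<tau> j) \<omega>) UNIV"
          using bm[of "k + int i"] unfolding standard_brownian_motion_def by blast
        from this[rule_format, OF \<tau>]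
        have "indep_vars (\<lambda>_. borel) (\<lambda>j \<omega>. B (k + int i) (?\<tau> (Suc j)) \<omega> - B (k + int i) (?\<tau> j) \<omega>) UNIV" .
        then have "indep_vars (\<lambda>_. borel) (\<lambda>j \<omega>. (B (k + int i) (?\<tau> (Suc j)) \<omega> - B (k + int i) (?\<tau> j) \<omega>) / sqrt \<delta>) UNIV"
          by (rule indep_vars_compose2) simp
        then have "indep_vars (\<lambda>_. borel) (\<lambda>j. W k \<delta> (i, Suc j)) UNIV"
          unfolding W_def[abs_def] by simp
        then have "indep_vars (\<lambda>_. borel) (\<lambda>j. W k \<delta> (i, Suc j)) {..<m}"
          by (rule indep_vars_subset) simp
        from indep_varsD_finite[OF this, of "\<lambda>j. A (i, Suc j)"] A1[OF i] nm
        have "prob (\<Inter>j<m. W k \<delta> (i, Suc j) -` A (i, Suc j) \<inter> space M) = (\<Prod>j<m. prob (W k \<delta> (i, Suc j) -` A (i, Suc j) \<inter> space M))"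
          by auto
        moreover have "(\<Inter>j<m. W k \<delta> (i, Suc j) -` A (i, Suc j) \<inter> space M) = trajectory (B (k + int i)) -` U i \<inter> space M"
          using nm \<delta> measurable_space[OF measurable_trajectory]
          by (auto simp: U_def W_def trajectory_def[of _ _])
        ultimately show ?thesis by simp
      qed
      ultimately show ?thesis by simp
    qed
    also have "(\<Prod>i<n. prob (W k \<delta> (i, 0) -` A (i, 0) \<inter> space M)) * (\<Prod>i<n. \<Prod>j<m. prob (W k \<delta> (i, Suc j) -` A (i, Suc j) \<inter> space M)) =
        (\<Prod>i<n. \<Prod>j\<le>m. prob (W k \<delta> (i, j) -` A (i, j) \<inter> space M))"
      by (simp only: prod.distrib[symmetric] prod.atMost_shift)
    also have "\<dots> = (\<Prod>c\<in>cell_index n m. prob (W k \<delta> c -` A c \<inter> space M))"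
      unfolding cell_index_def prod.cartesian_product by (rule prod.cong) auto
    finally show "prob (\<Inter>c\<in>cell_index n m. W k \<delta> c -` A c \<inter> space M) =
      (\<Prod>c\<in>cell_index n m. prob (W k \<delta> c -` A c \<inter> space M))" .
  qed
qed

abbreviation grid_incr :: "int \<Rightarrow> real \<Rightarrow> 'a \<Rightarrow> nat \<Rightarrow> nat \<Rightarrow> real" where
  "grid_incr k \<delta> \<omega> \<equiv> path_incr_grid (\<lambda>i s. B i s \<omega>) k \<delta>"

lemma distr_W_joint:
  assumes "0 < \<delta>" "0 < n" "0 < m"
  shows "distr M (PiM (cell_index n m) (\<lambda>_. borel)) (\<lambda>\<omega>. \<lambda>c\<in>cell_index n m. W k \<delta> c \<omega>) = gauss_law n m"
proof -
  have ne: "cell_index n m \<noteq> {}" using assms by (auto simp: cell_index_def)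
  have rv: "W k \<delta> c \<in> borel_measurable M" for c using assms by (simp add: measurable_W)
  have "distr M (PiM (cell_index n m) (\<lambda>_. borel)) (\<lambda>\<omega>. \<lambda>c\<in>cell_index n m. W k \<delta> c \<omega>) =
      PiM (cell_index n m) (\<lambda>c. distr M borel (W k \<delta> c))"
    by (rule iffD1[OF indep_vars_iff_distr_eq_PiM'[OF ne rv] indep_W[OF assms]])
  also have "\<dots> = gauss_law n m"
    unfolding gauss_law_def by (rule PiM_cong) (simp_all add: distr_W assms(1))
  finally show ?thesis .
qed

lemma measurable_W_joint:
  "0 < \<delta> \<Longrightarrow> (\<lambda>\<omega>. \<lambda>c\<in>cell_index n m. W k \<delta> c \<omega>) \<in> M \<rightarrow>\<^sub>M PiM (cell_index n m) (\<lambda>_. borel)"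
  by (intro measurable_restrict measurable_W) simp

lemma incr_W:
  assumes "0 < T" "0 < m" "i \<le> n" "j < m"
  shows "incr T m (\<lambda>c\<in>cell_index (Suc n) m. W k (T / real m) c \<omega>) i j = grid_incr k (T / real m) \<omega> i j"
  using assms by (simp add: incr_def W_def cell_index_def)

text \<open>The grid increments have the law \<open>gauss_law\<close> at every mesh, so the bound is
  uniform in m and survives the passage to continuous time.\<close>

lemma mgf_grid:
  assumes T: "0 < T" and m: "0 < m" and nu: "0 < \<nu>" "\<nu> \<le> la"
  shows "(\<integral>\<^sup>+\<omega>. ennreal (exp ((la - \<nu>) * pass (\<lambda>_. 0) (grid_incr k (T / real m) \<omega>) n m)) \<partial>M)
    \<le> ennreal (mgf_lim T (Suc n) \<nu> la)"
proof -
  let ?C = "cell_index (Suc n) m"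
  let ?F = "\<lambda>x. ennreal (exp ((la - \<nu>) * pass (\<lambda>_. 0) (incr T m x) n m))"
  have \<delta>: "0 < T / real m" using T m by simp
  have F: "?F \<in> borel_measurable (PiM ?C (\<lambda>_. borel))"
    using measurable_pass_incr[of T m n] by measurable
  have "pass (\<lambda>_. 0) (grid_incr k (T / real m) \<omega>) n m =
      pass (\<lambda>_. 0) (incr T m (\<lambda>c\<in>?C. W k (T / real m) c \<omega>)) n m" for \<omega>
    using incr_W[OF T m] by (intro rpass_cong) auto
  then have "(\<integral>\<^sup>+\<omega>. ennreal (exp ((la - \<nu>) * pass (\<lambda>_. 0) (grid_incr k (T / real m) \<omega>) n m)) \<partial>M) =
      (\<integral>\<^sup>+\<omega>. ?F (\<lambda>c\<in>?C. W k (T / real m) c \<omega>) \<partial>M)" by simp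
  also have "\<dots> = (\<integral>\<^sup>+x. ?F x \<partial>gauss_law (Suc n) m)"
    unfolding distr_W_joint[OF \<delta> zero_less_Suc m, of n k, symmetric]
    by (rule nn_integral_distr[OF measurable_W_joint[OF \<delta>], symmetric]) (use F in simp)
  also have "\<dots> \<le> ennreal (mgf_lim T (Suc n) \<nu> la)"
    by (rule gauss_mgf_bound[OF T m nu])
  finally show ?thesis .
qed

section \<open>Starting positions, measurability and tail bounds\<close>

lemma x0_nonneg: "\<omega> \<in> space M \<Longrightarrow> x0 (int a) \<omega> = (\<Sum>i<a. \<zeta> (1 + int i) \<omega>)"
proof (induction a)
  case (Suc a)
  then show ?case using x0_diff[of \<omega> "int (Suc a)"] by (simp add: algebra_simps)
qed (simp add: x0_0)

lemma x0_nonpos: "\<omega> \<in> space M \<Longrightarrow> x0 (- int a) \<omega> = - (\<Sum>i<a. \<zeta> (- int i) \<omega>)"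
proof (induction a)
  case (Suc a)
  have "x0 (- int (Suc a)) \<omega> = x0 (- int a - 1) \<omega>" by (rule arg_cong[of _ _ "\<lambda>k. x0 k \<omega>"]) simp
  then show ?case using x0_diff[of \<omega> "- int a"] Suc by (simp del: of_nat_Suc)
qed (simp add: x0_0)

lemma measurable_x0: "x0 k \<in> borel_measurable M"
proof -
  have "(\<lambda>\<omega>. \<Sum>i<nat k. \<zeta> (1 + int i) \<omega>) \<in> borel_measurable M" "(\<lambda>\<omega>. - (\<Sum>i<nat (- k). \<zeta> (- int i) \<omega>)) \<in> borel_measurable M"
    by (intro borel_measurable_sum borel_measurable_uminus measurable_\<zeta>)+
  moreover have "x0 k \<omega> = (if 0 \<le> k then (\<Sum>i<nat k. \<zeta> (1 + int i) \<omega>) else - (\<Sum>i<nat (- k). \<zeta> (- int i) \<omega>))"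
    if "\<omega> \<in> space M" for \<omega>
    using x0_nonneg[OF that, of "nat k"] x0_nonpos[OF that, of "nat (- k)"] by auto
  ultimately show ?thesis
    by (cases "0 \<le> k") (auto cong: measurable_cong)
qed

text \<open>With base level 1 every starting position is a sum of gaps, as \<open>start\<close>
  requires. Leaving out the levels up to 0 can only lower the system, which is harmless for a lower
  bound.\<close>

lemma prob_grid:
  assumes T: "0 < T" and m: "0 < m"
  shows "prob {\<omega> \<in> space M. y \<le> pass (\<lambda>i. x0 (1 + int i) \<omega>) (grid_incr 1 (T / real m) \<omega>) n m} =
    measure (gauss_law (Suc n) m) {x \<in> space (gauss_law (Suc n) m). y \<le> pass (start x) (incr T m x) n m}"
proof -
  let ?C = "cell_index (Suc n) m"
  let ?P = "PiM ?C (\<lambda>_. borel :: real measure)"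
  let ?w = "\<lambda>\<omega>. \<lambda>c\<in>?C. W 1 (T / real m) c \<omega>"
  let ?A = "{x \<in> space ?P. y \<le> pass (start x) (incr T m x) n m}"
  have \<delta>: "0 < T / real m" using T m by simp
  have A: "?A \<in> sets ?P"
    using measurable_pass_start[of T m n] by measurable
  have eq: "pass (\<lambda>i. x0 (1 + int i) \<omega>) (grid_incr 1 (T / real m) \<omega>) n m = pass (start (?w \<omega>)) (incr T m (?w \<omega>)) n m"
    if \<omega>: "\<omega> \<in> space M" for \<omega>
  proof (rule rpass_cong)
    fix i assume i: "i \<le> n"
    have "start (?w \<omega>) i = (\<Sum>k<Suc i. \<zeta> (1 + int k) \<omega>)"
      unfolding start_def by (intro sum.cong) (use i in \<open>auto simp: cell_index_def W_def\<close>)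
    then show "x0 (1 + int i) \<omega> = start (?w \<omega>) i"
      using x0_nonneg[OF \<omega>, of "Suc i"] by simp
  qed (use incr_W[OF T m] in auto)
  have sp: "space (gauss_law (Suc n) m) = space ?P"
    unfolding distr_W_joint[OF \<delta> zero_less_Suc m, of n 1, symmetric] by simp
  have "measure (gauss_law (Suc n) m) ?A = measure M (?w -` ?A \<inter> space M)"
    unfolding distr_W_joint[OF \<delta> zero_less_Suc m, of n 1, symmetric]
    by (rule measure_distr[OF measurable_W_joint[OF \<delta>] A])
  also have "?w -` ?A \<inter> space M = {\<omega> \<in> space M. y \<le> pass (\<lambda>i. x0 (1 + int i) \<omega>) (grid_incr 1 (T / real m) \<omega>) n m}"
  proof -
    have "?w \<omega> \<in> space ?P" if "\<omega> \<in> space M" for \<omega>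
      by (rule measurable_space[OF measurable_W_joint[OF \<delta>] that])
    then show ?thesis using eq by auto
  qed
  finally show ?thesis unfolding sp by simp
qed

lemma mgf_\<zeta>:
  assumes "c < 1"
  shows "(\<integral>\<^sup>+\<omega>. ennreal (exp (c * \<zeta> n \<omega>)) \<partial>M) = ennreal (1 / (1 - c))"
proof -
  have "distr M lborel (\<zeta> n) = expo 1"
    using exp_\<zeta>[of n] by (simp add: distributed_def)
  moreover have "(\<integral>\<^sup>+\<omega>. ennreal (exp (c * \<zeta> n \<omega>)) \<partial>M) = (\<integral>\<^sup>+x. ennreal (exp (c * x)) \<partial>distr M lborel (\<zeta> n))"
    by (rule nn_integral_distr[symmetric]) (auto simp: measurable_\<zeta> measurable_lborel1)
  ultimately show ?thesis using nn_integral_expo_exp[of 1 c] assms by simp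
qed

lemma mgf_\<zeta>_sum:
  assumes c: "c < 1" and f: "inj_on f {..<a}"
  shows "(\<integral>\<^sup>+\<omega>. ennreal (exp (c * (\<Sum>i<a. \<zeta> (f i) \<omega>))) \<partial>M) = ennreal ((1 / (1 - c)) ^ a)"
proof -
  have "indep_vars (\<lambda>_. borel) (\<lambda>i. \<zeta> (f i)) {..<a}"
    using indep_vars_reindex[OF indep_\<zeta> f] by simp
  then have ind: "indep_vars (\<lambda>_. borel) (\<lambda>i \<omega>. ennreal (exp (c * \<zeta> (f i) \<omega>))) {..<a}"
    by (rule indep_vars_compose2) measurable
  have "ennreal (exp (c * (\<Sum>i<a. \<zeta> (f i) \<omega>))) = (\<Prod>i<a. ennreal (exp (c * \<zeta> (f i) \<omega>)))" for \<omega>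
    by (simp add: sum_distrib_left exp_sum prod_ennreal)
  then have "(\<integral>\<^sup>+\<omega>. ennreal (exp (c * (\<Sum>i<a. \<zeta> (f i) \<omega>))) \<partial>M) = (\<Prod>i<a. \<integral>\<^sup>+\<omega>. ennreal (exp (c * \<zeta> (f i) \<omega>)) \<partial>M)"
    using indep_vars_nn_integral[OF _ ind] by simp
  also have "\<dots> = ennreal ((1 / (1 - c)) ^ a)"
    using c by (simp add: mgf_\<zeta> ennreal_power)
  finally show ?thesis .
qed

text \<open>Gaps and paths are independent, so the expectation factorises. The sign sg is 1 for
  starting levels a and -1 for starting levels - a, whose positions are minus a sum of gaps.\<close>

lemma mgf_term:
  assumes T: "0 < T" and m: "0 < m" and nu: "0 < \<nu>" "\<nu> \<le> la"
    and x: "\<And>\<omega>. \<omega> \<in> space M \<Longrightarrow> x0 k \<omega> = sg * (\<Sum>i<a. \<zeta> (f i) \<omega>)"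
    and f: "inj_on f {..<a}" and sg: "(la - \<nu>) * sg < 1"
  shows "(\<integral>\<^sup>+\<omega>. ennreal (exp ((la - \<nu>) * (x0 k \<omega> + pass (\<lambda>_. 0) (grid_incr k (T / real m) \<omega>) n m))) \<partial>M)
    \<le> ennreal ((1 / (1 - (la - \<nu>) * sg)) ^ a * mgf_lim T (Suc n) \<nu> la)"
proof -
  let ?\<theta> = "la - \<nu>"
  define u where "u g = sg * (\<Sum>i<a. g (f i))" for g :: "int \<Rightarrow> real"
  define v where "v p = pass (\<lambda>_. 0) (path_incr_grid p k (T / real m)) n m" for p :: "int \<Rightarrow> real \<Rightarrow> real"
  have u: "u \<in> borel_measurable (PiM UNIV (\<lambda>_. borel))"
    unfolding u_def[abs_def]
    by (intro borel_measurable_times borel_measurable_const borel_measurable_sum measurable_component_singleton) simp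
  have v: "v \<in> borel_measurable (PiM UNIV (\<lambda>_. path_space))"
    unfolding v_def[abs_def] using T m
    by (intro measurable_rpass borel_measurable_const borel_measurable_diff measurable_path_value) auto
  have ve: "v (paths \<omega>) = pass (\<lambda>_. 0) (grid_incr k (T / real m) \<omega>) n m" for \<omega>
    unfolding v_def by (rule rpass_cong) (use T m in \<open>auto simp: trajectory_def\<close>)
  have E: "(\<lambda>x. ennreal (exp (?\<theta> * x))) \<in> borel_measurable borel" by measurable
  have "(\<integral>\<^sup>+\<omega>. ennreal (exp (?\<theta> * (x0 k \<omega> + pass (\<lambda>_. 0) (grid_incr k (T / real m) \<omega>) n m))) \<partial>M) =
      (\<integral>\<^sup>+\<omega>. ennreal (exp (?\<theta> * u (gaps \<omega>))) * ennreal (exp (?\<theta> * v (paths \<omega>))) \<partial>M)"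
    by (intro nn_integral_cong) (simp add: ve u_def x distrib_left exp_add ennreal_mult)
  also have "\<dots> = (\<integral>\<^sup>+\<omega>. ennreal (exp (?\<theta> * u (gaps \<omega>))) \<partial>M) * (\<integral>\<^sup>+\<omega>. ennreal (exp (?\<theta> * v (paths \<omega>))) \<partial>M)"
    by (rule indep_var_nn_integral[OF indep_var_gaps_paths[OF u v] E E])
  also have "(\<integral>\<^sup>+\<omega>. ennreal (exp (?\<theta> * u (gaps \<omega>))) \<partial>M) = ennreal ((1 / (1 - ?\<theta> * sg)) ^ a)"
    unfolding u_def mult.assoc[symmetric] by (rule mgf_\<zeta>_sum[OF sg f])
  also have "ennreal ((1 / (1 - ?\<theta> * sg)) ^ a) * (\<integral>\<^sup>+\<omega>. ennreal (exp (?\<theta> * v (paths \<omega>))) \<partial>M) \<le>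
      ennreal ((1 / (1 - ?\<theta> * sg)) ^ a) * ennreal (mgf_lim T (Suc n) \<nu> la)"
    unfolding ve by (intro mult_left_mono mgf_grid[OF T m nu]) simp
  also have "\<dots> = ennreal ((1 / (1 - ?\<theta> * sg)) ^ a * mgf_lim T (Suc n) \<nu> la)"
    using sg nu by (subst ennreal_mult) (auto simp: mgf_lim_def)
  finally show ?thesis .
qed

text \<open>Grid passages lie below the continuous one and recover it in the limit. The passage time
  is a supremum over uncountably many jump sequences; this representation makes it
  measurable.\<close>

lemma last_passage_eq_liminf:
  assumes "0 < T" "\<omega> \<in> space M"
  shows "last_passage (\<lambda>n s. B n s \<omega>) k (k + int j) T =
    liminf (\<lambda>m. ereal (pass (\<lambda>_. 0) (grid_incr k (T / real m) \<omega>) j m))"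
proof (rule antisym)
  show "last_passage (\<lambda>n s. B n s \<omega>) k (k + int j) T \<le>
      liminf (\<lambda>m. ereal (pass (\<lambda>_. 0) (grid_incr k (T / real m) \<omega>) j m))"
    by (rule last_passage_le_liminf) (use assms continuous_B in auto)
  have "liminf (\<lambda>m. ereal (pass (\<lambda>_. 0) (grid_incr k (T / real m) \<omega>) j m)) \<le>
      liminf (\<lambda>m::nat. last_passage (\<lambda>n s. B n s \<omega>) k (k + int j) T)"
  proof (rule Liminf_mono)
    show "\<forall>\<^sub>F m in sequentially. ereal (pass (\<lambda>_. 0) (grid_incr k (T / real m) \<omega>) j m) \<le>
        last_passage (\<lambda>n s. B n s \<omega>) k (k + int j) T"
      using eventually_gt_at_top[of 0]
    proof eventually_elim
      case (elim m)
      then show ?case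
        using pass_le_last_passage[of "T / real m" "\<lambda>n s. B n s \<omega>" k j m] assms by simp
    qed
  qed
  then show "liminf (\<lambda>m. ereal (pass (\<lambda>_. 0) (grid_incr k (T / real m) \<omega>) j m)) \<le>
      last_passage (\<lambda>n s. B n s \<omega>) k (k + int j) T"
    by (simp add: Liminf_const)
qed

lemma measurable_grid_pass:
  "0 \<le> \<delta> \<Longrightarrow> (\<lambda>\<omega>. pass (\<lambda>_. 0) (grid_incr k \<delta> \<omega>) j m) \<in> borel_measurable M"
  by (intro measurable_rpass borel_measurable_const borel_measurable_diff measurable_B) auto

lemma measurable_last_passage:
  assumes T: "0 < T"
  shows "(\<lambda>\<omega>. last_passage (\<lambda>n s. B n s \<omega>) k (k + int j) T) \<in> borel_measurable M"
proof -
  have "(\<lambda>\<omega>. liminf (\<lambda>m. ereal (pass (\<lambda>_. 0) (grid_incr k (T / real m) \<omega>) j m))) \<in> borel_measurable M"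
    using T by (intro borel_measurable_liminf borel_measurable_ereal measurable_grid_pass) simp
  then show ?thesis
    by (rule measurable_cong[THEN iffD2, rotated]) (rule last_passage_eq_liminf[OF T])
qed

lemma measurable_reflected_system:
  assumes T: "0 < T"
  shows "(\<lambda>\<omega>. reflected_system (\<lambda>n. x0 n \<omega>) (\<lambda>n s. B n s \<omega>) n T) \<in> borel_measurable M"
  unfolding reflected_system_def
proof (rule borel_measurable_SUP)
  fix k assume "k \<in> {..n}"
  then obtain j where "n = k + int j" by (metis atMost_iff zle_iff_zadd)
  then show "(\<lambda>\<omega>. ereal (x0 k \<omega>) + last_passage (\<lambda>n s. B n s \<omega>) k n T) \<in> borel_measurable M"
    using measurable_last_passage[OF T, of k j] measurable_x0[of k] by (auto intro: borel_measurable_ereal_add)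
qed (rule countableI_type)

text \<open>Markov's inequality on the grid, followed by Fatou. The strict inequality in the event
  carries over from the lower limit to all large m, where the exponential then dominates the
  indicator.\<close>

lemma tail_term:
  assumes T: "0 < T" and \<theta>: "0 < \<theta>" and K: "0 \<le> K"
    and mgf: "\<And>m. 0 < m \<Longrightarrow> (\<integral>\<^sup>+\<omega>. ennreal (exp (\<theta> * (x0 k \<omega> + pass (\<lambda>_. 0) (grid_incr k (T / real m) \<omega>) j m))) \<partial>M) \<le> ennreal K"
  shows "emeasure M {\<omega> \<in> space M. ereal c < ereal (x0 k \<omega>) + last_passage (\<lambda>n s. B n s \<omega>) k (k + int j) T} \<le> ennreal (exp (- \<theta> * c) * K)"
proof -
  let ?p = "\<lambda>m \<omega>. pass (\<lambda>_. 0) (grid_incr k (T / real m) \<omega>) j m"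
  let ?A = "{\<omega> \<in> space M. ereal c < ereal (x0 k \<omega>) + last_passage (\<lambda>n s. B n s \<omega>) k (k + int j) T}"
  let ?f = "\<lambda>m \<omega>. ennreal (exp (\<theta> * (x0 k \<omega> + ?p m \<omega>)))"
  have mp: "?p m \<in> borel_measurable M" for m using T by (intro measurable_grid_pass) simp
  have mf: "?f m \<in> borel_measurable M" for m
    using measurable_x0[of k] mp[of m] by measurable
  have "?A \<in> sets M"
    using measurable_x0[of k] measurable_last_passage[OF T, of k j] by measurable
  then have "emeasure M ?A = (\<integral>\<^sup>+\<omega>. indicator ?A \<omega> \<partial>M)" by simp
  also have "\<dots> \<le> (\<integral>\<^sup>+\<omega>. liminf (\<lambda>m. ennreal (exp (- \<theta> * c)) * ?f m \<omega>) \<partial>M)"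
  proof (rule nn_integral_mono)
    fix \<omega> assume \<omega>: "\<omega> \<in> space M"
    show "indicator ?A \<omega> \<le> liminf (\<lambda>m. ennreal (exp (- \<theta> * c)) * ?f m \<omega>)"
    proof (cases "\<omega> \<in> ?A")
      case True
      then have "ereal c < ereal (x0 k \<omega>) + liminf (\<lambda>m. ereal (?p m \<omega>))"
        using last_passage_eq_liminf[OF T \<omega>] by simp
      then have "ereal (c - x0 k \<omega>) < liminf (\<lambda>m. ereal (?p m \<omega>))"
        by (cases "liminf (\<lambda>m. ereal (?p m \<omega>))") auto
      then have "\<forall>\<^sub>F m in sequentially. ereal (c - x0 k \<omega>) < ereal (?p m \<omega>)"
        by (rule less_LiminfD)
      then have "\<forall>\<^sub>F m in sequentially. 1 \<le> ennreal (exp (- \<theta> * c)) * ?f m \<omega>"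
      proof eventually_elim
        case (elim m)
        then have "\<theta> * c \<le> \<theta> * (x0 k \<omega> + ?p m \<omega>)" using \<theta> by (intro mult_left_mono) auto
        then have "1 \<le> exp (- \<theta> * c) * exp (\<theta> * (x0 k \<omega> + ?p m \<omega>))"
          unfolding exp_add[symmetric] by simp
        then show ?case by (simp add: ennreal_mult[symmetric])
      qed
      then have "1 \<le> liminf (\<lambda>m. ennreal (exp (- \<theta> * c)) * ?f m \<omega>)" by (rule Liminf_bounded)
      then show ?thesis using True by (simp add: indicator_def)
    qed simp
  qed
  also have "\<dots> \<le> liminf (\<lambda>m. \<integral>\<^sup>+\<omega>. ennreal (exp (- \<theta> * c)) * ?f m \<omega> \<partial>M)"
    by (rule nn_integral_liminf) (use mf in measurable)
  also have "\<dots> \<le> liminf (\<lambda>m::nat. ennreal (exp (- \<theta> * c) * K))"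
  proof (rule Liminf_mono)
    show "\<forall>\<^sub>F m in sequentially. (\<integral>\<^sup>+\<omega>. ennreal (exp (- \<theta> * c)) * ?f m \<omega> \<partial>M) \<le> ennreal (exp (- \<theta> * c) * K)"
      using eventually_gt_at_top[of 0]
    proof eventually_elim
      case (elim m)
      have "(\<integral>\<^sup>+\<omega>. ennreal (exp (- \<theta> * c)) * ?f m \<omega> \<partial>M) = ennreal (exp (- \<theta> * c)) * (\<integral>\<^sup>+\<omega>. ?f m \<omega> \<partial>M)"
        by (rule nn_integral_cmult[OF mf])
      also have "\<dots> \<le> ennreal (exp (- \<theta> * c)) * ennreal K" by (intro mult_left_mono mgf elim) simp
      also have "\<dots> = ennreal (exp (- \<theta> * c) * K)" using K by (simp add: ennreal_mult)
      finally show ?case .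
    qed
  qed
  also have "\<dots> = ennreal (exp (- \<theta> * c) * K)" by (simp add: Liminf_const)
  finally show ?thesis .
qed

abbreviation X :: "nat \<Rightarrow> 'a \<Rightarrow> ereal" where
  "X t \<omega> \<equiv> reflected_system (\<lambda>n. x0 n \<omega>) (\<lambda>n s. B n s \<omega>) (int t) (real t)"

text \<open>For k = a the gaps contribute (1 / (1 - \<theta>)) ^ a and the t - a + 1 levels the
  complementary power, so all t + 1 nonnegative starting levels share one bound. For k = - a the
  powers combine to \<rho> ^ a with \<rho> = (\<nu> + \<theta>) / (\<nu> (1 + \<theta>)), which is
  below 1 precisely for \<nu> > 1; the infinite union is then bounded by a geometric series.\<close>

theorem upper_tail:
  assumes t: "0 < t" and \<theta>: "0 < \<theta>" "\<theta> < 1" and nu: "1 < \<nu>"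
  shows "prob {\<omega> \<in> space M. ereal c \<le> X t \<omega>} \<le> exp (- \<theta> * (c - 1)) *
     (real (Suc t) / (1 - \<theta>) * mgf_lim (real t) t (1 - \<theta>) 1 +
      (\<nu> + \<theta>) / \<nu> / (1 - (\<nu> + \<theta>) / \<nu> / (1 + \<theta>)) * mgf_lim (real t) t \<nu> (\<nu> + \<theta>))"
proof -
  have T: "0 < real t" using t by simp
  \<comment> \<open>A supremum that is at least c need not have a term that large, but it has one
    above c - 1. The loss is the constant factor exp \<theta>.\<close>
  define A where "A k = {\<omega> \<in> space M. ereal (c - 1) < ereal (x0 k \<omega>) + last_passage (\<lambda>n s. B n s \<omega>) k (int t) (real t)}" for k
  define u where "u = exp (- \<theta> * (c - 1))"
  define \<rho> where "\<rho> = (\<nu> + \<theta>) / \<nu> / (1 + \<theta>)"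
  have \<rho>: "0 < \<rho>" "\<rho> < 1"
  proof -
    have "\<nu> + \<theta> < \<nu> * (1 + \<theta>)" using nu \<theta> by (simp add: algebra_simps)
    then show "0 < \<rho>" "\<rho> < 1" using nu \<theta> by (auto simp: \<rho>_def divide_less_eq mult.commute intro!: divide_pos_pos)
  qed
  define R1 where "R1 = mgf_lim (real t) t (1 - \<theta>) 1"
  define R2 where "R2 = mgf_lim (real t) t \<nu> (\<nu> + \<theta>)"
  have R0: "0 \<le> R1" "0 \<le> R2" using \<theta> nu by (auto simp: R1_def R2_def mgf_lim_def)
  have A_meas: "A k \<in> events" if k: "k \<le> int t" for k
  proof -
    obtain j where j: "int t = k + int j" using k zle_iff_zadd by blast
    show ?thesis
      unfolding A_def j using measurable_x0[of k] measurable_last_passage[OF T, of k j] by measurable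
  qed
  have pos: "emeasure M (A (int a)) \<le> ennreal (u * (R1 / (1 - \<theta>)))" if a: "a \<le> t" for a
  proof -
    let ?K = "(1 / (1 - \<theta>)) ^ a * mgf_lim (real t) (Suc (t - a)) (1 - \<theta>) 1"
    have j: "int t = int a + int (t - a)" using a by simp
    have "emeasure M (A (int a)) \<le> ennreal (exp (- \<theta> * (c - 1)) * ?K)"
      unfolding A_def j
    proof (rule tail_term[OF T \<theta>(1)])
      show "0 \<le> ?K" using \<theta> by (simp add: mgf_lim_def)
      fix m :: nat assume m: "0 < m"
      have "(\<integral>\<^sup>+\<omega>. ennreal (exp ((1 - (1 - \<theta>)) * (x0 (int a) \<omega> + pass (\<lambda>_. 0) (grid_incr (int a) (real t / real m) \<omega>) (t - a) m))) \<partial>M)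
          \<le> ennreal ((1 / (1 - (1 - (1 - \<theta>)) * 1)) ^ a * mgf_lim (real t) (Suc (t - a)) (1 - \<theta>) 1)"
        by (rule mgf_term[OF T m, where f="\<lambda>i. 1 + int i"]) (use \<theta> x0_nonneg in \<open>auto simp: inj_on_def\<close>)
      then show "(\<integral>\<^sup>+\<omega>. ennreal (exp (\<theta> * (x0 (int a) \<omega> + pass (\<lambda>_. 0) (grid_incr (int a) (real t / real m) \<omega>) (t - a) m))) \<partial>M) \<le> ennreal ?K"
        by simp
    qed
    also have "?K = R1 / (1 - \<theta>)"
    proof -
      have "(1 / (1 - \<theta>)) ^ a * (1 / (1 - \<theta>)) ^ Suc (t - a) = (1 / (1 - \<theta>)) ^ t * (1 / (1 - \<theta>))"
        using a by (simp only: power_add[symmetric] power_Suc2[symmetric]) (simp add: Suc_diff_le[symmetric])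
      then show ?thesis by (simp add: R1_def mgf_lim_def mult_ac) 
    qed
    finally show ?thesis by (simp add: u_def)
  qed
  have neg: "emeasure M (A (- int a)) \<le> ennreal (u * (R2 * ((\<nu> + \<theta>) / \<nu>)) * \<rho> ^ a)" for a
  proof -
    let ?K = "(1 / (1 + \<theta>)) ^ a * mgf_lim (real t) (Suc (t + a)) \<nu> (\<nu> + \<theta>)"
    have j: "int t = - int a + int (t + a)" by simp
    have "emeasure M (A (- int a)) \<le> ennreal (exp (- \<theta> * (c - 1)) * ?K)"
      unfolding A_def j
    proof (rule tail_term[OF T \<theta>(1)])
      show "0 \<le> ?K" using \<theta> nu by (simp add: mgf_lim_def)
      fix m :: nat assume m: "0 < m"
      have "(\<integral>\<^sup>+\<omega>. ennreal (exp ((\<nu> + \<theta> - \<nu>) * (x0 (- int a) \<omega> + pass (\<lambda>_. 0) (grid_incr (- int a) (real t / real m) \<omega>) (t + a) m))) \<partial>M)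
          \<le> ennreal ((1 / (1 - (\<nu> + \<theta> - \<nu>) * (- 1))) ^ a * mgf_lim (real t) (Suc (t + a)) \<nu> (\<nu> + \<theta>))"
        by (rule mgf_term[OF T m, where f="\<lambda>i. - int i"]) (use \<theta> nu x0_nonpos in \<open>auto simp: inj_on_def\<close>)
      then show "(\<integral>\<^sup>+\<omega>. ennreal (exp (\<theta> * (x0 (- int a) \<omega> + pass (\<lambda>_. 0) (grid_incr (- int a) (real t / real m) \<omega>) (t + a) m))) \<partial>M) \<le> ennreal ?K"
        by simp
    qed
    also have "?K = R2 * ((\<nu> + \<theta>) / \<nu>) * \<rho> ^ a"
      by (simp add: R2_def mgf_lim_def \<rho>_def power_add power_divide power_mult_distrib mult_ac)
    finally show ?thesis by (simp add: u_def mult.assoc)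
  qed
  have sub: "{\<omega> \<in> space M. ereal c \<le> X t \<omega>} \<subseteq> (\<Union>a\<in>{..t}. A (int a)) \<union> (\<Union>a. A (- int a))"
  proof
    fix \<omega> assume \<omega>: "\<omega> \<in> {\<omega> \<in> space M. ereal c \<le> X t \<omega>}"
    have "ereal (c - 1) < ereal c" by simp
    also have "\<dots> \<le> X t \<omega>" using \<omega> by simp
    finally obtain k where k: "k \<le> int t" "ereal (c - 1) < ereal (x0 k \<omega>) + last_passage (\<lambda>n s. B n s \<omega>) k (int t) (real t)"
      unfolding reflected_system_def less_SUP_iff by auto
    then have Ak: "\<omega> \<in> A k" using \<omega> by (simp add: A_def)
    show "\<omega> \<in> (\<Union>a\<in>{..t}. A (int a)) \<union> (\<Union>a. A (- int a))"
    proof (cases "0 \<le> k")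
      case True
      then have "k = int (nat k)" "nat k \<le> t" using k by auto
      with Ak show ?thesis by (metis UN_I UnI1 atMost_iff)
    next
      case False
      then have "k = - int (nat (- k))" by simp
      with Ak show ?thesis by (metis UN_I UnI2 UNIV_I)
    qed
  qed
  have m1: "(\<Union>a\<in>{..t}. A (int a)) \<in> events"
    by (intro sets.finite_UN) (auto intro!: A_meas)
  have m2: "(\<Union>a. A (- int a)) \<in> events"
    by (intro sets.countable_UN) (auto intro!: A_meas)
  have "emeasure M {\<omega> \<in> space M. ereal c \<le> X t \<omega>} \<le> emeasure M (\<Union>a\<in>{..t}. A (int a)) + emeasure M (\<Union>a. A (- int a))"
    by (rule order_trans[OF emeasure_mono[OF sub sets.Un[OF m1 m2]] emeasure_subadditive[OF m1 m2]])
  also have "emeasure M (\<Union>a\<in>{..t}. A (int a)) \<le> (\<Sum>a\<le>t. emeasure M (A (int a)))"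
    by (rule emeasure_subadditive_finite) (auto intro!: A_meas)
  also have "\<dots> \<le> (\<Sum>a\<le>t. ennreal (u * (R1 / (1 - \<theta>))))"
    by (rule sum_mono, rule pos) simp
  also have "\<dots> = ennreal (real (Suc t) * (u * (R1 / (1 - \<theta>))))"
  proof -
    have "(\<Sum>a\<le>t. ennreal (u * (R1 / (1 - \<theta>)))) = ennreal (\<Sum>a\<le>t. u * (R1 / (1 - \<theta>)))"
      using R0 \<theta> by (intro sum_ennreal) (auto simp: u_def)
    then show ?thesis by simp
  qed
  also have "emeasure M (\<Union>a. A (- int a)) \<le> (\<Sum>a. emeasure M (A (- int a)))"
    by (rule emeasure_subadditive_countably) (auto intro!: A_meas)
  also have "\<dots> \<le> (\<Sum>a. ennreal (u * (R2 * ((\<nu> + \<theta>) / \<nu>)) * \<rho> ^ a))"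
    by (intro suminf_le neg) auto
  also have "\<dots> = ennreal (u * (R2 * ((\<nu> + \<theta>) / \<nu>)) * (1 / (1 - \<rho>)))"
  proof (rule suminf_ennreal_eq)
    show "0 \<le> u * (R2 * ((\<nu> + \<theta>) / \<nu>)) * \<rho> ^ a" for a
      using \<rho> R0 nu \<theta> by (simp add: u_def)
    show "(\<lambda>a. u * (R2 * ((\<nu> + \<theta>) / \<nu>)) * \<rho> ^ a) sums (u * (R2 * ((\<nu> + \<theta>) / \<nu>)) * (1 / (1 - \<rho>)))"
      using \<rho> by (intro sums_mult geometric_sums) auto
  qed
  finally have "ennreal (prob {\<omega> \<in> space M. ereal c \<le> X t \<omega>}) \<le>
      ennreal (real (Suc t) * (u * (R1 / (1 - \<theta>)))) + ennreal (u * (R2 * ((\<nu> + \<theta>) / \<nu>)) * (1 / (1 - \<rho>)))"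
    by (simp add: emeasure_eq_measure add_mono)
  also have "\<dots> = ennreal (real (Suc t) * (u * (R1 / (1 - \<theta>))) + u * (R2 * ((\<nu> + \<theta>) / \<nu>)) * (1 / (1 - \<rho>)))"
    using \<rho> R0 nu \<theta> by (intro ennreal_plus[symmetric]) (auto simp: u_def)
  finally have "prob {\<omega> \<in> space M. ereal c \<le> X t \<omega>} \<le> real (Suc t) * (u * (R1 / (1 - \<theta>))) + u * (R2 * ((\<nu> + \<theta>) / \<nu>)) * (1 / (1 - \<rho>))"
    by (rule ennreal_le_iff[THEN iffD1, rotated]) (use \<rho> R0 nu \<theta> in \<open>auto simp: u_def\<close>)
  also have "\<dots> = u * (real (Suc t) / (1 - \<theta>) * R1 + (\<nu> + \<theta>) / \<nu> / (1 - \<rho>) * R2)"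
  proof -
    have "v * (u * (R1 / p)) + u * (R2 * D) * (1 / q) = u * (v / p * R1 + D / q * R2)" for v p q D :: real
      by (simp add: algebra_simps)
    then show ?thesis .
  qed
  finally show ?thesis by (simp add: u_def R1_def R2_def \<rho>_def)
qed

text \<open>On every grid the discretised system started from levels 1 to t lies below the true one,
  and the oscillation term of \<open>gauss_lower_bound\<close> vanishes as m grows.\<close>

theorem lower_tail:
  fixes \<theta> \<eta> y y1 y2 :: real
  assumes th: "0 < \<eta>" "\<eta> < \<theta>" "\<theta> + \<eta> < 1" and y: "y < y1" "y1 \<le> y2" and t: "0 < t"
  shows "mgf_lim (real t) t (1 - \<theta>) 1 - mgf_lim (real t) t 1 (1 + \<theta>)
      - exp (- \<eta> * y2) * mgf_lim (real t) t (1 - (\<theta> + \<eta>)) 1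
      - exp (\<eta> * y1) * mgf_lim (real t) t (1 - (\<theta> - \<eta>)) 1
    \<le> exp (\<theta> * y2) * prob {\<omega> \<in> space M. ereal y \<le> X t \<omega>}"
proof -
  obtain n where n: "t = Suc n" using t by (cases t) auto
  have T: "0 < real t" using t by simp
  \<comment> \<open>The summand 1 keeps the divisor positive when n = 0, that is, when there is a
    single level.\<close>
  define \<epsilon> where "\<epsilon> = (y1 - y) / (4 * real n + 1) / 2"
  have \<epsilon>: "0 < \<epsilon>" "4 * real n * \<epsilon> < y1 - y"
  proof -
    show "0 < \<epsilon>" using y by (simp add: \<epsilon>_def)
    have "4 * real n * \<epsilon> < (4 * real n + 1) * \<epsilon> * 2" using \<open>0 < \<epsilon>\<close> by (simp add: algebra_simps add_pos_nonneg)
    also have "\<dots> = y1 - y"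
    proof -
      have "4 * real n + 1 \<noteq> 0" by linarith
      then show ?thesis unfolding \<epsilon>_def by (simp only: nonzero_mult_div_cancel_left times_divide_eq_right) simp
    qed
    finally show "4 * real n * \<epsilon> < y1 - y" .
  qed
  let ?l = "mgf_lim (real t) t (1 - \<theta>) 1 - mgf_lim (real t) t 1 (1 + \<theta>)
      - exp (- \<eta> * y2) * mgf_lim (real t) t (1 - (\<theta> + \<eta>)) 1
      - exp (\<eta> * y1) * mgf_lim (real t) t (1 - (\<theta> - \<eta>)) 1"
  let ?e = "\<lambda>m. 2 * real (Suc n) * real m * exp (2 * real t - sqrt (real m) * \<epsilon>)"
  let ?P = "prob {\<omega> \<in> space M. ereal y \<le> X t \<omega>}"
  have meas: "{\<omega> \<in> space M. ereal y \<le> X t \<omega>} \<in> events"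
    using measurable_reflected_system[OF T, of "int t"] by measurable
  have "?l \<le> exp (\<theta> * y2) * (?P + ?e m)" if m: "0 < m" for m
  proof -
    let ?Q = "prob {\<omega> \<in> space M. y \<le> pass (\<lambda>i. x0 (1 + int i) \<omega>) (grid_incr 1 (real t / real m) \<omega>) n m}"
    have "?l \<le> exp (\<theta> * y2) * (?Q + ?e m)"
      using gauss_lower_bound[OF T m th y(2) \<epsilon>] unfolding prob_grid[OF T m] n[symmetric] .
    also have "?Q \<le> ?P"
    proof (rule finite_measure_mono[OF _ meas], rule subsetI)
      fix \<omega> assume \<omega>: "\<omega> \<in> {\<omega> \<in> space M. y \<le> pass (\<lambda>i. x0 (1 + int i) \<omega>) (grid_incr 1 (real t / real m) \<omega>) n m}"
      have "ereal (pass (\<lambda>i. x0 (1 + int i) \<omega>) (grid_incr 1 (real t / real m) \<omega>) n m) \<le>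
          reflected_system (\<lambda>k. x0 k \<omega>) (\<lambda>n s. B n s \<omega>) (1 + int n) (real m * (real t / real m))"
        by (rule pass_le_reflected_system) simp
      also have "\<dots> = X t \<omega>" using m by (simp add: n)
      finally have "ereal (pass (\<lambda>i. x0 (1 + int i) \<omega>) (grid_incr 1 (real t / real m) \<omega>) n m) \<le> X t \<omega>" .
      moreover have "ereal y \<le> ereal (pass (\<lambda>i. x0 (1 + int i) \<omega>) (grid_incr 1 (real t / real m) \<omega>) n m)"
        using \<omega> by simp
      ultimately show "\<omega> \<in> {\<omega> \<in> space M. ereal y \<le> X t \<omega>}"
        using \<omega> order_trans by blast
    qed
    finally show ?thesis by simp
  qed
  then have "\<forall>\<^sub>F m in sequentially. ?l \<le> exp (\<theta> * y2) * (?P + ?e m)"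
    using eventually_gt_at_top[of 0] by (rule eventually_mono[rotated])
  moreover have "(\<lambda>m. exp (\<theta> * y2) * (?P + ?e m)) \<longlonglongrightarrow> exp (\<theta> * y2) * (?P + 0)"
  proof -
    have "?e \<longlonglongrightarrow> 0" using \<epsilon>(1) by real_asymp
    then show ?thesis by (intro tendsto_intros)
  qed
  ultimately have "?l \<le> exp (\<theta> * y2) * (?P + 0)"
    by (intro tendsto_lowerbound[of "\<lambda>m. exp (\<theta> * y2) * (?P + ?e m)" _ sequentially]) auto
  then show ?thesis by simp
qed

end

section \<open>The rate\<close>

text \<open>Exponent per unit time of \<open>mgf_lim\<close> when both the time and the number of
  levels are t.\<close>

definition cgf :: "real \<Rightarrow> real \<Rightarrow> real" where
  "cgf \<nu> la = (la\<^sup>2 - \<nu>\<^sup>2) / 2 + ln (la / \<nu>)"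

lemma mgf_lim_eq_exp:
  assumes "0 < \<nu>" "0 < la"
  shows "mgf_lim (real t) t \<nu> la = exp (real t * cgf \<nu> la)"
proof -
  have "exp (real t * ln (la / \<nu>)) = (la / \<nu>) ^ t"
    using assms by (simp add: exp_of_nat_mult)
  then show ?thesis
    by (simp add: mgf_lim_def cgf_def distrib_left exp_add)
qed

text \<open>The difference of the two sides is - \<theta>^2 - ln (1 - \<theta>^2), positive by ln u
  < u - 1 for u < 1. This gap makes negligible both the paths through row 0 in the lower bound and
  the starting levels - a in the upper bound.\<close>

lemma cgf_right_less:
  assumes "0 < \<theta>" "\<theta> < 1"
  shows "cgf 1 (1 + \<theta>) < cgf (1 - \<theta>) 1"
proof -
  have "\<theta>\<^sup>2 < 1" "0 < \<theta>\<^sup>2" using assms by (simp_all add: power_less_one_iff abs_square_less_1)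
  then have "ln (1 - \<theta>\<^sup>2) < - \<theta>\<^sup>2"
    using ln_le_minus_one[of "1 - \<theta>\<^sup>2"] ln_eq_minus_one[of "1 - \<theta>\<^sup>2"] by fastforce
  moreover have "1 - \<theta>\<^sup>2 = (1 + \<theta>) * (1 - \<theta>)" by (simp add: algebra_simps power2_eq_square)
  then have "ln (1 - \<theta>\<^sup>2) = ln (1 + \<theta>) + ln (1 - \<theta>)" using assms by (simp add: ln_mult)
  ultimately have "ln (1 + \<theta>) + ln (1 - \<theta>) < - \<theta>\<^sup>2" by simp
  moreover have "cgf 1 (1 + \<theta>) = \<theta> + \<theta>\<^sup>2 / 2 + ln (1 + \<theta>)"
    by (simp add: cgf_def power2_eq_square field_simps)
  moreover have "cgf (1 - \<theta>) 1 = \<theta> - \<theta>\<^sup>2 / 2 - ln (1 - \<theta>)"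
    using assms by (simp add: cgf_def ln_div power2_eq_square field_simps)
  ultimately show ?thesis by linarith
qed

text \<open>The stationary point in the Legendre transform of \<theta> |-> cgf (1 - \<theta>) 1 at 2
  + a: the number 1 - \<theta> is the smaller root of u + 1 / u = 2 + a.\<close>

definition \<theta>_opt :: "real \<Rightarrow> real" where
  "\<theta>_opt a = sqrt (a + a\<^sup>2 / 4) - a / 2"

lemma \<theta>_opt:
  assumes "0 < a"
  shows "0 < \<theta>_opt a" "\<theta>_opt a < 1" "(1 - \<theta>_opt a) + 1 / (1 - \<theta>_opt a) = 2 + a"
    "\<theta>_opt a * (2 + a) - cgf (1 - \<theta>_opt a) 1 = r_stat a"
proof -
  define s where "s = sqrt (a + a\<^sup>2 / 4)"
  have s2: "s\<^sup>2 = a + a\<^sup>2 / 4" using assms by (simp add: s_def)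
  have s0: "0 < s" using assms by (simp add: s_def add_pos_nonneg)
  have th: "\<theta>_opt a = s - a / 2" by (simp add: \<theta>_opt_def s_def)
  have "(a / 2)\<^sup>2 < s\<^sup>2" unfolding s2 using assms by (simp add: power2_eq_square)
  then show p: "0 < \<theta>_opt a" unfolding th using power_less_imp_less_base[of "a / 2" 2 s] s0 by simp
  have "s\<^sup>2 < (1 + a / 2)\<^sup>2" unfolding s2 by (simp add: power2_eq_square algebra_simps)
  then show l: "\<theta>_opt a < 1" unfolding th using power_less_imp_less_base[of s 2 "1 + a / 2"] assms by simp
  \<comment> \<open>The two roots of u + 1 / u = 2 + a have product 1, so the reciprocal of one is
    the other.\<close>
  have "(1 + a / 2 - s) * (1 + a / 2 + s) = 1"
    using s2 by (simp add: algebra_simps power2_eq_square)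
  moreover have "1 - \<theta>_opt a = 1 + a / 2 - s" by (simp add: th)
  ultimately have "(1 - \<theta>_opt a) * (1 + a / 2 + s) = 1" by (simp only:)
  moreover have "1 / v = w" if "v * w = 1" for v w :: real
    using that by (auto simp: divide_eq_eq mult.commute)
  ultimately have "1 / (1 - \<theta>_opt a) = 1 + a / 2 + s" by blast
  then show "(1 - \<theta>_opt a) + 1 / (1 - \<theta>_opt a) = 2 + a" by (simp add: th)
  have "ln (1 / (1 - \<theta>_opt a)) = - ln (1 - \<theta>_opt a)" using l by (simp add: ln_div)
  then have "\<theta>_opt a * (2 + a) - cgf (1 - \<theta>_opt a) 1 =
      \<theta>_opt a * (2 + a) - (1 - (1 - \<theta>_opt a)\<^sup>2) / 2 + ln (1 - \<theta>_opt a)"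
    by (simp add: cgf_def)
  also have "\<theta>_opt a * (2 + a) - (1 - (1 - \<theta>_opt a)\<^sup>2) / 2 = - (a\<^sup>2 / 4) + (1 + a / 2) * s"
    using s2 by (simp add: th power2_eq_square field_simps)
  finally have "\<theta>_opt a * (2 + a) - cgf (1 - \<theta>_opt a) 1 = - (a\<^sup>2 / 4) + (1 + a / 2) * s + ln (1 - \<theta>_opt a)" .
  moreover have "r_stat a = - (a\<^sup>2 / 4) + (1 + a / 2) * s + ln (1 - \<theta>_opt a)"
    unfolding r_stat_def s_def th by (simp add: algebra_simps)
  ultimately show "\<theta>_opt a * (2 + a) - cgf (1 - \<theta>_opt a) 1 = r_stat a" by (simp only:)
qed

lemma cgf_deriv:
  assumes "\<theta> < 1"
  shows "((\<lambda>\<theta>. cgf (1 - \<theta>) 1) has_real_derivative (1 - \<theta>) + 1 / (1 - \<theta>)) (at \<theta>)"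
proof -
  have "((\<lambda>\<theta>. (1 - (1 - \<theta>)\<^sup>2) / 2 - ln (1 - \<theta>)) has_real_derivative (1 - \<theta>) + 1 / (1 - \<theta>)) (at \<theta>)"
    using assms by (auto intro!: derivative_eq_intros simp: field_simps)
  moreover have "\<forall>\<^sub>F x in nhds \<theta>. (1 - (1 - x)\<^sup>2) / 2 - ln (1 - x) = cgf (1 - x) 1"
  proof -
    have "\<forall>\<^sub>F x in nhds \<theta>. x \<in> {..<1}" by (rule eventually_nhds_in_open) (use assms in auto)
    then show ?thesis by eventually_elim (simp add: cgf_def ln_div)
  qed
  ultimately show ?thesis
    by (subst DERIV_cong_ev[OF refl _ refl, of _ "\<lambda>\<theta>. (1 - (1 - \<theta>)\<^sup>2) / 2 - ln (1 - \<theta>)"])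
       (auto simp: eq_commute)
qed

context stationary_rbm
begin

abbreviation tail :: "real \<Rightarrow> nat \<Rightarrow> real" where
  "tail a t \<equiv> prob {\<omega> \<in> space M. ereal (2 * real t + a * real t) \<le> X t \<omega>}"

text \<open>For \<theta> slightly above the optimum the slope x \<theta> of \<Lambda> exceeds 2 + a,
  so a window around x \<theta> t lies entirely above the level 2 t + a t. Under the tilt by
  \<theta> the mass concentrates in this window, and by continuity the cost exceeds
  \<open>r_stat a\<close> by less than e.\<close>

lemma tail_eventually_ge:
  assumes a: "0 < a" and e: "0 < e"
  shows "\<forall>\<^sub>F t in sequentially. exp (- (r_stat a + e) * real t) / 2 \<le> tail a t"
proof -
  define x where "x \<theta> = (1 - \<theta>) + 1 / (1 - \<theta>)" for \<theta> :: real
  define \<Lambda> where "\<Lambda> \<theta> = cgf (1 - \<theta>) 1" for \<theta>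
  \<comment> \<open>Half the distance from the slope to 2 + a: the window stays above the level, and
    \<delta> vanishes at the optimum, so that the cost there is exactly
    \<open>r_stat a\<close>.\<close>
  define \<delta> where "\<delta> \<theta> = (x \<theta> - (2 + a)) / 2" for \<theta>
  let ?\<theta>0 = "\<theta>_opt a"
  note opt = \<theta>_opt[OF a]
  have x0: "x ?\<theta>0 = 2 + a" using opt(3) by (simp add: x_def)
  have \<Lambda>: "(\<Lambda> has_real_derivative x \<theta>) (at \<theta>)" if "\<theta> < 1" for \<theta>
    using cgf_deriv[OF that] by (simp add: \<Lambda>_def[abs_def] x_def)
  have "isCont (\<lambda>\<theta>. \<theta> * (x \<theta> + \<delta> \<theta>) - \<Lambda> \<theta>) ?\<theta>0"
    using DERIV_isCont[OF \<Lambda>[OF opt(2)]] opt(2) unfolding \<delta>_def x_def by (intro continuous_intros) auto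
  then have "((\<lambda>\<theta>. \<theta> * (x \<theta> + \<delta> \<theta>) - \<Lambda> \<theta>) \<longlongrightarrow> ?\<theta>0 * (x ?\<theta>0 + \<delta> ?\<theta>0) - \<Lambda> ?\<theta>0) (at_right ?\<theta>0)"
    unfolding isCont_def by (rule tendsto_mono[OF at_le[OF subset_UNIV]])
  moreover have "?\<theta>0 * (x ?\<theta>0 + \<delta> ?\<theta>0) - \<Lambda> ?\<theta>0 = r_stat a"
    using opt(4) by (simp add: x0 \<delta>_def \<Lambda>_def)
  ultimately have "((\<lambda>\<theta>. \<theta> * (x \<theta> + \<delta> \<theta>) - \<Lambda> \<theta>) \<longlongrightarrow> r_stat a) (at_right ?\<theta>0)"
    by (simp only:)
  from order_tendstoD(2)[OF this, of "r_stat a + e"] e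
  have "\<forall>\<^sub>F \<theta> in at_right ?\<theta>0. \<theta> * (x \<theta> + \<delta> \<theta>) - \<Lambda> \<theta> < r_stat a + e" by simp
  moreover have "\<forall>\<^sub>F \<theta> in at_right ?\<theta>0. \<theta> < 1 \<and> ?\<theta>0 < \<theta>"
    using opt(2) eventually_at_right_field by blast
  ultimately have "\<forall>\<^sub>F \<theta> in at_right ?\<theta>0. \<theta> * (x \<theta> + \<delta> \<theta>) - \<Lambda> \<theta> < r_stat a + e \<and> \<theta> < 1 \<and> ?\<theta>0 < \<theta>"
    by eventually_elim simp
  then obtain \<theta> where \<theta>: "\<theta> * (x \<theta> + \<delta> \<theta>) - \<Lambda> \<theta> < r_stat a + e" "\<theta> < 1" "?\<theta>0 < \<theta>"
    using eventually_happens[of _ "at_right ?\<theta>0"] by (auto simp: trivial_limit_at_right_real)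
  have \<theta>0: "0 < \<theta>" using \<theta>(3) opt(1) by simp
  have xa: "2 + a < x \<theta>"
  proof -
    \<comment> \<open>u + 1 / u is strictly decreasing on (0, 1).\<close>
    define u v where "u = 1 - \<theta>" and "v = 1 - ?\<theta>0"
    have uv: "0 < u" "u < v" "v < 1" using \<theta> opt by (auto simp: u_def v_def)
    then have "u * v < 1" by (metis less_trans mult_strict_mono mult_1 zero_less_one less_imp_le)
    then have "0 < (v - u) * (1 - u * v) / (u * v)" using uv by simp
    also have "\<dots> = (u + 1 / u) - (v + 1 / v)" using uv by (simp add: field_simps)
    finally show ?thesis using opt(3) by (simp add: u_def v_def x_def)
  qed
  then have \<delta>0: "0 < \<delta> \<theta>" by (simp add: \<delta>_def)
  have "(\<lambda>h. (\<Lambda> (\<theta> + h) - \<Lambda> \<theta>) / h) \<midarrow>0\<rightarrow> x \<theta>"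
    using DERIV_D[OF \<Lambda>[OF \<theta>(2)]] .
  then have "\<forall>\<^sub>F h in at 0. dist ((\<Lambda> (\<theta> + h) - \<Lambda> \<theta>) / h) (x \<theta>) < \<delta> \<theta>"
    using \<delta>0 by (rule tendstoD)
  then obtain d where d: "0 < d" "\<And>h. h \<noteq> 0 \<Longrightarrow> \<bar>h\<bar> < d \<Longrightarrow> \<bar>(\<Lambda> (\<theta> + h) - \<Lambda> \<theta>) / h - x \<theta>\<bar> < \<delta> \<theta>"
    by (auto simp: eventually_at dist_real_def)
  \<comment> \<open>Small enough for the estimate of the difference quotient on both sides of
    \<theta>, with \<theta> - \<eta> and \<theta> + \<eta> still inside (0, 1).\<close>
  define \<eta> where "\<eta> = min (d / 2) (min (\<theta> / 2) ((1 - \<theta>) / 2))"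
  have \<eta>: "0 < \<eta>" "\<eta> < \<theta>" "\<theta> + \<eta> < 1" "\<eta> < d"
    using d(1) \<theta>(2) \<theta>0 by (auto simp: \<eta>_def min_def field_simps)
  have c2: "\<Lambda> (\<theta> + \<eta>) < \<Lambda> \<theta> + \<eta> * (x \<theta> + \<delta> \<theta>)"
  proof -
    have "(\<Lambda> (\<theta> + \<eta>) - \<Lambda> \<theta>) / \<eta> < x \<theta> + \<delta> \<theta>" using d(2)[of \<eta>] \<eta> by (auto simp: abs_less_iff)
    then show ?thesis using \<eta>(1) by (simp add: divide_less_eq algebra_simps)
  qed
  have c3: "\<Lambda> (\<theta> - \<eta>) < \<Lambda> \<theta> - \<eta> * (x \<theta> - \<delta> \<theta>)"
  proof -
    have "(\<Lambda> (\<theta> + - \<eta>) - \<Lambda> \<theta>) / (- \<eta>) > x \<theta> - \<delta> \<theta>" using d(2)[of "- \<eta>"] \<eta> by (auto simp: abs_less_iff)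
    then have "(\<Lambda> \<theta> - \<Lambda> (\<theta> - \<eta>)) / \<eta> > x \<theta> - \<delta> \<theta>" by (simp add: minus_divide_left)
    then show ?thesis using \<eta>(1) by (simp add: less_divide_eq algebra_simps)
  qed
  \<comment> \<open>Exponents, relative to the main term exp (t \<Lambda> \<theta>), of the three
    subtracted contributions: paths through row 0, values above the window, values below it.\<close>
  define c1 where "c1 = cgf 1 (1 + \<theta>) - \<Lambda> \<theta>"
  define d2 where "d2 = \<Lambda> (\<theta> + \<eta>) - \<Lambda> \<theta> - \<eta> * (x \<theta> + \<delta> \<theta>)"
  define d3 where "d3 = \<Lambda> (\<theta> - \<eta>) - \<Lambda> \<theta> + \<eta> * (x \<theta> - \<delta> \<theta>)"
  have neg: "c1 < 0" "d2 < 0" "d3 < 0"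
    using cgf_right_less[OF \<theta>0 \<theta>(2)] c2 c3 by (auto simp: c1_def d2_def d3_def \<Lambda>_def)
  have "(\<lambda>t::nat. exp (real t * c)) \<longlonglongrightarrow> 0" if "c < 0" for c :: real
    using that by real_asymp
  then have "(\<lambda>t::nat. exp (real t * c1) + exp (real t * d2) + exp (real t * d3)) \<longlonglongrightarrow> 0 + 0 + 0"
    using neg by (intro tendsto_add) auto
  then have "\<forall>\<^sub>F t in sequentially. exp (real t * c1) + exp (real t * d2) + exp (real t * d3) < 1 / 2"
    by (rule order_tendstoD(2)) simp
  then show ?thesis
    using eventually_gt_at_top[of 0]
  proof eventually_elim
    case (elim t)
    let ?y1 = "(x \<theta> - \<delta> \<theta>) * real t" and ?y2 = "(x \<theta> + \<delta> \<theta>) * real t"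
    have mg: "mgf_lim (real t) t (1 - v) 1 = exp (real t * \<Lambda> v)" if "v < 1" for v
      unfolding \<Lambda>_def by (rule mgf_lim_eq_exp) (use that in auto)
    have mg2: "mgf_lim (real t) t 1 (1 + \<theta>) = exp (real t * cgf 1 (1 + \<theta>))"
      by (rule mgf_lim_eq_exp) (use \<theta>0 in auto)
    have "mgf_lim (real t) t (1 - \<theta>) 1 - mgf_lim (real t) t 1 (1 + \<theta>)
        - exp (- \<eta> * ?y2) * mgf_lim (real t) t (1 - (\<theta> + \<eta>)) 1
        - exp (\<eta> * ?y1) * mgf_lim (real t) t (1 - (\<theta> - \<eta>)) 1
      \<le> exp (\<theta> * ?y2) * tail a t"
    proof (rule lower_tail)
      have "2 + a < x \<theta> - \<delta> \<theta>" using xa by (simp add: \<delta>_def field_simps)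
      then have "(2 + a) * real t < ?y1" using elim(2) by (intro mult_strict_right_mono) auto
      then show "2 * real t + a * real t < ?y1" by (simp add: distrib_right)
      show "?y1 \<le> ?y2" using \<delta>0 by (intro mult_right_mono) auto
    qed (use \<eta> elim in auto)
    also have "mgf_lim (real t) t (1 - \<theta>) 1 - mgf_lim (real t) t 1 (1 + \<theta>)
        - exp (- \<eta> * ?y2) * mgf_lim (real t) t (1 - (\<theta> + \<eta>)) 1
        - exp (\<eta> * ?y1) * mgf_lim (real t) t (1 - (\<theta> - \<eta>)) 1 =
        exp (real t * \<Lambda> \<theta>) * (1 - (exp (real t * c1) + exp (real t * d2) + exp (real t * d3)))"
    proof -
      have "exp (real t * \<Lambda> \<theta>) * exp (real t * c1) = exp (real t * cgf 1 (1 + \<theta>))"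
        "exp (real t * \<Lambda> \<theta>) * exp (real t * d2) = exp (- \<eta> * ?y2) * exp (real t * \<Lambda> (\<theta> + \<eta>))"
        "exp (real t * \<Lambda> \<theta>) * exp (real t * d3) = exp (\<eta> * ?y1) * exp (real t * \<Lambda> (\<theta> - \<eta>))"
        unfolding exp_add[symmetric] by (simp_all add: c1_def d2_def d3_def algebra_simps)
      then show ?thesis
        using mg[of \<theta>] mg[of "\<theta> + \<eta>"] mg[of "\<theta> - \<eta>"] mg2 \<theta> \<eta> by (simp add: algebra_simps)
    qed
    finally have "exp (real t * \<Lambda> \<theta>) * (1 / 2) \<le> exp (\<theta> * ?y2) * tail a t"
      by (rule order_trans[rotated]) (use elim(1) in \<open>auto intro!: mult_left_mono\<close>)
    then have "exp (- (\<theta> * ?y2)) * (exp (real t * \<Lambda> \<theta>) * (1 / 2)) \<le> exp (- (\<theta> * ?y2)) * (exp (\<theta> * ?y2) * tail a t)"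
      by (intro mult_left_mono) auto
    also have "\<dots> = tail a t" by (simp add: mult.assoc[symmetric] exp_add[symmetric])
    also have "exp (- (\<theta> * ?y2)) * (exp (real t * \<Lambda> \<theta>) * (1 / 2)) = exp (- (\<theta> * (x \<theta> + \<delta> \<theta>) - \<Lambda> \<theta>) * real t) / 2"
    proof -
      have "- (\<theta> * ?y2) + real t * \<Lambda> \<theta> = - (\<theta> * (x \<theta> + \<delta> \<theta>) - \<Lambda> \<theta>) * real t"
        by (simp add: algebra_simps)
      then have "exp (- (\<theta> * ?y2)) * exp (real t * \<Lambda> \<theta>) = exp (- (\<theta> * (x \<theta> + \<delta> \<theta>) - \<Lambda> \<theta>) * real t)"
        by (simp only: exp_add[symmetric])
      then show ?thesis by (simp only: mult.assoc[symmetric])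
    qed
    finally have *: "exp (- (\<theta> * (x \<theta> + \<delta> \<theta>) - \<Lambda> \<theta>) * real t) / 2 \<le> tail a t" .
    have "- (r_stat a + e) * real t \<le> - (\<theta> * (x \<theta> + \<delta> \<theta>) - \<Lambda> \<theta>) * real t"
      using \<theta>(1) by (intro mult_right_mono) auto
    then have "exp (- (r_stat a + e) * real t) / 2 \<le> exp (- (\<theta> * (x \<theta> + \<delta> \<theta>) - \<Lambda> \<theta>) * real t) / 2"
      by simp
    with * show ?case by linarith
  qed
qed

text \<open>At the optimal \<theta> the leading exponent is \<open>- r_stat a\<close>. The strict
  gap of \<open>cgf_right_less\<close> at \<nu> = 1 persists for some \<nu> > 1 by continuity, which
  keeps the series over the levels - a both convergent and of smaller order. The linear prefactor
  counts the t + 1 nonnegative starting levels.\<close>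

lemma tail_le:
  assumes a: "0 < a"
  shows "\<exists>C D. 0 < C \<and> 0 < D \<and> (\<forall>t>0. tail a t \<le> (C * real t + D) * exp (- r_stat a * real t))"
proof -
  define \<theta> where "\<theta> = \<theta>_opt a"
  note opt = \<theta>_opt[OF a, folded \<theta>_def]
  have "isCont (\<lambda>\<nu>. cgf \<nu> (\<nu> + \<theta>)) 1"
    unfolding cgf_def using opt by (intro continuous_intros) auto
  then have "((\<lambda>\<nu>. cgf \<nu> (\<nu> + \<theta>)) \<longlongrightarrow> cgf 1 (1 + \<theta>)) (at_right 1)"
    unfolding isCont_def by (rule tendsto_mono[OF at_le[OF subset_UNIV]])
  from order_tendstoD(2)[OF this cgf_right_less[OF opt(1,2)]]
  have "\<forall>\<^sub>F \<nu> in at_right 1. cgf \<nu> (\<nu> + \<theta>) < cgf (1 - \<theta>) 1" .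
  moreover have "\<forall>\<^sub>F \<nu> in at_right (1::real). 1 < \<nu>" by (rule eventually_at_right_less)
  ultimately have "\<forall>\<^sub>F \<nu> in at_right 1. cgf \<nu> (\<nu> + \<theta>) < cgf (1 - \<theta>) 1 \<and> 1 < \<nu>"
    by eventually_elim simp
  then obtain \<nu> where nu: "cgf \<nu> (\<nu> + \<theta>) < cgf (1 - \<theta>) 1" "1 < \<nu>"
    using eventually_happens[of _ "at_right (1::real)"] by (auto simp: trivial_limit_at_right_real)
  define E where "E = (\<nu> + \<theta>) / \<nu> / (1 - (\<nu> + \<theta>) / \<nu> / (1 + \<theta>))"
  have E: "0 \<le> E"
  proof -
    have "\<nu> + \<theta> \<le> \<nu> * (1 + \<theta>)" using nu opt by (simp add: algebra_simps)
    then have "(\<nu> + \<theta>) / \<nu> / (1 + \<theta>) \<le> 1" using nu opt by (simp add: divide_le_eq mult.commute)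
    then show ?thesis using nu opt by (simp add: E_def)
  qed
  show ?thesis
  proof (intro exI conjI allI impI)
    show "0 < exp \<theta> / (1 - \<theta>)" using opt by simp
    show "0 < exp \<theta> * (1 / (1 - \<theta>) + E)" using opt E by (simp add: add_pos_nonneg)
    fix t :: nat assume t: "0 < t"
    let ?c = "2 * real t + a * real t"
    have "tail a t \<le> exp (- \<theta> * (?c - 1)) * (real (Suc t) / (1 - \<theta>) * mgf_lim (real t) t (1 - \<theta>) 1 + E * mgf_lim (real t) t \<nu> (\<nu> + \<theta>))"
      unfolding E_def by (rule upper_tail) (use t opt nu in auto)
    also have "\<dots> \<le> exp (- \<theta> * (?c - 1)) * (real (Suc t) / (1 - \<theta>) * exp (real t * cgf (1 - \<theta>) 1) + E * exp (real t * cgf (1 - \<theta>) 1))"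
    proof (intro mult_left_mono add_mono)
      show "mgf_lim (real t) t (1 - \<theta>) 1 \<le> exp (real t * cgf (1 - \<theta>) 1)"
        using opt by (simp add: mgf_lim_eq_exp)
      show "mgf_lim (real t) t \<nu> (\<nu> + \<theta>) \<le> exp (real t * cgf (1 - \<theta>) 1)"
        using nu opt by (simp add: mgf_lim_eq_exp mult_left_mono)
    qed (use E opt in auto)
    also have "\<dots> = (exp (- \<theta> * (?c - 1)) * exp (real t * cgf (1 - \<theta>) 1)) * (real (Suc t) / (1 - \<theta>) + E)"
      by (simp add: algebra_simps)
    also have "exp (- \<theta> * (?c - 1)) * exp (real t * cgf (1 - \<theta>) 1) = exp \<theta> * exp (- r_stat a * real t)"
      unfolding exp_add[symmetric] opt(4)[symmetric] by (simp add: algebra_simps)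
    also have "exp \<theta> * exp (- r_stat a * real t) * (real (Suc t) / (1 - \<theta>) + E) =
        (exp \<theta> / (1 - \<theta>) * real t + exp \<theta> * (1 / (1 - \<theta>) + E)) * exp (- r_stat a * real t)"
      by (simp add: add_divide_distrib algebra_simps)
    finally show "tail a t \<le> (exp \<theta> / (1 - \<theta>) * real t + exp \<theta> * (1 / (1 - \<theta>) + E)) * exp (- r_stat a * real t)" .
  qed
qed

lemma tail_rate:
  assumes a: "0 < a"
  shows "(\<lambda>t. ln (tail a t) / real t) \<longlonglongrightarrow> - r_stat a"
proof (rule LIMSEQ_I)
  fix e :: real assume e: "0 < e"
  obtain C D where CD: "0 < C" "0 < D" "\<And>t. 0 < t \<Longrightarrow> tail a t \<le> (C * real t + D) * exp (- r_stat a * real t)"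
    using tail_le[OF a] by blast
  have "(\<lambda>t::nat. ln (C * real t + D) / real t) \<longlonglongrightarrow> 0" using CD by real_asymp
  then have ev1: "\<forall>\<^sub>F t in sequentially. ln (C * real t + D) / real t < e"
    using e by (rule order_tendstoD)
  have "(\<lambda>t::nat. ln 2 / real t) \<longlonglongrightarrow> 0" by real_asymp
  then have ev2: "\<forall>\<^sub>F t in sequentially. ln 2 / real t < e / 2"
    by (rule order_tendstoD) (use e in simp)
  have "\<forall>\<^sub>F t in sequentially. norm (ln (tail a t) / real t - - r_stat a) < e"
    using ev1 ev2 tail_eventually_ge[OF a half_gt_zero[OF e]] eventually_gt_at_top[of 0]
  proof eventually_elim
    case (elim t)
    have lower: "exp (- (r_stat a + e / 2) * real t) / 2 \<le> tail a t" using elim e by simp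
    \<comment> \<open>Positivity of the probability comes from the lower bound; without it the
      logarithms could not be compared.\<close>
    have pos: "0 < tail a t" by (rule less_le_trans[OF _ lower]) simp
    have t: "0 < real t" using elim by simp
    have "ln (exp (- (r_stat a + e / 2) * real t) / 2) \<le> ln (tail a t)"
      using lower pos by (subst ln_le_cancel_iff) auto
    then have l1: "- (r_stat a + e / 2) * real t - ln 2 \<le> ln (tail a t)"
      by (simp add: ln_div)
    have "ln (tail a t) \<le> ln ((C * real t + D) * exp (- r_stat a * real t))"
      using CD(3)[of t] pos elim by (subst ln_le_cancel_iff) auto
    also have "\<dots> = ln (C * real t + D) - r_stat a * real t"
    proof -
      have "0 < C * real t + D" using CD(1,2) t by (simp add: add_pos_pos)
      then show ?thesis by (simp add: ln_mult)
    qed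
    finally have l2: "ln (tail a t) \<le> ln (C * real t + D) - r_stat a * real t" .
    have "ln (tail a t) / real t \<le> (ln (C * real t + D) - r_stat a * real t) / real t"
      using l2 t by (intro divide_right_mono) auto
    then have u: "ln (tail a t) / real t - - r_stat a < e"
      using elim(1) t by (simp add: diff_divide_distrib)
    have "(- (r_stat a + e / 2) * real t - ln 2) / real t \<le> ln (tail a t) / real t"
      using l1 t by (intro divide_right_mono) auto
    then have "- e < ln (tail a t) / real t - - r_stat a"
      using elim(2) t by (simp add: diff_divide_distrib)
    with u show ?case by (simp add: abs_less_iff)
  qed
  then show "\<exists>no. \<forall>t\<ge>no. norm (ln (tail a t) / real t - - r_stat a) < e"
    by (simp add: eventually_sequentially)
qed

end

theorem theorem3:
  fixes M :: "'a measure"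
    and B :: "int \<Rightarrow> real \<Rightarrow> 'a \<Rightarrow> real"
    and \<zeta> :: "int \<Rightarrow> 'a \<Rightarrow> real"
    and x0 :: "int \<Rightarrow> 'a \<Rightarrow> real"
    and a :: real
  assumes "prob_space M"
    and "\<And>n. standard_brownian_motion M (B n)"
    and "prob_space.indep_vars M (\<lambda>_. path_space) (\<lambda>n. trajectory (B n)) UNIV"
    and "\<And>n. distributed M lborel (\<zeta> n) (exponential_density 1)"
    and "prob_space.indep_vars M (\<lambda>_. borel) \<zeta> UNIV"
    and "prob_space.indep_set M
           (sets (vimage_algebra (space M) (\<lambda>\<omega> n. \<zeta> n \<omega>) (PiM UNIV (\<lambda>_. borel))))
           (sets (vimage_algebra (space M) (\<lambda>\<omega> n. trajectory (B n) \<omega>) (PiM UNIV (\<lambda>_. path_space))))"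
    and "\<And>\<omega>. \<omega> \<in> space M \<Longrightarrow> x0 0 \<omega> = 0"
    and "\<And>n \<omega>. \<omega> \<in> space M \<Longrightarrow> x0 n \<omega> - x0 (n - 1) \<omega> = \<zeta> n \<omega>"
    and "a > 0"
  shows "(\<lambda>t::nat. ln (measure M {\<omega> \<in> space M.
             reflected_system (\<lambda>n. x0 n \<omega>) (\<lambda>n s. B n s \<omega>) (int t) (real t)
               \<ge> ereal (2 * real t + a * real t)}) / real t)
         \<longlonglongrightarrow> - r_stat a"
proof -
  interpret stationary_rbm M B \<zeta> x0
    by (intro stationary_rbm.intro stationary_rbm_axioms.intro assms)
  show ?thesis by (rule tail_rate) (rule assms)
qed

end
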